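(* Let $u$ be the mild solution of the one-dimensional stochastic wave equation with zero initial conditions driven by the fractional-white noise $W^H$, and fix $x\in\mathbb R$. For $N\ge2$ define, from the observations $u(\frac iN,x)$, $i=0,\dots,N$, $$\hat H_N=-\frac{\log4+\log\left(\frac1N\sum_{i=0}^{N-1}\left(u\left(\frac{i+1}{N},x\right)-u\left(\frac iN,x\right)\right)^2\right)}{2\log N}.$$ If $\frac12\le H<\frac34$, then $\hat H_N$ is a strongly consistent and asymptotically normal estimator of $H$ (as $N\to\infty$). If $\frac34<H<1$, then $\hat H_N$ is a strongly consistent estimator of $H$.
   Context: The equation is $\partial_t^2u=\partial_x^2u+\dot W^H$ for $t\ge0$, $x\in\mathbb R$, with $u(0,x)=0$ and $\partial_tu(0,x)=0$. The noise $W^H$ is centred Gaussian, fractional in time with Hurst parameter $H$ and white in space: the Wiener integrals of deterministic functions $f,g$ on $[0,\infty)\times\mathbb R$ are jointly centred Gaussian with $$\mathbb E\Big[\int f\,dW^H\int g\,dW^H\Big]=H(2H-1)\int_0^\infty\!\int_0^\infty\!\int_{\mathbb R}f(r,y)g(v,y)|r-v|^{2H-2}\,dy\,dv\,dr\quad\text{if } H>\tfrac12,$$ and $=\int_0^\infty\int_{\mathbb R}f(r,y)g(r,y)\,dy\,dr$ if $H=\frac12$. The mild solution is the centred Gaussian field $u(t,x)=\int_0^t\int_{\mathbb R}G_1(t-r,x-y)\,W^H(dr,dy)$ with $G_1(t,x)=\frac12\mathbf 1_{\{|x|<t\}}$. An estimator $\hat\theta_N$ of $\theta$ is strongly consistent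 if $\hat\theta_N\to\theta$ almost surely as $N\to\infty$; it is asymptotically normal if there are deterministic $a_N\to\infty$ (possibly depending on the true parameter) such that $a_N(\hat\theta_N-\theta)$ converges in distribution to a normal law with strictly positive variance. *)

theory Defs
  imports "HOL-Probability.Probability"
begin

text \<open>Deterministic integrands and the noise live on $[0,\infty) \times \mathbb{R}$. Integrands are
  total functions of (time, space), but only their values at nonnegative times enter.\<close>

text \<open>For \<open>H > 1/2\<close> absolute convergence is required, so that the covariance below, an
  iterated Bochner integral, does not depend on the order of integration.\<close>

definition noise_integrands :: "real \<Rightarrow> (real \<times> real \<Rightarrow> real) set" where
  "noise_integrands H = {f \<in> borel_measurable borel.
     (if H = 1/2
      then (\<integral>\<^sup>+ r\<in>{0..}. (\<integral>\<^sup>+ y. ennreal ((f (r, y))\<^sup>2) \<partial>lborel) \<partial>lborel) < \<infinity>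
      else (\<integral>\<^sup>+ r\<in>{0..}. (\<integral>\<^sup>+ v\<in>{0..}. (\<integral>\<^sup>+ y.
              ennreal (\<bar>f (r, y)\<bar> * \<bar>f (v, y)\<bar> * \<bar>r - v\<bar> powr (2 * H - 2))
              \<partial>lborel) \<partial>lborel) \<partial>lborel) < \<infinity>)}"

definition noise_cov :: "real \<Rightarrow> (real \<times> real \<Rightarrow> real) \<Rightarrow> (real \<times> real \<Rightarrow> real) \<Rightarrow> real" where
  "noise_cov H f g =
     (if H = 1/2
      then (LINT r:{0..}|lborel. (LINT y|lborel. f (r, y) * g (r, y)))
      else H * (2 * H - 1) *
           (LINT r:{0..}|lborel. (LINT v:{0..}|lborel. (LINT y|lborel.
              f (r, y) * g (v, y) * \<bar>r - v\<bar> powr (2 * H - 2)))))"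

text \<open>A centred Gaussian variable may be degenerate, i.e. almost surely zero.\<close>

definition centred_gaussian :: "'a measure \<Rightarrow> ('a \<Rightarrow> real) \<Rightarrow> bool" where
  "centred_gaussian M X \<longleftrightarrow> X \<in> borel_measurable M \<and>
     ((AE \<omega> in M. X \<omega> = 0) \<or> (\<exists>\<sigma>>0. distributed M lborel X (normal_density 0 \<sigma>)))"

definition jointly_centred_gaussian :: "'a measure \<Rightarrow> 'i set \<Rightarrow> ('i \<Rightarrow> 'a \<Rightarrow> real) \<Rightarrow> bool" where
  "jointly_centred_gaussian M I X \<longleftrightarrow>
     (\<forall>J c. finite J \<and> J \<subseteq> I \<longrightarrow> centred_gaussian M (\<lambda>\<omega>. \<Sum>i\<in>J. c i * X i \<omega>))"

text \<open>The noise is given by its Wiener integral: \<open>W f\<close> is \<open>\<integral>f dW\<close>. Almost sure linearity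
  of \<open>W\<close> is a consequence of the covariance formula.\<close>

definition fractional_white_noise ::
    "'a measure \<Rightarrow> real \<Rightarrow> ((real \<times> real \<Rightarrow> real) \<Rightarrow> 'a \<Rightarrow> real) \<Rightarrow> bool" where
  "fractional_white_noise M H W \<longleftrightarrow>
     prob_space M \<and>
     jointly_centred_gaussian M (noise_integrands H) W \<and>
     (\<forall>f\<in>noise_integrands H. \<forall>g\<in>noise_integrands H.
        (LINT \<omega>|M. W f \<omega> * W g \<omega>) = noise_cov H f g)"

definition wave_kernel :: "real \<Rightarrow> real \<Rightarrow> real" where
  "wave_kernel t x = 1/2 * indicator {x. \<bar>x\<bar> < t} x"

text \<open>Wiener integrals are determined only up to null sets, so the solution is any
  version of the field of integrals.\<close>

definition mild_wave_solution ::
    "'a measure \<Rightarrow> ((real \<times> real \<Rightarrow> real) \<Rightarrow> 'a \<Rightarrow> real) \<Rightarrow> (real \<Rightarrow> real \<Rightarrow> 'a \<Rightarrow> real) \<Rightarrow> bool" where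
  "mild_wave_solution M W u \<longleftrightarrow>
     (\<forall>t\<ge>0. \<forall>x. u t x \<in> borel_measurable M \<and>
        (AE \<omega> in M. u t x \<omega> =
           W (\<lambda>(r, y). indicator {0..t} r * wave_kernel (t - r) (x - y)) \<omega>))"

definition hurst_estimator ::
    "(real \<Rightarrow> real \<Rightarrow> 'a \<Rightarrow> real) \<Rightarrow> real \<Rightarrow> nat \<Rightarrow> 'a \<Rightarrow> real" where
  "hurst_estimator u x N \<omega> =
     - ((ln 4 + ln (1 / real N *
            (\<Sum>i<N. (u (real (i + 1) / real N) x \<omega> - u (real i / real N) x \<omega>)\<^sup>2)))
        / (2 * ln (real N)))"

definition strongly_consistent :: "'a measure \<Rightarrow> (nat \<Rightarrow> 'a \<Rightarrow> real) \<Rightarrow> real \<Rightarrow> bool" where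
  "strongly_consistent M est \<theta> \<longleftrightarrow>
     (\<forall>N. est N \<in> borel_measurable M) \<and> (AE \<omega> in M. (\<lambda>N. est N \<omega>) \<longlonglongrightarrow> \<theta>)"

definition asymptotically_normal :: "'a measure \<Rightarrow> (nat \<Rightarrow> 'a \<Rightarrow> real) \<Rightarrow> real \<Rightarrow> bool" where
  "asymptotically_normal M est \<theta> \<longleftrightarrow>
     (\<forall>N. est N \<in> borel_measurable M) \<and>
     (\<exists>a :: nat \<Rightarrow> real. filterlim a at_top sequentially \<and>
        (\<exists>m \<sigma>. \<sigma> > 0 \<and>
           weak_conv_m (\<lambda>N. distr M borel (\<lambda>\<omega>. a N * (est N \<omega> - \<theta>)))
             (density lborel (normal_density m \<sigma>))))"

end

theory Submission
  imports Defs "HOL-Complex_Analysis.Conformal_Mappings" "HOL-Real_Asymp.Real_Asymp"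
begin

text \<open>The solution is self-similar, and its unit-step increments \<open>Y\<^sub>i\<close> have an explicit, nonnegative
  covariance matrix \<open>C\<close> with row sums at most \<open>N\<^sup>2\<^sup>H\<close> and \<open>tr C\<^sup>2 \<ge> N\<^sup>3/48\<close>. Up to scaling the
  estimator is a function of \<open>V = \<Sum>\<^sub>i Y\<^sub>i\<^sup>2\<close>. Gaussian integration by parts, applied twice to
  \<open>\<Phi>(z) = E e\<^sup>-\<^sup>z\<^sup>V\<close>, gives \<open>\<Phi>'(z) = (2 z tr C\<^sup>2 - tr C) \<Phi>(z) - 4 z\<^sup>2 R(z)\<close> on \<open>Re z \<ge> 0\<close>, where
  \<open>R \<ge> 0\<close> on the real axis and \<open>\<bar>R\<bar> \<le> tr C\<^sup>3\<close>. On the real axis this is a sub-Gaussian bound for the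
  lower tail of \<open>V\<close>; with a union bound for the upper tail it yields consistency by Borel--Cantelli,
  since \<open>V\<close> only has to be controlled up to powers of \<open>ln N\<close>. On the imaginary axis it bounds the
  distance of the characteristic function of \<open>V\<close> from a normal one by a multiple of
  \<open>tr C\<^sup>3 / (tr C\<^sup>2)\<^sup>3\<^sup>/\<^sup>2 = O(N\<^sup>2\<^sup>H\<^sup>-\<^sup>3\<^sup>/\<^sup>2)\<close>, which tends to \<open>0\<close> for \<open>H < 3/4\<close>. No diagonalisation
  of \<open>C\<close> is needed.\<close>

section \<open>Gaussian spaces\<close>

text \<open>The vector of increments is not assumed to have a density (\<open>C\<close> may be
  singular), so integration by parts starts from characteristic functions; it is established on the
  nonnegative reals and continued analytically to the half-plane. The equation for
  \<open>Phi\<close> should be read against \<open>exp (- z * trC + z^2 * trC2)\<close>, the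
  transform of the normal law with the mean and variance of \<open>V\<close>: the quotient
  \<open>g\<close> of the two has a derivative that contains only the remainder. The lower tail is
  governed by \<open>(tr C)^2 / tr C^2\<close>, which is at least of order
  \<open>N^(2 - 2 H)\<close> and hence tends to infinity for every \<open>H < 1\<close>. The
  \<open>ln 4\<close> of the estimator offsets \<open>tr C ~ N^2 / 4\<close>: the increments are not
  stationary, the variance of \<open>Y i\<close> being about \<open>i / 2\<close> because the
  backward light cone widens linearly. For the limit law the bias matters too:
  \<open>4 * tr C / N^2\<close> differs from 1 by \<open>O(1/N)\<close>, which is negligible against
  a standard deviation of order at least \<open>N^(-1/2)\<close>. The normalised estimator is a
  different function of the normalised \<open>V\<close> for each \<open>N\<close>, so the logarithm
  is passed by a Skorohod coupling.\<close>

lemma norm_exp_scaled_diff_le: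
  fixes x :: real
  assumes "convex S" "\<And>w. w \<in> S \<Longrightarrow> Re w * x \<le> 0" "w \<in> S" "z \<in> S"
  shows "cmod (exp (w * x) - exp (z * x)) \<le> \<bar>x\<bar> * cmod (w - z)"
proof (rule field_differentiable_bound[where f = "\<lambda>w. exp (w * of_real x)" and S = S
      and f' = "\<lambda>w. of_real x * exp (w * of_real x)"])
  show "((\<lambda>w. exp (w * of_real x)) has_field_derivative of_real x * exp (u * of_real x)) (at u within S)"
    for u :: complex
    by (auto intro!: derivative_eq_intros)
  show "cmod (of_real x * exp (u * of_real x)) \<le> \<bar>x\<bar>" if "u \<in> S" for u
    using assms(2)[OF that] by (simp add: norm_mult mult_left_le)
qed (use assms in auto)

lemma has_field_derivative_integral_exp:
  fixes h :: "'a \<Rightarrow> complex" and X :: "'a \<Rightarrow> real" and z :: complex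
  assumes h: "integrable M h" and hX: "integrable M (\<lambda>\<omega>. h \<omega> * X \<omega>)"
    and [measurable]: "X \<in> borel_measurable M"
    and S: "convex S" "\<And>w \<omega>. w \<in> S \<Longrightarrow> Re w * X \<omega> \<le> 0" "z \<in> S"
  shows "((\<lambda>w. LINT \<omega>|M. h \<omega> * exp (w * X \<omega>)) has_field_derivative
           (LINT \<omega>|M. h \<omega> * X \<omega> * exp (z * X \<omega>))) (at z within S)"
proof -
  have [measurable]: "h \<in> borel_measurable M" using h by auto
  have bd: "cmod (exp (w * X \<omega>)) \<le> 1" if "w \<in> S" for w \<omega>
    using S(2)[OF that, of \<omega>] by simp
  have int: "integrable M (\<lambda>\<omega>. h \<omega> * exp (w * X \<omega>))" if "w \<in> S" for w
    by (rule Bochner_Integration.integrable_bound[OF h])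
       (use bd[OF that] in \<open>auto simp: norm_mult mult_left_le\<close>)
  show ?thesis
    unfolding has_field_derivative_iff tendsto_at_iff_sequentially
  proof safe
    fix u :: "nat \<Rightarrow> complex"
    assume u: "\<forall>i. u i \<in> S - {z}" and lim: "u \<longlonglongrightarrow> z"
    have eq: "((LINT \<omega>|M. h \<omega> * exp (u n * X \<omega>)) - (LINT \<omega>|M. h \<omega> * exp (z * X \<omega>))) / (u n - z)
       = (LINT \<omega>|M. h \<omega> * ((exp (u n * X \<omega>) - exp (z * X \<omega>)) / (u n - z)))" for n
    proof -
      have "(LINT \<omega>|M. h \<omega> * ((exp (u n * X \<omega>) - exp (z * X \<omega>)) / (u n - z)))
        = (LINT \<omega>|M. (h \<omega> * exp (u n * X \<omega>) - h \<omega> * exp (z * X \<omega>)) / (u n - z))"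
        by (simp add: right_diff_distrib)
      also have "\<dots> = (LINT \<omega>|M. h \<omega> * exp (u n * X \<omega>) - h \<omega> * exp (z * X \<omega>)) / (u n - z)"
        by (rule integral_divide_zero)
      also have "(LINT \<omega>|M. h \<omega> * exp (u n * X \<omega>) - h \<omega> * exp (z * X \<omega>))
        = (LINT \<omega>|M. h \<omega> * exp (u n * X \<omega>)) - (LINT \<omega>|M. h \<omega> * exp (z * X \<omega>))"
        by (rule Bochner_Integration.integral_diff) (use u int S(3) in auto)
      finally show ?thesis by (rule sym)
    qed
    have "(\<lambda>n. LINT \<omega>|M. h \<omega> * ((exp (u n * X \<omega>) - exp (z * X \<omega>)) / (u n - z))) \<longlonglongrightarrow>
      (LINT \<omega>|M. h \<omega> * X \<omega> * exp (z * X \<omega>))"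
    proof (rule integral_dominated_convergence)
      show "integrable M (\<lambda>\<omega>. cmod (h \<omega> * X \<omega>))" using hX by simp
      show "AE \<omega> in M. cmod (h \<omega> * ((exp (u n * X \<omega>) - exp (z * X \<omega>)) / (u n - z)))
          \<le> cmod (h \<omega> * X \<omega>)" for n
      proof (rule AE_I2)
        fix \<omega>
        have "cmod ((exp (u n * X \<omega>) - exp (z * X \<omega>)) / (u n - z)) \<le> \<bar>X \<omega>\<bar>"
          using norm_exp_scaled_diff_le[OF S(1), of "X \<omega>" "u n" z] S u
          by (auto simp: norm_divide divide_simps)
        then show "cmod (h \<omega> * ((exp (u n * X \<omega>) - exp (z * X \<omega>)) / (u n - z)))
          \<le> cmod (h \<omega> * X \<omega>)"
          by (auto simp: norm_mult simp del: times_divide_eq_right intro!: mult_left_mono)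
      qed
      show "AE \<omega> in M. (\<lambda>n. h \<omega> * ((exp (u n * X \<omega>) - exp (z * X \<omega>)) / (u n - z)))
          \<longlonglongrightarrow> h \<omega> * X \<omega> * exp (z * X \<omega>)"
      proof (rule AE_I2)
        fix \<omega>
        have "((\<lambda>w. exp (w * X \<omega>)) has_field_derivative X \<omega> * exp (z * X \<omega>)) (at z within S)"
          by (auto intro!: derivative_eq_intros)
        then have "(\<lambda>n. (exp (u n * X \<omega>) - exp (z * X \<omega>)) / (u n - z)) \<longlonglongrightarrow> X \<omega> * exp (z * X \<omega>)"
          unfolding has_field_derivative_iff tendsto_at_iff_sequentially using u lim by (auto simp: o_def)
        from tendsto_mult_left[OF this, of "h \<omega>"]
        show "(\<lambda>n. h \<omega> * ((exp (u n * X \<omega>) - exp (z * X \<omega>)) / (u n - z)))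
          \<longlonglongrightarrow> h \<omega> * X \<omega> * exp (z * X \<omega>)" by (simp add: mult.assoc)
      qed
    qed (measurable)
    then show "((\<lambda>w. ((LINT \<omega>|M. h \<omega> * exp (w * X \<omega>)) - (LINT \<omega>|M. h \<omega> * exp (z * X \<omega>))) / (w - z)) \<circ> u)
       \<longlonglongrightarrow> (LINT \<omega>|M. h \<omega> * X \<omega> * exp (z * X \<omega>))"
      unfolding o_def eq .
  qed
qed

lemma convex_imaginary_axis: "convex {w. Re w = 0}"
  by (auto simp: convex_def)

text \<open>The previous lemma on the imaginary axis, where \<open>Re w * X = 0\<close> whatever the
  sign of \<open>X\<close>; the substitution \<open>w = \<i> * t\<close> contributes the factor
  \<open>\<i>\<close>.\<close>

lemma has_vector_derivative_integral_iexp: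
  fixes h :: "'a \<Rightarrow> complex" and X :: "'a \<Rightarrow> real"
  assumes "integrable M h" "integrable M (\<lambda>\<omega>. h \<omega> * X \<omega>)" "X \<in> borel_measurable M"
  shows "((\<lambda>t. LINT \<omega>|M. h \<omega> * iexp (t * X \<omega>)) has_vector_derivative
           (LINT \<omega>|M. \<i> * X \<omega> * h \<omega> * iexp (t * X \<omega>))) (at t)"
proof -
  have "((\<lambda>w. LINT \<omega>|M. h \<omega> * exp (w * X \<omega>)) has_field_derivative
           (LINT \<omega>|M. h \<omega> * X \<omega> * exp (\<i> * t * X \<omega>))) (at (\<i> * t) within {w. Re w = 0})"
    by (rule has_field_derivative_integral_exp) (use assms convex_imaginary_axis in auto)
  then have "((\<lambda>w. LINT \<omega>|M. h \<omega> * exp (w * X \<omega>)) has_field_derivative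
           (LINT \<omega>|M. h \<omega> * X \<omega> * exp (\<i> * t * X \<omega>))) (at (\<i> * t) within (\<lambda>t. \<i> * of_real t) ` UNIV)"
    by (rule DERIV_subset) auto
  from field_vector_diff_chain_within[OF _ this, of \<i>]
    has_vector_derivative_mult_right[OF has_vector_derivative_of_real[OF DERIV_ident[where F = "at t"]], of \<i>]
  have "((\<lambda>w. LINT \<omega>|M. h \<omega> * exp (w * X \<omega>)) \<circ> (\<lambda>t. \<i> * of_real t) has_vector_derivative
           \<i> * (LINT \<omega>|M. h \<omega> * X \<omega> * exp (\<i> * t * X \<omega>))) (at t)"
    by simp
  then show ?thesis
    by (simp add: o_def mult_ac flip: integral_mult_right_zero)
qed

text \<open>Joint normality is encoded by closure under linear combinations and the characteristic
  function of each member, a form that also admits degenerate variables. Fourth moments serve to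
  differentiate the expectation of \<open>Y i * Y j * exp (- z * V)\<close> in
  \<open>z\<close>.\<close>

locale gaussian_space = prob_space M for M :: "'a measure" +
  fixes G :: "('a \<Rightarrow> real) set"
  assumes measurable_G: "X \<in> G \<Longrightarrow> X \<in> borel_measurable M"
    and lin_G: "X \<in> G \<Longrightarrow> Y \<in> G \<Longrightarrow> (\<lambda>\<omega>. a * X \<omega> + b * Y \<omega>) \<in> G"
    and integrable_pow4: "X \<in> G \<Longrightarrow> integrable M (\<lambda>\<omega>. X \<omega> ^ 4)"
    and char_G: "X \<in> G \<Longrightarrow> (LINT \<omega>|M. iexp (X \<omega>)) = exp (- (LINT \<omega>|M. (X \<omega>)\<^sup>2) / 2)"
begin

definition cov :: "('a \<Rightarrow> real) \<Rightarrow> ('a \<Rightarrow> real) \<Rightarrow> real" where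
  "cov X Y = (LINT \<omega>|M. X \<omega> * Y \<omega>)"

lemma cov_commute: "cov X Y = cov Y X"
  by (simp add: cov_def mult.commute)

lemma integrable_G4:
  assumes "X \<in> G" "Y \<in> G" "Z \<in> G"
  shows "integrable M (\<lambda>\<omega>. X \<omega> * Y \<omega> * (Z \<omega>)\<^sup>2)"
proof (rule Bochner_Integration.integrable_bound)
  note [measurable] = assms[THEN measurable_G]
  show "(\<lambda>\<omega>. X \<omega> * Y \<omega> * (Z \<omega>)\<^sup>2) \<in> borel_measurable M" by measurable
  show "integrable M (\<lambda>\<omega>. X \<omega> ^ 4 + Y \<omega> ^ 4 + Z \<omega> ^ 4)"
    using assms by (intro Bochner_Integration.integrable_add integrable_pow4)
  have "\<bar>x * y * z\<^sup>2\<bar> \<le> x ^ 4 + y ^ 4 + z ^ 4" for x y z :: real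
  proof -
    have 1: "\<bar>x * y\<bar> \<le> (x\<^sup>2 + y\<^sup>2) / 2"
      using sum_squares_ge_zero[of "\<bar>x\<bar> - \<bar>y\<bar>" 0] by (simp add: power2_eq_square algebra_simps abs_mult)
    have "\<bar>x * y * z\<^sup>2\<bar> = \<bar>x * y\<bar> * z\<^sup>2" by (simp add: abs_mult)
    also have "\<dots> \<le> (x\<^sup>2 + y\<^sup>2) / 2 * z\<^sup>2" using 1 by (intro mult_right_mono) auto
    also have "\<dots> \<le> x ^ 4 + y ^ 4 + z ^ 4"
    proof -
      have "(a + b) / 2 * c \<le> a\<^sup>2 + b\<^sup>2 + c\<^sup>2" for a b c :: real
      proof -
        have "0 \<le> (a - c)\<^sup>2" "0 \<le> (b - c)\<^sup>2" "0 \<le> a\<^sup>2" "0 \<le> b\<^sup>2" "0 \<le> c\<^sup>2" by auto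
        moreover have "(a + b) / 2 * c = (2 * a * c) / 4 + (2 * b * c) / 4"
          by (simp add: field_simps)
        ultimately show ?thesis unfolding power2_diff by linarith
      qed
      from this[of "x\<^sup>2" "y\<^sup>2" "z\<^sup>2"] show ?thesis by simp
    qed
    finally show ?thesis .
  qed
  then show "AE \<omega> in M. norm (X \<omega> * Y \<omega> * (Z \<omega>)\<^sup>2) \<le> norm (X \<omega> ^ 4 + Y \<omega> ^ 4 + Z \<omega> ^ 4)"
    by (auto intro!: AE_I2 order_trans[OF _ abs_ge_self])
qed

lemma integrable_G2:
  assumes "X \<in> G" "Y \<in> G"
  shows "integrable M (\<lambda>\<omega>. X \<omega> * Y \<omega>)"
proof (rule Bochner_Integration.integrable_bound)
  note [measurable] = assms[THEN measurable_G]
  show "(\<lambda>\<omega>. X \<omega> * Y \<omega>) \<in> borel_measurable M" by measurable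
  show "integrable M (\<lambda>\<omega>. 1 + X \<omega> ^ 4 + Y \<omega> ^ 4)"
    using assms by (intro Bochner_Integration.integrable_add integrable_pow4) auto
  have "\<bar>x * y\<bar> \<le> 1 + x ^ 4 + y ^ 4" for x y :: real
  proof -
    have 1: "\<bar>x * y\<bar> \<le> (x\<^sup>2 + y\<^sup>2) / 2"
      using sum_squares_ge_zero[of "\<bar>x\<bar> - \<bar>y\<bar>" 0] by (simp add: power2_eq_square algebra_simps abs_mult)
    have "0 \<le> (x\<^sup>2 - 1)\<^sup>2" "0 \<le> (y\<^sup>2 - 1)\<^sup>2" "0 \<le> x^4" "0 \<le> y^4" by auto
    then have "(x\<^sup>2 + y\<^sup>2) / 2 \<le> 1 + x ^ 4 + y ^ 4"
      by (simp add: power2_eq_square power4_eq_xxxx algebra_simps)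
    with 1 show ?thesis by linarith
  qed
  then show "AE \<omega> in M. norm (X \<omega> * Y \<omega>) \<le> norm (1 + X \<omega> ^ 4 + Y \<omega> ^ 4)"
    by (auto intro!: AE_I2 order_trans[OF _ abs_ge_self])
qed

lemma integrable_G1:
  assumes "X \<in> G"
  shows "integrable M X"
proof (rule square_integrable_imp_integrable)
  show "X \<in> borel_measurable M" using assms by (rule measurable_G)
  show "integrable M (\<lambda>\<omega>. (X \<omega>)\<^sup>2)"
    using integrable_G2[OF assms assms] by (simp add: power2_eq_square)
qed

lemma scale_G: "X \<in> G \<Longrightarrow> (\<lambda>\<omega>. a * X \<omega>) \<in> G"
  using lin_G[of X X a 0] by simp

lemma diff_G: "X \<in> G \<Longrightarrow> Y \<in> G \<Longrightarrow> (\<lambda>\<omega>. X \<omega> - Y \<omega>) \<in> G"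
  using lin_G[of X Y 1 "-1"] by simp

lemma cov_lin:
  assumes "X \<in> G" "Y \<in> G" "Z \<in> G"
  shows "cov Z (\<lambda>\<omega>. a * X \<omega> + b * Y \<omega>) = a * cov Z X + b * cov Z Y"
    and "cov (\<lambda>\<omega>. a * X \<omega> + b * Y \<omega>) Z = a * cov X Z + b * cov Y Z"
proof -
  show *: "cov Z (\<lambda>\<omega>. a * X \<omega> + b * Y \<omega>) = a * cov Z X + b * cov Z Y"
    unfolding cov_def
    by (simp add: algebra_simps integrable_G2 assms)
  show "cov (\<lambda>\<omega>. a * X \<omega> + b * Y \<omega>) Z = a * cov X Z + b * cov Y Z"
    using * by (simp add: cov_commute)
qed

text \<open>Compute the derivative at \<open>t = 0\<close> of the expectation of
  \<open>iexp (L + t * X)\<close> twice: under the integral, and from the closed form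
  \<open>exp (- Var (L + t * X) / 2)\<close>.\<close>

lemma integral_mult_iexp:
  assumes X: "X \<in> G" and L: "L \<in> G"
  shows "(LINT \<omega>|M. X \<omega> * iexp (L \<omega>)) = \<i> * cov X L * (LINT \<omega>|M. iexp (L \<omega>))"
proof -
  note [measurable] = X[THEN measurable_G] L[THEN measurable_G]
  have 1: "integrable M (\<lambda>\<omega>. iexp (L \<omega>))"
    by (rule integrable_iexp) auto
  have 2: "integrable M (\<lambda>\<omega>. iexp (L \<omega>) * X \<omega>)"
    by (rule Bochner_Integration.integrable_bound[OF integrable_G1[OF X]]) (auto simp: norm_mult)
  have "((\<lambda>t. LINT \<omega>|M. iexp (L \<omega>) * iexp (t * X \<omega>)) has_vector_derivative
           (LINT \<omega>|M. \<i> * X \<omega> * iexp (L \<omega>) * iexp (0 * X \<omega>))) (at 0)"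
    by (rule has_vector_derivative_integral_iexp[OF 1 2]) simp
  moreover have "(LINT \<omega>|M. iexp (L \<omega>) * iexp (t * X \<omega>)) = exp (- (cov L L + 2 * t * cov X L + t\<^sup>2 * cov X X) / 2)" for t
  proof -
    have "(LINT \<omega>|M. iexp (L \<omega>) * iexp (t * X \<omega>)) = (LINT \<omega>|M. iexp (1 * L \<omega> + t * X \<omega>))"
      by (simp add: exp_add algebra_simps)
    also have "\<dots> = exp (- (LINT \<omega>|M. (1 * L \<omega> + t * X \<omega>)\<^sup>2) / 2)"
      by (rule char_G[OF lin_G[OF L X]])
    also have "(LINT \<omega>|M. (1 * L \<omega> + t * X \<omega>)\<^sup>2) = cov L L + 2 * t * cov X L + t\<^sup>2 * cov X X"
      using cov_lin[OF L X lin_G[OF L X], of 1 t 1 t] cov_lin[OF L X L, of 1 t] cov_lin[OF L X X, of 1 t]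
        cov_commute[of L X]
      by (simp add: cov_def power2_eq_square algebra_simps)
    finally show ?thesis .
  qed
  ultimately have D1: "((\<lambda>t. complex_of_real (exp (- (cov L L + 2 * t * cov X L + t\<^sup>2 * cov X X) / 2))) has_vector_derivative
           (LINT \<omega>|M. \<i> * X \<omega> * iexp (L \<omega>))) (at 0)"
    by simp
  have "((\<lambda>t. exp (- (cov L L + 2 * t * cov X L + t\<^sup>2 * cov X X) / 2)) has_real_derivative
           (- cov X L * exp (- cov L L / 2))) (at 0)"
    by (auto intro!: derivative_eq_intros)
  then have D2: "((\<lambda>t. complex_of_real (exp (- (cov L L + 2 * t * cov X L + t\<^sup>2 * cov X X) / 2))) has_vector_derivative
           of_real (- cov X L * exp (- cov L L / 2))) (at 0)"
    by (intro has_vector_derivative_of_real) (simp add: has_real_derivative_iff_has_vector_derivative)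
  have "(LINT \<omega>|M. \<i> * X \<omega> * iexp (L \<omega>)) = - cov X L * (LINT \<omega>|M. iexp (L \<omega>))"
    using vector_derivative_unique_at[OF D1 D2] char_G[OF L] by (simp add: cov_def power2_eq_square)
  then have "\<i> * (LINT \<omega>|M. X \<omega> * iexp (L \<omega>)) = - cov X L * (LINT \<omega>|M. iexp (L \<omega>))"
    by (simp add: mult.assoc)
  then have "\<i> * (\<i> * (LINT \<omega>|M. X \<omega> * iexp (L \<omega>))) = \<i> * (- cov X L * (LINT \<omega>|M. iexp (L \<omega>)))"
    by simp
  then show ?thesis by (simp add: algebra_simps)
qed

end

section \<open>Gaussian integration by parts\<close>

lemma cos_power_tendsto_exp:
  fixes c :: real
  shows "(\<lambda>n. cos (c / sqrt (Suc n)) ^ Suc n) \<longlonglongrightarrow> exp (- c\<^sup>2 / 2)"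
proof (cases "c = 0")
  case False
  have "(\<lambda>n. cos (d / sqrt (Suc n)) ^ Suc n) \<longlonglongrightarrow> exp (- (d * d / 2))" if "d > 0" for d :: real
    using that by real_asymp
  from this[of c] this[of "-c"] False show ?thesis
    by (cases "c > 0") (auto simp: power2_eq_square)
qed simp

text \<open>Variant for the exponent that remains after one cosine of the power \<open>Suc n\<close>
  has been differentiated.\<close>

lemma cos_power_tendsto_exp':
  fixes c :: real
  shows "(\<lambda>n. cos (c / sqrt (Suc n)) ^ n) \<longlonglongrightarrow> exp (- c\<^sup>2 / 2)"
proof (cases "c = 0")
  case False
  have "(\<lambda>n. cos (d / sqrt (Suc n)) ^ n) \<longlonglongrightarrow> exp (- (d * d / 2))" if "d > 0" for d :: real
    using that by real_asymp
  from this[of c] this[of "-c"] False show ?thesis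
    by (cases "c > 0") (auto simp: power2_eq_square)
qed simp

lemma sqrt_mult_sin_tendsto:
  fixes c :: real
  shows "(\<lambda>n. sqrt (Suc n) * sin (c / sqrt (Suc n))) \<longlonglongrightarrow> c"
proof (cases "c = 0")
  case False
  have "(\<lambda>n. sqrt (Suc n) * sin (d / sqrt (Suc n))) \<longlonglongrightarrow> d" if "d > 0" for d :: real
    using that by real_asymp
  from this[of c] this[of "-c"] False show ?thesis
    by (cases "c > 0") (auto simp flip: tendsto_minus_cancel_left)
qed simp

context gaussian_space
begin

text \<open>\<open>F'\<close> acts as the derivative of \<open>F\<close> in the direction of the covariances with \<open>X\<close>. Quantifying over
  \<open>L\<close> makes the relation stable under \<open>F \<mapsto> F cos K\<close>, hence under multiplication by
  \<open>exp (-l K\<^sup>2) = lim cos (K (2 l / n)\<^sup>1\<^sup>/\<^sup>2)\<^sup>n\<close>.\<close>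

definition stein_pair :: "('a \<Rightarrow> real) \<Rightarrow> ('a \<Rightarrow> real) \<Rightarrow> ('a \<Rightarrow> real) \<Rightarrow> bool" where
  "stein_pair X F F' \<longleftrightarrow> F \<in> borel_measurable M \<and> (\<forall>\<omega>. \<bar>F \<omega>\<bar> \<le> 1) \<and> integrable M F' \<and>
     (\<forall>L\<in>G. (LINT \<omega>|M. X \<omega> * F \<omega> * iexp (L \<omega>)) =
       (LINT \<omega>|M. F' \<omega> * iexp (L \<omega>)) + \<i> * cov X L * (LINT \<omega>|M. F \<omega> * iexp (L \<omega>)))"

lemma stein_pair_one: "X \<in> G \<Longrightarrow> stein_pair X (\<lambda>_. 1) (\<lambda>_. 0)"
  by (simp add: stein_pair_def integral_mult_iexp)

lemma integrable_mult_iexp: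
  fixes h :: "'a \<Rightarrow> real"
  assumes "integrable M h" "L \<in> borel_measurable M"
  shows "complex_integrable M (\<lambda>\<omega>. h \<omega> * iexp (L \<omega>))"
  by (rule Bochner_Integration.integrable_bound[OF assms(1)])
     (use assms in \<open>auto simp: norm_mult\<close>)

lemma integrable_bounded_mult:
  fixes h F :: "'a \<Rightarrow> real"
  assumes "integrable M h" "F \<in> borel_measurable M" "\<And>\<omega>. \<bar>F \<omega>\<bar> \<le> 1"
  shows "integrable M (\<lambda>\<omega>. h \<omega> * F \<omega>)"
  by (rule Bochner_Integration.integrable_bound[OF assms(1)])
     (use assms in \<open>auto simp: abs_mult mult_left_le\<close>)

text \<open>Since \<open>2 * cos K * iexp L = iexp (L + K) + iexp (L - K)\<close>, the hypothesis is
  applied to \<open>L + K\<close> and \<open>L - K\<close>, both in \<open>G\<close>. The parts of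
  their covariances with \<open>X\<close> that have opposite signs combine to the sine term.\<close>

lemma stein_pair_cos:
  assumes X: "X \<in> G" and K: "K \<in> G" and st: "stein_pair X F F'"
  shows "stein_pair X (\<lambda>\<omega>. F \<omega> * cos (K \<omega>))
     (\<lambda>\<omega>. F' \<omega> * cos (K \<omega>) - cov X K * (F \<omega> * sin (K \<omega>)))"
  unfolding stein_pair_def
proof (intro conjI ballI allI)
  have [measurable]: "F \<in> borel_measurable M" and F1: "\<bar>F \<omega>\<bar> \<le> 1" and F': "integrable M F'" for \<omega>
    using st by (auto simp: stein_pair_def)
  have [measurable]: "F' \<in> borel_measurable M" using F' by auto
  note [measurable] = X[THEN measurable_G] K[THEN measurable_G]
  have intF: "integrable M F"
    by (rule integrable_const_bound[where B = 1]) (use F1 in auto)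
  have intXF: "integrable M (\<lambda>\<omega>. X \<omega> * F \<omega>)"
    by (intro integrable_bounded_mult integrable_G1 X F1) auto
  show "(\<lambda>\<omega>. F \<omega> * cos (K \<omega>)) \<in> borel_measurable M" by measurable
  show "\<bar>F \<omega> * cos (K \<omega>)\<bar> \<le> 1" for \<omega>
    using F1[of \<omega>] by (simp add: abs_mult mult_le_one)
  have intS: "integrable M (\<lambda>\<omega>. F \<omega> * sin (K \<omega>))" "integrable M (\<lambda>\<omega>. F \<omega> * cos (K \<omega>))"
    "integrable M (\<lambda>\<omega>. F' \<omega> * cos (K \<omega>))"
    by (intro integrable_bounded_mult F' intF; simp)+
  then show "integrable M (\<lambda>\<omega>. F' \<omega> * cos (K \<omega>) - cov X K * (F \<omega> * sin (K \<omega>)))"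
    by simp
  fix L assume L: "L \<in> G"
  note [measurable] = L[THEN measurable_G]
  define I where "I h s = (LINT \<omega>|M. h \<omega> * iexp (L \<omega> + s * K \<omega>))" for h :: "'a \<Rightarrow> real" and s :: real
  have stI: "I (\<lambda>\<omega>. X \<omega> * F \<omega>) s = I F' s + \<i> * (cov X L + s * cov X K) * I F s" for s
  proof -
    have "\<forall>L\<in>G. (LINT \<omega>|M. X \<omega> * F \<omega> * iexp (L \<omega>)) =
       (LINT \<omega>|M. F' \<omega> * iexp (L \<omega>)) + \<i> * cov X L * (LINT \<omega>|M. F \<omega> * iexp (L \<omega>))"
      using st by (simp add: stein_pair_def)
    from bspec[OF this lin_G[OF L K, of 1 s]] cov_lin(1)[OF L K X, of 1 s]
    show ?thesis by (simp add: I_def)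
  qed
  have sum: "I h 1 + I h (-1) = 2 * (LINT \<omega>|M. h \<omega> * cos (K \<omega>) * iexp (L \<omega>))"
    "I h 1 - I h (-1) = 2 * \<i> * (LINT \<omega>|M. h \<omega> * sin (K \<omega>) * iexp (L \<omega>))"
    if h: "integrable M h" for h :: "'a \<Rightarrow> real"
  proof -
    have i: "complex_integrable M (\<lambda>\<omega>. h \<omega> * iexp (L \<omega> + s * K \<omega>))" for s
      by (intro integrable_mult_iexp h) measurable
    have e: "iexp (l + 1 * k) + iexp (l + (-1) * k) = 2 * cos k * iexp l"
       "iexp (l + 1 * k) - iexp (l + (-1) * k) = 2 * \<i> * sin k * iexp l" for l k :: real
      by (simp_all add: complex_eq_iff Re_exp Im_exp cos_add sin_add cos_diff sin_diff algebra_simps)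
    have "I h 1 + I h (-1) = (LINT \<omega>|M. 2 * (h \<omega> * cos (K \<omega>) * iexp (L \<omega>)))"
      unfolding I_def Bochner_Integration.integral_add[OF i i, symmetric] distrib_left[symmetric] e
      by (simp add: mult_ac)
    then show "I h 1 + I h (-1) = 2 * (LINT \<omega>|M. h \<omega> * cos (K \<omega>) * iexp (L \<omega>))"
      by simp
    have "I h 1 - I h (-1) = (LINT \<omega>|M. (2 * \<i>) * (h \<omega> * sin (K \<omega>) * iexp (L \<omega>)))"
      unfolding I_def Bochner_Integration.integral_diff[OF i i, symmetric] right_diff_distrib[symmetric] e
      by (simp add: mult_ac)
    then show "I h 1 - I h (-1) = 2 * \<i> * (LINT \<omega>|M. h \<omega> * sin (K \<omega>) * iexp (L \<omega>))"
      by (simp only: integral_mult_right_zero)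
  qed
  have "2 * (LINT \<omega>|M. X \<omega> * F \<omega> * cos (K \<omega>) * iexp (L \<omega>)) =
      I (\<lambda>\<omega>. X \<omega> * F \<omega>) 1 + I (\<lambda>\<omega>. X \<omega> * F \<omega>) (-1)"
    using sum(1)[OF intXF] by simp
  also have "\<dots> = (I F' 1 + I F' (-1)) + \<i> * cov X L * (I F 1 + I F (-1)) + \<i> * cov X K * (I F 1 - I F (-1))"
    unfolding stI by (simp add: algebra_simps)
  also have "\<dots> = 2 * ((LINT \<omega>|M. F' \<omega> * cos (K \<omega>) * iexp (L \<omega>))
      + \<i> * cov X L * (LINT \<omega>|M. F \<omega> * cos (K \<omega>) * iexp (L \<omega>))
      - cov X K * (LINT \<omega>|M. F \<omega> * sin (K \<omega>) * iexp (L \<omega>)))"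
    unfolding sum[OF intF] sum[OF F'] by (simp add: algebra_simps)
  finally have "2 * (LINT \<omega>|M. X \<omega> * F \<omega> * cos (K \<omega>) * iexp (L \<omega>)) =
    2 * ((LINT \<omega>|M. F' \<omega> * cos (K \<omega>) * iexp (L \<omega>))
      + \<i> * cov X L * (LINT \<omega>|M. F \<omega> * cos (K \<omega>) * iexp (L \<omega>))
      - cov X K * (LINT \<omega>|M. F \<omega> * sin (K \<omega>) * iexp (L \<omega>)))" .
  moreover have "a = b" if "2 * a = 2 * b" for a b :: complex using that by simp
  ultimately have *: "(LINT \<omega>|M. X \<omega> * F \<omega> * cos (K \<omega>) * iexp (L \<omega>)) = (LINT \<omega>|M. F' \<omega> * cos (K \<omega>) * iexp (L \<omega>))
      + \<i> * cov X L * (LINT \<omega>|M. F \<omega> * cos (K \<omega>) * iexp (L \<omega>))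
      - cov X K * (LINT \<omega>|M. F \<omega> * sin (K \<omega>) * iexp (L \<omega>))"
    by blast
  have "(LINT \<omega>|M. (F' \<omega> * cos (K \<omega>) - cov X K * (F \<omega> * sin (K \<omega>))) * iexp (L \<omega>))
     = (LINT \<omega>|M. (F' \<omega> * cos (K \<omega>)) * iexp (L \<omega>) - cov X K * ((F \<omega> * sin (K \<omega>)) * iexp (L \<omega>)))"
    by (simp add: algebra_simps)
  also have "\<dots> = (LINT \<omega>|M. (F' \<omega> * cos (K \<omega>)) * iexp (L \<omega>)) - cov X K * (LINT \<omega>|M. (F \<omega> * sin (K \<omega>)) * iexp (L \<omega>))"
    using integrable_mult_iexp[OF intS(1), of L] integrable_mult_iexp[OF intS(3), of L] by simp
  finally show "(LINT \<omega>|M. X \<omega> * complex_of_real (F \<omega> * cos (K \<omega>)) * iexp (L \<omega>)) =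
     (LINT \<omega>|M. complex_of_real (F' \<omega> * cos (K \<omega>) - cov X K * (F \<omega> * sin (K \<omega>))) * iexp (L \<omega>)) +
     \<i> * cov X L * (LINT \<omega>|M. complex_of_real (F \<omega> * cos (K \<omega>)) * iexp (L \<omega>))"
    using * by (simp add: mult.assoc)
qed

text \<open>The cosine factor is adjoined \<open>m\<close> times, with the product rule. For
  \<open>m = 0\<close> the truncated exponent \<open>m - 1\<close> is harmless because of the factor
  \<open>m\<close>.\<close>

lemma stein_pair_cos_power:
  assumes X: "X \<in> G" and K: "K \<in> G" and st: "stein_pair X F F'"
  shows "stein_pair X (\<lambda>\<omega>. F \<omega> * cos (K \<omega>) ^ m)
     (\<lambda>\<omega>. F' \<omega> * cos (K \<omega>) ^ m - m * cov X K * (F \<omega> * sin (K \<omega>) * cos (K \<omega>) ^ (m - 1)))"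
proof (induction m)
  case 0
  then show ?case using st by simp
next
  case (Suc m)
  have "F' \<omega> * cos (K \<omega>) ^ Suc m - Suc m * cov X K * (F \<omega> * sin (K \<omega>) * cos (K \<omega>) ^ (Suc m - 1))
    = (F' \<omega> * cos (K \<omega>) ^ m - m * cov X K * (F \<omega> * sin (K \<omega>) * cos (K \<omega>) ^ (m - 1))) * cos (K \<omega>)
     - cov X K * (F \<omega> * cos (K \<omega>) ^ m * sin (K \<omega>))" for \<omega>
    by (cases m) (simp_all add: algebra_simps)
  then show ?case
    using stein_pair_cos[OF X K Suc] by (simp add: mult_ac)
qed

text \<open>Apply the cosine power rule to \<open>K\<close> scaled by \<open>a n\<close>, and pass
  to the limit by dominated convergence in each of the three integrals of the defining
  identity.\<close>

lemma stein_pair_gauss: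
  assumes X: "X \<in> G" and K: "K \<in> G" and st: "stein_pair X F F'" and l: "l \<ge> 0"
  shows "stein_pair X (\<lambda>\<omega>. F \<omega> * exp (- l * (K \<omega>)\<^sup>2))
     (\<lambda>\<omega>. F' \<omega> * exp (- l * (K \<omega>)\<^sup>2) - 2 * l * cov X K * (F \<omega> * K \<omega> * exp (- l * (K \<omega>)\<^sup>2)))"
  unfolding stein_pair_def
proof (intro conjI ballI allI)
  have [measurable]: "F \<in> borel_measurable M" and F1: "\<bar>F \<omega>\<bar> \<le> 1" and F': "integrable M F'" for \<omega>
    using st by (auto simp: stein_pair_def)
  have [measurable]: "F' \<in> borel_measurable M" using F' by auto
  note [measurable] = X[THEN measurable_G] K[THEN measurable_G]
  have F1': "\<bar>F \<omega> * y\<bar> \<le> \<bar>y\<bar>" for \<omega> y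
    using F1[of \<omega>] by (simp add: abs_mult mult_left_le_one_le)
  have e1: "exp (- l * (K \<omega>)\<^sup>2) \<le> 1" for \<omega> using l by simp
  show "(\<lambda>\<omega>. F \<omega> * exp (- l * (K \<omega>)\<^sup>2)) \<in> borel_measurable M" by measurable
  show "\<bar>F \<omega> * exp (- l * (K \<omega>)\<^sup>2)\<bar> \<le> 1" for \<omega>
    using order_trans[OF F1'[of \<omega> "exp (- l * (K \<omega>)\<^sup>2)"], of 1] e1[of \<omega>] by simp
  have intFK: "integrable M (\<lambda>\<omega>. F \<omega> * K \<omega>)"
    using integrable_bounded_mult[OF integrable_G1[OF K], of F] F1 by (simp add: mult.commute)
  show "integrable M (\<lambda>\<omega>. F' \<omega> * exp (- l * (K \<omega>)\<^sup>2) - 2 * l * cov X K * (F \<omega> * K \<omega> * exp (- l * (K \<omega>)\<^sup>2)))"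
    using l by (intro Bochner_Integration.integrable_diff integrable_mult_right integrable_bounded_mult F' intFK) auto
  fix L assume L: "L \<in> G"
  note [measurable] = L[THEN measurable_G]
  \<comment> \<open>With this scale the limit \<open>exp (- (s * K)^2 / 2)\<close> of the cosine
    powers is \<open>exp (- l * K^2)\<close>.\<close>
  define s where "s = sqrt (2 * l)"
  have s2: "s\<^sup>2 = 2 * l" using l by (simp add: s_def)
  define a where "a n = s / sqrt (Suc n)" for n
  define Kn where "Kn n \<omega> = a n * K \<omega>" for n \<omega>
  have Kn: "Kn n \<in> G" for n unfolding Kn_def using scale_G[OF K] .
  have [measurable]: "Kn n \<in> borel_measurable M" for n using Kn[THEN measurable_G] .
  have KnK: "Kn n \<omega> = s * K \<omega> / sqrt (Suc n)" for n \<omega> by (simp add: Kn_def a_def)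
  have covKn: "cov X (Kn n) = a n * cov X K" for n
    using cov_lin(1)[OF K K X, of "a n" 0] by (simp add: Kn_def[abs_def])
  let ?D = "\<lambda>n \<omega>. F' \<omega> * cos (Kn n \<omega>) ^ Suc n - Suc n * cov X (Kn n) * (F \<omega> * sin (Kn n \<omega>) * cos (Kn n \<omega>) ^ n)"
  have eq: "(LINT \<omega>|M. X \<omega> * (F \<omega> * cos (Kn n \<omega>) ^ Suc n) * iexp (L \<omega>)) =
       (LINT \<omega>|M. ?D n \<omega> * iexp (L \<omega>)) + \<i> * cov X L * (LINT \<omega>|M. (F \<omega> * cos (Kn n \<omega>) ^ Suc n) * iexp (L \<omega>))" for n
    using stein_pair_cos_power[OF X Kn st, of n "Suc n"] L unfolding stein_pair_def by simp
  have abscos: "\<bar>cos y ^ n\<bar> \<le> 1" for y :: real and n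
    unfolding power_abs by (rule power_le_one) auto
  have c1: "(\<lambda>n. cos (Kn n \<omega>) ^ Suc n) \<longlonglongrightarrow> exp (- l * (K \<omega>)\<^sup>2)"
    and c2: "(\<lambda>n. cos (Kn n \<omega>) ^ n) \<longlonglongrightarrow> exp (- l * (K \<omega>)\<^sup>2)" for \<omega>
    using cos_power_tendsto_exp[of "s * K \<omega>"] cos_power_tendsto_exp'[of "s * K \<omega>"]
    by (simp_all add: KnK power_mult_distrib s2)
  have c3: "(\<lambda>n. Suc n * a n * sin (Kn n \<omega>)) \<longlonglongrightarrow> 2 * l * K \<omega>" for \<omega>
  proof -
    have "Suc n * a n * sin (Kn n \<omega>) = s * (sqrt (Suc n) * sin (s * K \<omega> / sqrt (Suc n)))" for n
    proof -
      have "Suc n * a n = s * (real (Suc n) / sqrt (Suc n))" by (simp add: a_def)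
      also have "\<dots> = s * sqrt (Suc n)" by (subst real_div_sqrt) auto
      finally show ?thesis by (simp add: KnK)
    qed
    moreover have "(\<lambda>n. s * (sqrt (Suc n) * sin (s * K \<omega> / sqrt (Suc n)))) \<longlonglongrightarrow> s * (s * K \<omega>)"
      by (intro tendsto_mult_left sqrt_mult_sin_tendsto)
    moreover have "s * (s * K \<omega>) = 2 * l * K \<omega>"
      using s2 by (simp add: power2_eq_square flip: mult.assoc)
    ultimately show ?thesis by simp
  qed
  \<comment> \<open>Domination uniform in \<open>n\<close>: the growing factor \<open>Suc n\<close>
    is absorbed by \<bar>sin y\<bar> \<le> \<bar>y\<bar>, because
    \<open>Suc n * (a n)^2 = 2 * l\<close>.\<close>
  have bd3: "\<bar>Suc n * a n * sin (Kn n \<omega>)\<bar> \<le> 2 * l * \<bar>K \<omega>\<bar>" for n \<omega>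
  proof -
    have "a n \<ge> 0" using l by (simp add: a_def s_def)
    have "\<bar>sin (Kn n \<omega>)\<bar> \<le> \<bar>Kn n \<omega>\<bar>" by (rule abs_sin_x_le_abs_x)
    then have "\<bar>Suc n * a n * sin (Kn n \<omega>)\<bar> \<le> Suc n * a n * \<bar>Kn n \<omega>\<bar>"
      using \<open>a n \<ge> 0\<close> by (simp add: abs_mult mult_left_mono)
    also have "\<dots> = (Suc n * (a n)\<^sup>2) * \<bar>K \<omega>\<bar>"
      using \<open>a n \<ge> 0\<close> by (simp add: Kn_def abs_mult power2_eq_square)
    also have "Suc n * (a n)\<^sup>2 = 2 * l"
      by (simp add: a_def power_divide s2)
    finally show ?thesis .
  qed
  have D_eq: "?D n \<omega> = F' \<omega> * cos (Kn n \<omega>) ^ Suc n - cov X K * (Suc n * a n * sin (Kn n \<omega>)) * (F \<omega> * cos (Kn n \<omega>) ^ n)" for n \<omega>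
    by (simp add: covKn algebra_simps)
  have lim1: "(\<lambda>n. LINT \<omega>|M. X \<omega> * (F \<omega> * cos (Kn n \<omega>) ^ Suc n) * iexp (L \<omega>)) \<longlonglongrightarrow>
     (LINT \<omega>|M. X \<omega> * (F \<omega> * exp (- l * (K \<omega>)\<^sup>2)) * iexp (L \<omega>))"
  proof (rule integral_dominated_convergence)
    show "integrable M (\<lambda>\<omega>. \<bar>X \<omega>\<bar>)" using integrable_G1[OF X] by simp
    show "AE \<omega> in M. (\<lambda>n. X \<omega> * (F \<omega> * cos (Kn n \<omega>) ^ Suc n) * iexp (L \<omega>)) \<longlonglongrightarrow> X \<omega> * (F \<omega> * exp (- l * (K \<omega>)\<^sup>2)) * iexp (L \<omega>)"
      by (intro AE_I2 tendsto_mult tendsto_of_real tendsto_const c1)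
    show "AE \<omega> in M. norm (X \<omega> * (F \<omega> * cos (Kn n \<omega>) ^ Suc n) * iexp (L \<omega>)) \<le> \<bar>X \<omega>\<bar>" for n
    proof (rule AE_I2)
      fix \<omega>
      have "\<bar>F \<omega> * cos (Kn n \<omega>) ^ Suc n\<bar> \<le> 1" by (rule order_trans[OF F1' abscos])
      then show "norm (X \<omega> * (F \<omega> * cos (Kn n \<omega>) ^ Suc n) * iexp (L \<omega>)) \<le> \<bar>X \<omega>\<bar>"
        unfolding norm_mult norm_of_real norm_power norm_exp_i_times abs_mult power_abs mult_1_right
        by (intro mult_left_le) auto
    qed
  qed measurable
  have lim2: "(\<lambda>n. LINT \<omega>|M. (F \<omega> * cos (Kn n \<omega>) ^ Suc n) * iexp (L \<omega>)) \<longlonglongrightarrow>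
     (LINT \<omega>|M. (F \<omega> * exp (- l * (K \<omega>)\<^sup>2)) * iexp (L \<omega>))"
  proof (rule integral_dominated_convergence)
    show "integrable M (\<lambda>\<omega>. 1 :: real)" by simp
    show "AE \<omega> in M. (\<lambda>n. (F \<omega> * cos (Kn n \<omega>) ^ Suc n) * iexp (L \<omega>)) \<longlonglongrightarrow> (F \<omega> * exp (- l * (K \<omega>)\<^sup>2)) * iexp (L \<omega>)"
      by (intro AE_I2 tendsto_mult tendsto_of_real tendsto_const c1)
    show "AE \<omega> in M. norm ((F \<omega> * cos (Kn n \<omega>) ^ Suc n) * iexp (L \<omega>)) \<le> 1" for n
    proof (rule AE_I2)
      fix \<omega>
      have "\<bar>F \<omega> * cos (Kn n \<omega>) ^ Suc n\<bar> \<le> 1" by (rule order_trans[OF F1' abscos])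
      then show "norm ((F \<omega> * cos (Kn n \<omega>) ^ Suc n) * iexp (L \<omega>)) \<le> 1"
        unfolding norm_mult norm_of_real norm_power norm_exp_i_times abs_mult power_abs mult_1_right .
    qed
  qed measurable
  have lim3: "(\<lambda>n. LINT \<omega>|M. ?D n \<omega> * iexp (L \<omega>)) \<longlonglongrightarrow>
     (LINT \<omega>|M. (F' \<omega> * exp (- l * (K \<omega>)\<^sup>2) - 2 * l * cov X K * (F \<omega> * K \<omega> * exp (- l * (K \<omega>)\<^sup>2))) * iexp (L \<omega>))"
  proof (rule integral_dominated_convergence)
    show "integrable M (\<lambda>\<omega>. \<bar>F' \<omega>\<bar> + \<bar>cov X K\<bar> * (2 * l * \<bar>K \<omega>\<bar>))"
      using F' integrable_G1[OF K] by simp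
    show "AE \<omega> in M. (\<lambda>n. ?D n \<omega> * iexp (L \<omega>)) \<longlonglongrightarrow>
      (F' \<omega> * exp (- l * (K \<omega>)\<^sup>2) - 2 * l * cov X K * (F \<omega> * K \<omega> * exp (- l * (K \<omega>)\<^sup>2))) * iexp (L \<omega>)"
    proof (rule AE_I2)
      fix \<omega>
      have "(\<lambda>n. ?D n \<omega>) \<longlonglongrightarrow> F' \<omega> * exp (- l * (K \<omega>)\<^sup>2) - cov X K * (2 * l * K \<omega>) * (F \<omega> * exp (- l * (K \<omega>)\<^sup>2))"
        unfolding D_eq by (intro tendsto_intros c1 c2 c3)
      then have "(\<lambda>n. ?D n \<omega>) \<longlonglongrightarrow> F' \<omega> * exp (- l * (K \<omega>)\<^sup>2) - 2 * l * cov X K * (F \<omega> * K \<omega> * exp (- l * (K \<omega>)\<^sup>2))"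
        by (simp add: mult_ac)
      then show "(\<lambda>n. ?D n \<omega> * iexp (L \<omega>)) \<longlonglongrightarrow>
        (F' \<omega> * exp (- l * (K \<omega>)\<^sup>2) - 2 * l * cov X K * (F \<omega> * K \<omega> * exp (- l * (K \<omega>)\<^sup>2))) * iexp (L \<omega>)"
        by (intro tendsto_mult tendsto_of_real tendsto_const)
    qed
    show "AE \<omega> in M. norm (?D n \<omega> * iexp (L \<omega>)) \<le> \<bar>F' \<omega>\<bar> + \<bar>cov X K\<bar> * (2 * l * \<bar>K \<omega>\<bar>)" for n
    proof (rule AE_I2)
      fix \<omega>
      have "norm (?D n \<omega> * iexp (L \<omega>)) = \<bar>?D n \<omega>\<bar>" by (simp only: norm_mult norm_of_real norm_exp_i_times mult_1_right)
      also have "\<dots> \<le> \<bar>F' \<omega> * cos (Kn n \<omega>) ^ Suc n\<bar> + \<bar>cov X K * (Suc n * a n * sin (Kn n \<omega>)) * (F \<omega> * cos (Kn n \<omega>) ^ n)\<bar>"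
        unfolding D_eq by (rule abs_triangle_ineq4)
      also have "\<dots> = \<bar>F' \<omega>\<bar> * \<bar>cos (Kn n \<omega>) ^ Suc n\<bar> + \<bar>cov X K\<bar> * \<bar>Suc n * a n * sin (Kn n \<omega>)\<bar> * \<bar>F \<omega> * cos (Kn n \<omega>) ^ n\<bar>"
        by (simp only: abs_mult)
      also have "\<dots> \<le> \<bar>F' \<omega>\<bar> * 1 + \<bar>cov X K\<bar> * (2 * l * \<bar>K \<omega>\<bar>) * 1"
        using bd3[of n \<omega>] F1'[of \<omega> "cos (Kn n \<omega>) ^ n"] abscos[of "Kn n \<omega>"] l
        by (intro add_mono mult_mono order_refl) (auto intro: order_trans simp del: power_Suc)
      finally show "norm (?D n \<omega> * iexp (L \<omega>)) \<le> \<bar>F' \<omega>\<bar> + \<bar>cov X K\<bar> * (2 * l * \<bar>K \<omega>\<bar>)"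
        by simp
    qed
  qed measurable
  show "(LINT \<omega>|M. X \<omega> * complex_of_real (F \<omega> * exp (- l * (K \<omega>)\<^sup>2)) * iexp (L \<omega>)) =
    (LINT \<omega>|M. complex_of_real (F' \<omega> * exp (- l * (K \<omega>)\<^sup>2) - 2 * l * cov X K * (F \<omega> * K \<omega> * exp (- l * (K \<omega>)\<^sup>2))) * iexp (L \<omega>))
    + \<i> * cov X L * (LINT \<omega>|M. complex_of_real (F \<omega> * exp (- l * (K \<omega>)\<^sup>2)) * iexp (L \<omega>))"
    using LIMSEQ_unique[OF lim1[unfolded eq] tendsto_add[OF lim3 tendsto_mult_left[OF lim2]]] by simp
qed

text \<open>Starting from the constant 1, the Gaussian factors are adjoined one by one; the factor
  of \<open>Y j\<close> contributes the summand with \<open>cov X (Y j)\<close>.\<close>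

lemma stein_pair_exp_sum_squares:
  assumes X: "X \<in> G" and I: "finite I" and Y: "\<And>k. k \<in> I \<Longrightarrow> Y k \<in> G" and l: "l \<ge> 0"
  shows "stein_pair X (\<lambda>\<omega>. exp (- l * (\<Sum>k\<in>I. (Y k \<omega>)\<^sup>2)))
    (\<lambda>\<omega>. - 2 * l * (\<Sum>k\<in>I. cov X (Y k) * Y k \<omega>) * exp (- l * (\<Sum>k\<in>I. (Y k \<omega>)\<^sup>2)))"
  using I Y
proof (induction I)
  case empty
  then show ?case using stein_pair_one[OF X] by simp
next
  case (insert j I)
  have "stein_pair X (\<lambda>\<omega>. exp (- l * (\<Sum>k\<in>I. (Y k \<omega>)\<^sup>2)))
    (\<lambda>\<omega>. - 2 * l * (\<Sum>k\<in>I. cov X (Y k) * Y k \<omega>) * exp (- l * (\<Sum>k\<in>I. (Y k \<omega>)\<^sup>2)))"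
    by (rule insert.IH) (use insert.prems in auto)
  note st = stein_pair_gauss[OF X _ this l, of "Y j"]
  define E where "E \<omega> = exp (- l * (\<Sum>k\<in>I. (Y k \<omega>)\<^sup>2))" for \<omega>
  have E: "exp (- l * (\<Sum>k\<in>insert j I. (Y k \<omega>)\<^sup>2)) = E \<omega> * exp (- l * (Y j \<omega>)\<^sup>2)" for \<omega>
    using insert.hyps by (simp add: E_def algebra_simps flip: exp_add)
  have "- 2 * l * (\<Sum>k\<in>insert j I. cov X (Y k) * Y k \<omega>) * (E \<omega> * exp (- l * (Y j \<omega>)\<^sup>2)) =
     - 2 * l * (\<Sum>k\<in>I. cov X (Y k) * Y k \<omega>) * E \<omega> * exp (- l * (Y j \<omega>)\<^sup>2)
     - 2 * l * cov X (Y j) * (E \<omega> * Y j \<omega> * exp (- l * (Y j \<omega>)\<^sup>2))" for \<omega>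
    using insert.hyps by (simp add: algebra_simps)
  then show ?case
    unfolding E using st[folded E_def] insert.prems by simp
qed

text \<open>Evaluate the Stein identity at \<open>L = t * Z\<close> and differentiate at
  \<open>t = 0\<close>: each integral acquires the factor \<open>\<i> * Z\<close>, and the
  covariance term, being linear in \<open>t\<close>, leaves \<open>cov X Z\<close> times the
  expectation of \<open>E\<close>.\<close>

lemma gaussian_ibp_real:
  assumes X: "X \<in> G" and Z: "Z \<in> G" and I: "finite I" and Y: "\<And>k. k \<in> I \<Longrightarrow> Y k \<in> G" and l: "l \<ge> 0"
  defines "E \<equiv> \<lambda>\<omega>. exp (- l * (\<Sum>k\<in>I. (Y k \<omega>)\<^sup>2))"
  shows "(LINT \<omega>|M. X \<omega> * Z \<omega> * E \<omega>) =
    cov X Z * (LINT \<omega>|M. E \<omega>) - 2 * l * (\<Sum>k\<in>I. cov X (Y k) * (LINT \<omega>|M. Y k \<omega> * Z \<omega> * E \<omega>))"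
proof -
  define F' where "F' \<omega> = - 2 * l * (\<Sum>k\<in>I. cov X (Y k) * Y k \<omega>) * E \<omega>" for \<omega>
  have st: "stein_pair X E F'"
    unfolding E_def F'_def[abs_def] by (rule stein_pair_exp_sum_squares[OF X I Y l])
  note [measurable] = X[THEN measurable_G] Z[THEN measurable_G]
  have [measurable]: "E \<in> borel_measurable M" and E1: "\<bar>E \<omega>\<bar> \<le> 1" and intF': "integrable M F'"
    and eq: "\<And>L. L \<in> G \<Longrightarrow> (LINT \<omega>|M. X \<omega> * E \<omega> * iexp (L \<omega>)) =
       (LINT \<omega>|M. F' \<omega> * iexp (L \<omega>)) + \<i> * cov X L * (LINT \<omega>|M. E \<omega> * iexp (L \<omega>))" for \<omega>
    using st by (auto simp: stein_pair_def)
  have [measurable]: "F' \<in> borel_measurable M" using intF' by auto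
  have iE: "integrable M E"
    by (rule integrable_const_bound[where B = 1]) (use E1 in auto)
  have iXE: "integrable M (\<lambda>\<omega>. X \<omega> * E \<omega>)"
    by (intro integrable_bounded_mult integrable_G1 X E1) auto
  have iEZ: "integrable M (\<lambda>\<omega>. E \<omega> * Z \<omega>)"
    using integrable_bounded_mult[OF integrable_G1[OF Z], of E] E1 by (simp add: mult.commute)
  have iG: "integrable M (\<lambda>\<omega>. A \<omega> * Z \<omega> * E \<omega>)" if "A \<in> G" for A
    by (intro integrable_bounded_mult integrable_G2 that Z E1) auto
  have F'Z: "F' \<omega> * Z \<omega> = (\<Sum>k\<in>I. (- 2 * l * cov X (Y k)) * (Y k \<omega> * Z \<omega> * E \<omega>))" for \<omega>
    by (simp add: F'_def sum_distrib_left sum_distrib_right mult_ac)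
  have iF'Z: "integrable M (\<lambda>\<omega>. F' \<omega> * Z \<omega>)"
    unfolding F'Z by (intro Bochner_Integration.integrable_sum integrable_mult_right iG Y)
  note D = has_vector_derivative_integral_iexp[where t = 0 and X = Z]
  have cx: "complex_integrable M (\<lambda>\<omega>. complex_of_real (h \<omega>))"
    "complex_integrable M (\<lambda>\<omega>. complex_of_real (h \<omega>) * Z \<omega>)"
    if "integrable M h" "integrable M (\<lambda>\<omega>. h \<omega> * Z \<omega>)" for h
    using that by (simp_all flip: of_real_mult)
  have iXEZ: "integrable M (\<lambda>\<omega>. X \<omega> * E \<omega> * Z \<omega>)"
    using iG[OF X] by (simp add: mult_ac)
  have D1: "((\<lambda>t. LINT \<omega>|M. complex_of_real (X \<omega> * E \<omega>) * iexp (t * Z \<omega>)) has_vector_derivative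
      (LINT \<omega>|M. \<i> * Z \<omega> * complex_of_real (X \<omega> * E \<omega>) * iexp (0 * Z \<omega>))) (at 0)"
    using cx[OF iXE iXEZ] by (intro D) auto
  have D2: "((\<lambda>t. LINT \<omega>|M. complex_of_real (F' \<omega>) * iexp (t * Z \<omega>)) has_vector_derivative
      (LINT \<omega>|M. \<i> * Z \<omega> * complex_of_real (F' \<omega>) * iexp (0 * Z \<omega>))) (at 0)"
    using cx[OF intF' iF'Z] by (intro D) auto
  have D3: "((\<lambda>t. LINT \<omega>|M. complex_of_real (E \<omega>) * iexp (t * Z \<omega>)) has_vector_derivative
      (LINT \<omega>|M. \<i> * Z \<omega> * complex_of_real (E \<omega>) * iexp (0 * Z \<omega>))) (at 0)"
    using cx[OF iE iEZ] by (intro D) auto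
  have D4: "((\<lambda>t. \<i> * cov X Z * complex_of_real t) has_vector_derivative \<i> * cov X Z * of_real 1) (at 0)"
    by (intro has_vector_derivative_mult_right has_vector_derivative_of_real DERIV_ident)
  have "((\<lambda>t. (LINT \<omega>|M. complex_of_real (F' \<omega>) * iexp (t * Z \<omega>)) +
      (\<i> * cov X Z * complex_of_real t) * (LINT \<omega>|M. complex_of_real (E \<omega>) * iexp (t * Z \<omega>))) has_vector_derivative
      ((LINT \<omega>|M. \<i> * Z \<omega> * complex_of_real (F' \<omega>) * iexp (0 * Z \<omega>)) +
       (\<i> * cov X Z) * (LINT \<omega>|M. complex_of_real (E \<omega>)))) (at 0)"
    using has_vector_derivative_add[OF D2 has_vector_derivative_mult[OF D4 D3]] by simp
  moreover have "(LINT \<omega>|M. complex_of_real (X \<omega> * E \<omega>) * iexp (t * Z \<omega>)) = (LINT \<omega>|M. complex_of_real (F' \<omega>) * iexp (t * Z \<omega>)) +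
      (\<i> * cov X Z * complex_of_real t) * (LINT \<omega>|M. complex_of_real (E \<omega>) * iexp (t * Z \<omega>))" for t
    using eq[OF scale_G[OF Z, of t]] cov_lin(1)[OF Z Z X, of t 0] by (simp add: mult_ac)
  ultimately have "(LINT \<omega>|M. \<i> * Z \<omega> * complex_of_real (X \<omega> * E \<omega>) * iexp (0 * Z \<omega>)) =
    (LINT \<omega>|M. \<i> * Z \<omega> * complex_of_real (F' \<omega>) * iexp (0 * Z \<omega>)) +
       (\<i> * cov X Z) * (LINT \<omega>|M. complex_of_real (E \<omega>))"
    using vector_derivative_unique_at[OF D1] by simp
  then have "\<i> * (LINT \<omega>|M. complex_of_real (X \<omega> * Z \<omega> * E \<omega>)) =
    \<i> * ((LINT \<omega>|M. complex_of_real (F' \<omega> * Z \<omega>)) + cov X Z * (LINT \<omega>|M. complex_of_real (E \<omega>)))"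
    unfolding distrib_left integral_mult_right_zero[symmetric] by (simp add: mult_ac)
  then have "(LINT \<omega>|M. X \<omega> * Z \<omega> * E \<omega>) = (LINT \<omega>|M. F' \<omega> * Z \<omega>) + cov X Z * (LINT \<omega>|M. E \<omega>)"
    unfolding integral_complex_of_real by (simp flip: of_real_mult of_real_add)
  also have "(LINT \<omega>|M. F' \<omega> * Z \<omega>) = (\<Sum>k\<in>I. (- 2 * l * cov X (Y k)) * (LINT \<omega>|M. Y k \<omega> * Z \<omega> * E \<omega>))"
    unfolding F'Z using Y by (subst Bochner_Integration.integral_sum) (auto intro!: integrable_mult_right iG simp del: mult_minus_left)
  finally show ?thesis
    by (simp add: sum_distrib_left sum_negf mult_ac)
qed

end

section \<open>Quadratic functionals of Gaussian vectors\<close>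

locale gaussian_vector = gaussian_space M G for M :: "'a measure" and G +
  fixes I :: "'i set" and Y :: "'i \<Rightarrow> 'a \<Rightarrow> real"
  assumes finite_I: "finite I" and Y_in_G: "k \<in> I \<Longrightarrow> Y k \<in> G"
begin

abbreviation C :: "'i \<Rightarrow> 'i \<Rightarrow> real" where "C i j \<equiv> cov (Y i) (Y j)"

definition V :: "'a \<Rightarrow> real" where "V \<omega> = (\<Sum>k\<in>I. (Y k \<omega>)\<^sup>2)"

definition Phi :: "complex \<Rightarrow> complex" where
  "Phi z = (LINT \<omega>|M. exp (- z * complex_of_real (V \<omega>)))"

definition Psi :: "'i \<Rightarrow> 'i \<Rightarrow> complex \<Rightarrow> complex" where
  "Psi i j z = (LINT \<omega>|M. complex_of_real (Y i \<omega> * Y j \<omega>) * exp (- z * complex_of_real (V \<omega>)))"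

definition trC :: real where "trC = (\<Sum>i\<in>I. C i i)"
definition trC2 :: real where "trC2 = (\<Sum>i\<in>I. \<Sum>k\<in>I. C i k * C k i)"
definition trC3 :: real where "trC3 = (\<Sum>i\<in>I. \<Sum>k\<in>I. \<Sum>m\<in>I. C i k * C k m * C m i)"

definition Rem :: "complex \<Rightarrow> complex" where
  "Rem z = (\<Sum>i\<in>I. \<Sum>k\<in>I. \<Sum>m\<in>I. C i k * C k m * Psi m i z)"

lemma V_nonneg: "0 \<le> V \<omega>"
  by (simp add: V_def sum_nonneg)

lemma measurable_V [measurable]: "V \<in> borel_measurable M"
  unfolding V_def[abs_def] using Y_in_G measurable_G by measurable

lemma convex_right_half_plane: "convex {w. 0 \<le> Re w}"
  by (auto simp: convex_def)

lemma norm_exp_V_le: "0 \<le> Re z \<Longrightarrow> cmod (exp (- z * V \<omega>)) \<le> 1"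
  using V_nonneg[of \<omega>] by simp

lemma integrable_mult_exp_V:
  fixes h :: "'a \<Rightarrow> real" and z :: complex
  assumes "integrable M h" "0 \<le> Re z"
  shows "complex_integrable M (\<lambda>\<omega>. h \<omega> * exp (- z * V \<omega>))"
  by (rule Bochner_Integration.integrable_bound[OF assms(1)])
     (use assms norm_exp_V_le[OF assms(2)] in \<open>auto simp: norm_mult mult_left_le\<close>)

lemma integral_exp_V_derivative:
  fixes h :: "'a \<Rightarrow> real" and z :: complex
  assumes "integrable M h" "integrable M (\<lambda>\<omega>. h \<omega> * V \<omega>)" "0 \<le> Re z"
  shows "((\<lambda>z. LINT \<omega>|M. h \<omega> * exp (- z * V \<omega>)) has_field_derivative
     - (LINT \<omega>|M. h \<omega> * V \<omega> * exp (- z * V \<omega>))) (at z within {w. 0 \<le> Re w})"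
proof -
  have 1: "complex_integrable M (\<lambda>\<omega>. complex_of_real (h \<omega>))" using assms(1) by simp
  have 2: "complex_integrable M (\<lambda>\<omega>. complex_of_real (h \<omega>) * complex_of_real (- V \<omega>))"
    using assms(2) by (simp flip: of_real_mult)
  have "((\<lambda>z. LINT \<omega>|M. h \<omega> * exp (z * complex_of_real (- V \<omega>))) has_field_derivative
      (LINT \<omega>|M. complex_of_real (h \<omega>) * complex_of_real (- V \<omega>) * exp (z * complex_of_real (- V \<omega>))))
      (at z within {w. 0 \<le> Re w})"
    by (rule has_field_derivative_integral_exp[OF 1 2 _ convex_right_half_plane])
       (use assms(3) V_nonneg in auto)
  then show ?thesis by (simp flip: Bochner_Integration.integral_minus)
qed

lemma integrable_V: "integrable M V"
  unfolding V_def[abs_def] using integrable_G2[OF Y_in_G Y_in_G] by (simp add: power2_eq_square)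

lemma integrable_Y2_V: "i \<in> I \<Longrightarrow> j \<in> I \<Longrightarrow> integrable M (\<lambda>\<omega>. Y i \<omega> * Y j \<omega> * V \<omega>)"
  unfolding V_def[abs_def] sum_distrib_left using integrable_G4[OF Y_in_G Y_in_G Y_in_G] by simp

lemma Phi_derivative:
  assumes "0 \<le> Re z"
  shows "(Phi has_field_derivative - (\<Sum>i\<in>I. Psi i i z)) (at z within {w. 0 \<le> Re w})"
proof -
  have "(Phi has_field_derivative - (LINT \<omega>|M. complex_of_real (V \<omega>) * exp (- z * V \<omega>))) (at z within {w. 0 \<le> Re w})"
    using integral_exp_V_derivative[of "\<lambda>_. 1" z] assms integrable_V by (simp add: Phi_def[abs_def])
  also have "(LINT \<omega>|M. complex_of_real (V \<omega>) * exp (- z * V \<omega>)) =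
      (LINT \<omega>|M. (\<Sum>i\<in>I. complex_of_real (Y i \<omega> * Y i \<omega>) * exp (- z * V \<omega>)))"
    by (simp add: V_def sum_distrib_right power2_eq_square)
  also have "\<dots> = (\<Sum>i\<in>I. LINT \<omega>|M. complex_of_real (Y i \<omega> * Y i \<omega>) * exp (- z * V \<omega>))"
    by (intro Bochner_Integration.integral_sum integrable_mult_exp_V integrable_G2 Y_in_G assms)
  finally show ?thesis by (simp add: Psi_def)
qed

lemma Psi_derivative:
  assumes "i \<in> I" "j \<in> I" "0 \<le> Re z"
  shows "\<exists>d. (Psi i j has_field_derivative d) (at z within {w. 0 \<le> Re w})"
  using integral_exp_V_derivative[OF integrable_G2[OF Y_in_G Y_in_G] integrable_Y2_V assms(3), of i j] assms
  by (auto simp: Psi_def[abs_def])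

text \<open>The identity theorem gives zero on the open half-plane. Differentiability within the
  closed half-plane implies continuity up to the imaginary axis, which is where characteristic
  functions live.\<close>

lemma zero_on_right_half_plane:
  fixes f :: "complex \<Rightarrow> complex"
  assumes d: "\<And>z. 0 \<le> Re z \<Longrightarrow> \<exists>d. (f has_field_derivative d) (at z within {w. 0 \<le> Re w})"
    and 0: "\<And>l::real. 0 < l \<Longrightarrow> f (complex_of_real l) = 0" and z: "0 \<le> Re z"
  shows "f z = 0"
proof -
  have hol: "f holomorphic_on {w. 0 < Re w}"
    unfolding holomorphic_on_def field_differentiable_def
  proof
    fix w :: complex assume w: "w \<in> {w. 0 < Re w}"
    then obtain d where "(f has_field_derivative d) (at w within {w. 0 \<le> Re w})"
      using d[of w] by auto
    then have "(f has_field_derivative d) (at w within {w. 0 < Re w})"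
      by (rule DERIV_subset) auto
    then show "\<exists>d. (f has_field_derivative d) (at w within {w. 0 < Re w})" ..
  qed
  \<comment> \<open>An accumulation point of the zero set inside the open half-plane, as the
    identity theorem requires.\<close>
  have lim: "(1::complex) islimpt (of_real ` {0<..})"
  proof -
    have "(\<lambda>n. complex_of_real (1 + inverse (real (Suc n)))) \<longlonglongrightarrow> of_real (1 + 0)"
      by (intro tendsto_of_real tendsto_add tendsto_const LIMSEQ_inverse_real_of_nat)
    moreover have "complex_of_real (1 + inverse (real (Suc n))) \<in> of_real ` {0<..} - {1}" for n
    proof -
      have "1 + inverse (real (Suc n)) \<in> {0<..}" "1 + inverse (real (Suc n)) \<noteq> 1"
        by (auto intro: add_pos_nonneg)
      then show ?thesis by (metis DiffI image_eqI of_real_eq_1_iff singletonD)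
    qed
    ultimately show ?thesis
      unfolding islimpt_sequential by (intro exI[of _ "\<lambda>n. complex_of_real (1 + inverse (real (Suc n)))"]) simp
  qed
  have pos: "f w = 0" if "0 < Re w" for w
    by (rule analytic_continuation[OF hol, of "of_real ` {0<..}" 1])
       (use lim 0 that in \<open>auto simp: open_halfspace_Re_gt intro!: convex_connected convex_halfspace_Re_gt\<close>)
  have "continuous (at z within {w. 0 \<le> Re w}) f"
    using d[OF z] DERIV_continuous by blast
  moreover have "(\<lambda>n. z + of_real (inverse (real (Suc n)))) \<longlonglongrightarrow> z + of_real 0"
    by (intro tendsto_intros LIMSEQ_inverse_real_of_nat)
  ultimately have "(\<lambda>n. f (z + of_real (inverse (real (Suc n))))) \<longlonglongrightarrow> f z"
    using z unfolding continuous_within_sequentially o_def by simp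
  moreover have "f (z + of_real (inverse (real (Suc n)))) = 0" for n
    using z by (intro pos) (auto intro: add_nonneg_pos)
  ultimately show ?thesis by (simp add: LIMSEQ_const_iff)
qed

text \<open>Both sides are differentiable within the closed half-plane and agree for positive real
  \<open>z\<close> by \<open>gaussian_ibp_real\<close>, so their difference vanishes
  throughout.\<close>

lemma gaussian_ibp:
  assumes i: "i \<in> I" and j: "j \<in> I" and z: "0 \<le> Re z"
  shows "Psi i j z = C i j * Phi z - 2 * z * (\<Sum>k\<in>I. C i k * Psi k j z)"
proof -
  define D where "D z = Psi i j z - (C i j * Phi z - 2 * z * (\<Sum>k\<in>I. C i k * Psi k j z))" for z
  have "D z = 0"
  proof (rule zero_on_right_half_plane[OF _ _ z])
    fix z :: complex assume z: "0 \<le> Re z"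
    have "\<forall>k\<in>I. \<exists>d. (Psi k j has_field_derivative d) (at z within {w. 0 \<le> Re w})"
      using Psi_derivative j z by blast
    then obtain d where "\<And>k. k \<in> I \<Longrightarrow> (Psi k j has_field_derivative d k) (at z within {w. 0 \<le> Re w})"
      by metis
    note this[derivative_intros] Phi_derivative[OF z, derivative_intros]
    show "\<exists>d. (D has_field_derivative d) (at z within {w. 0 \<le> Re w})"
      unfolding D_def[abs_def] using i by (auto intro!: exI derivative_eq_intros)
  next
    fix l :: real assume l: "l > 0"
    define E where "E \<omega> = exp (- l * V \<omega>)" for \<omega>
    have E: "exp (- complex_of_real l * V \<omega>) = complex_of_real (E \<omega>)" for \<omega>
      by (simp add: E_def flip: exp_of_real)
    have Psi: "Psi a b l = complex_of_real (LINT \<omega>|M. Y a \<omega> * Y b \<omega> * E \<omega>)" for a b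
      unfolding Psi_def E by (simp flip: of_real_mult integral_complex_of_real)
    have Phi: "Phi l = complex_of_real (LINT \<omega>|M. E \<omega>)"
      unfolding Phi_def E by (simp flip: integral_complex_of_real)
    have "(LINT \<omega>|M. Y i \<omega> * Y j \<omega> * E \<omega>) = C i j * (LINT \<omega>|M. E \<omega>)
      - 2 * l * (\<Sum>k\<in>I. C i k * (LINT \<omega>|M. Y k \<omega> * Y j \<omega> * E \<omega>))"
      unfolding E_def V_def using gaussian_ibp_real[OF Y_in_G[OF i] Y_in_G[OF j] finite_I Y_in_G, where l = l] l by simp
    then show "D l = 0"
      unfolding D_def Psi Phi by simp
  qed
  then show ?thesis by (simp add: D_def)
qed

text \<open>The first integration by parts turns the sum of the \<open>Psi i i\<close> into
  \<open>trC * Phi\<close> minus \<open>2 * z\<close> times sums of \<open>C i k * Psi k i\<close>.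
  The second exposes \<open>trC2 * Phi\<close> there, so that what escapes the Gaussian form is
  multiplied by two entries of \<open>C\<close> and by \<open>z^2\<close>.\<close>

lemma Phi_derivative':
  assumes z: "0 \<le> Re z"
  shows "(Phi has_field_derivative (2 * z * trC2 - trC) * Phi z - 4 * z\<^sup>2 * Rem z) (at z within {w. 0 \<le> Re w})"
proof -
  have "(\<Sum>i\<in>I. \<Sum>k\<in>I. C i k * Psi k i z) =
    (\<Sum>i\<in>I. \<Sum>k\<in>I. C i k * (C k i * Phi z - 2 * z * (\<Sum>m\<in>I. C k m * Psi m i z)))"
    using gaussian_ibp z by (intro sum.cong) auto
  also have "\<dots> = trC2 * Phi z - 2 * z * Rem z"
    by (simp add: trC2_def Rem_def right_diff_distrib sum_subtractf sum_distrib_left sum_distrib_right mult_ac)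
  finally have 1: "(\<Sum>i\<in>I. \<Sum>k\<in>I. C i k * Psi k i z) = trC2 * Phi z - 2 * z * Rem z" .
  have "(\<Sum>i\<in>I. Psi i i z) = (\<Sum>i\<in>I. C i i * Phi z - 2 * z * (\<Sum>k\<in>I. C i k * Psi k i z))"
    using gaussian_ibp z by (intro sum.cong) auto
  also have "\<dots> = trC * Phi z - 2 * z * (\<Sum>i\<in>I. \<Sum>k\<in>I. C i k * Psi k i z)"
    by (simp add: trC_def sum_subtractf sum_distrib_left sum_distrib_right)
  finally have "(\<Sum>i\<in>I. Psi i i z) = - ((2 * z * trC2 - trC) * Phi z - 4 * z\<^sup>2 * Rem z)"
    unfolding 1 by (simp add: algebra_simps power2_eq_square)
  with Phi_derivative[OF z] show ?thesis by simp
qed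

text \<open>The quadratic form of the matrix \<open>C^2\<close> in \<open>Y\<close>, written as the
  squared length of \<open>C Y\<close> to make its sign visible. \<open>Rem z\<close> is its
  expectation weighted by \<open>exp (- z * V)\<close>.\<close>

definition Q :: "'a \<Rightarrow> real" where
  "Q \<omega> = (\<Sum>k\<in>I. (\<Sum>i\<in>I. C i k * Y i \<omega>)\<^sup>2)"

lemma Q_eq: "Q \<omega> = (\<Sum>i\<in>I. \<Sum>k\<in>I. \<Sum>m\<in>I. C i k * C k m * (Y m \<omega> * Y i \<omega>))"
proof -
  have "Q \<omega> = (\<Sum>k\<in>I. \<Sum>i\<in>I. \<Sum>m\<in>I. C i k * Y i \<omega> * (C m k * Y m \<omega>))"
    by (simp add: Q_def power2_eq_square sum_product)
  also have "\<dots> = (\<Sum>i\<in>I. \<Sum>k\<in>I. \<Sum>m\<in>I. C i k * Y i \<omega> * (C m k * Y m \<omega>))"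
    by (rule sum.swap)
  also have "\<dots> = (\<Sum>i\<in>I. \<Sum>k\<in>I. \<Sum>m\<in>I. C i k * C k m * (Y m \<omega> * Y i \<omega>))"
    by (simp add: cov_commute mult_ac)
  finally show ?thesis .
qed

lemma integrable_Q: "integrable M Q"
  unfolding Q_eq[abs_def] by (intro Bochner_Integration.integrable_sum integrable_mult_right integrable_G2 Y_in_G)

lemma integral_Q: "(LINT \<omega>|M. Q \<omega>) = trC3"
proof -
  have "integrable M (\<lambda>\<omega>. C i k * C k m * (Y m \<omega> * Y i \<omega>))" if "i \<in> I" "m \<in> I" for i k m
    using that by (intro integrable_mult_right integrable_G2 Y_in_G)
  then show ?thesis
    unfolding Q_eq[abs_def] by (simp add: trC3_def cov_def)
qed

lemma Rem_eq:
  fixes z :: complex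
  assumes "0 \<le> Re z"
  shows "Rem z = (LINT \<omega>|M. Q \<omega> * exp (- z * V \<omega>))"
proof -
  have int: "complex_integrable M (\<lambda>\<omega>. C i k * C k m * (Y m \<omega> * Y i \<omega> * exp (- z * V \<omega>)))"
    if "i \<in> I" "m \<in> I" for i k m
    using integrable_mult_exp_V[OF integrable_G2[OF Y_in_G Y_in_G] assms, of m i] that by simp
  have "(LINT \<omega>|M. Q \<omega> * exp (- z * V \<omega>)) =
    (LINT \<omega>|M. (\<Sum>i\<in>I. \<Sum>k\<in>I. \<Sum>m\<in>I. C i k * C k m * (Y m \<omega> * Y i \<omega> * exp (- z * V \<omega>))))"
    by (simp add: Q_eq sum_distrib_right mult.assoc)
  also have "\<dots> = (\<Sum>i\<in>I. \<Sum>k\<in>I. \<Sum>m\<in>I. LINT \<omega>|M. C i k * C k m * (Y m \<omega> * Y i \<omega> * exp (- z * V \<omega>)))"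
    using int by simp
  also have "\<dots> = Rem z"
    by (simp add: Rem_def Psi_def)
  finally show ?thesis ..
qed

lemma norm_Rem_le:
  assumes "0 \<le> Re z"
  shows "cmod (Rem z) \<le> trC3"
proof -
  have Q0: "0 \<le> Q \<omega>" for \<omega> by (simp add: Q_def sum_nonneg)
  have le: "cmod (Q \<omega> * exp (- z * V \<omega>)) \<le> Q \<omega>" for \<omega>
    using Q0[of \<omega>] norm_exp_V_le[OF assms, of \<omega>] by (simp add: norm_mult mult_left_le)
  have "cmod (Rem z) \<le> (LINT \<omega>|M. cmod (Q \<omega> * exp (- z * V \<omega>)))"
    unfolding Rem_eq[OF assms] by (rule integral_norm_bound)
  also have "\<dots> \<le> (LINT \<omega>|M. Q \<omega>)"
    by (intro integral_mono integrable_norm integrable_mult_exp_V integrable_Q assms le)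
  finally have "cmod (Rem z) \<le> (LINT \<omega>|M. Q \<omega>)" .
  then show ?thesis by (simp add: integral_Q)
qed

text \<open>\<open>Phi\<close> divided by the transform of the normal law with mean
  \<open>trC\<close> and variance \<open>2 * trC2\<close>. The prefactor is an integrating factor:
  all terms with \<open>Phi\<close> cancel in the derivative.\<close>

definition g :: "complex \<Rightarrow> complex" where
  "g z = exp (z * trC - z\<^sup>2 * trC2) * Phi z"

lemma g_derivative:
  assumes z: "0 \<le> Re z"
  shows "(g has_field_derivative - 4 * z\<^sup>2 * exp (z * trC - z\<^sup>2 * trC2) * Rem z) (at z within {w. 0 \<le> Re w})"
  unfolding g_def[abs_def]
  by (rule derivative_eq_intros Phi_derivative'[OF z] refl | simp add: algebra_simps power2_eq_square)+

lemma g_0: "g 0 = 1"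
  by (simp add: g_def Phi_def prob_space)

text \<open>At \<open>z = - \<i> * t\<close> the transform is the characteristic function of
  \<open>V\<close>. Integrating the bound on the derivative of \<open>g\<close> from 0 to this point
  estimates \<open>g - 1\<close>; multiplying back by the normal factor cancels the exponential
  growth exactly.\<close>

lemma char_V_bound:
  fixes t :: real
  shows "cmod ((LINT \<omega>|M. iexp (t * (V \<omega> - trC))) - exp (- t\<^sup>2 * trC2)) \<le> 4 * \<bar>t\<bar> ^ 3 * trC3"
proof -
  have T0: "0 \<le> trC2"
    by (auto simp: trC2_def cov_commute intro!: sum_nonneg)
  \<comment> \<open>On this segment \<open>z^2\<close> is real and nonpositive, so the integrating
    factor has modulus at most \<open>exp (t^2 * trC2)\<close>.\<close>
  define S where "S = {w. Re w = 0 \<and> \<bar>Im w\<bar> \<le> \<bar>t\<bar>}"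
  have "convex S"
  proof -
    have "S = {w. Re w = 0} \<inter> ({w. Im w \<le> \<bar>t\<bar>} \<inter> {w. Im w \<ge> - \<bar>t\<bar>})"
      by (auto simp: S_def)
    then show ?thesis
      by (auto intro!: convex_Int convex_imaginary_axis convex_halfspace_Im_le convex_halfspace_Im_ge)
  qed
  have "cmod (g (- \<i> * t) - g 0) \<le> (4 * t\<^sup>2 * exp (t\<^sup>2 * trC2) * trC3) * cmod (- \<i> * t - 0)"
  proof (rule field_differentiable_bound[OF \<open>convex S\<close>])
    fix z assume z: "z \<in> S"
    show "(g has_field_derivative - 4 * z\<^sup>2 * exp (z * trC - z\<^sup>2 * trC2) * Rem z) (at z within S)"
      using z by (intro DERIV_subset[OF g_derivative]) (auto simp: S_def)
    have "z = \<i> * Im z" using z by (simp add: S_def complex_eq_iff)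
    then have z2: "z\<^sup>2 = - ((Im z)\<^sup>2)" by (metis i_squared mult_minus1 of_real_minus of_real_power power_mult_distrib power2_i)
    have le: "(Im z)\<^sup>2 \<le> t\<^sup>2" using z by (simp add: S_def abs_le_square_iff)
    have "cmod (- 4 * z\<^sup>2 * exp (z * trC - z\<^sup>2 * trC2) * Rem z) =
       4 * (Im z)\<^sup>2 * exp ((Im z)\<^sup>2 * trC2) * cmod (Rem z)"
      unfolding z2 using z by (simp add: norm_mult norm_power S_def)
    also have "\<dots> \<le> 4 * t\<^sup>2 * exp (t\<^sup>2 * trC2) * trC3"
      using le T0 norm_Rem_le[of z] z by (intro mult_mono) (auto simp: S_def mult_right_mono)
    finally show "cmod (- 4 * z\<^sup>2 * exp (z * trC - z\<^sup>2 * trC2) * Rem z) \<le> 4 * t\<^sup>2 * exp (t\<^sup>2 * trC2) * trC3" .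
  qed (auto simp: S_def)
  then have bd: "cmod (g (- \<i> * t) - 1) \<le> 4 * \<bar>t\<bar> ^ 3 * exp (t\<^sup>2 * trC2) * trC3"
  proof -
    have "\<bar>t\<bar> ^ 3 = t\<^sup>2 * \<bar>t\<bar>" by (simp add: power3_eq_cube power2_eq_square)
    with \<open>cmod (g (- \<i> * t) - g 0) \<le> _\<close> show ?thesis
      by (simp add: g_0 norm_mult mult_ac)
  qed
  have "(LINT \<omega>|M. iexp (t * (V \<omega> - trC))) = (LINT \<omega>|M. exp (- \<i> * t * trC) * exp (- (- \<i> * t) * V \<omega>))"
    by (simp add: algebra_simps flip: exp_add)
  also have "\<dots> = exp (- \<i> * t * trC) * Phi (- \<i> * t)"
    unfolding Phi_def by (rule integral_mult_right_zero)
  also have "\<dots> = exp (- t\<^sup>2 * trC2) * g (- \<i> * t)"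
  proof -
    have z2: "(- \<i> * complex_of_real t)\<^sup>2 = - complex_of_real (t\<^sup>2)"
      by (simp add: power_mult_distrib)
    have "exp (- \<i> * t * trC) = exp (complex_of_real (- t\<^sup>2 * trC2)) * exp (- \<i> * t * trC - (- \<i> * complex_of_real t)\<^sup>2 * trC2)"
      unfolding z2 exp_add[symmetric] by simp
    then show ?thesis
      by (simp only: g_def exp_of_real mult.assoc)
  qed
  finally have "(LINT \<omega>|M. iexp (t * (V \<omega> - trC))) - exp (- t\<^sup>2 * trC2) = exp (- t\<^sup>2 * trC2) * (g (- \<i> * t) - 1)"
    by (simp add: algebra_simps)
  then have "cmod ((LINT \<omega>|M. iexp (t * (V \<omega> - trC))) - exp (- t\<^sup>2 * trC2)) = exp (- t\<^sup>2 * trC2) * cmod (g (- \<i> * t) - 1)"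
    by (simp add: norm_mult)
  also have "\<dots> \<le> exp (- t\<^sup>2 * trC2) * (4 * \<bar>t\<bar> ^ 3 * exp (t\<^sup>2 * trC2) * trC3)"
    by (intro mult_left_mono bd) simp
  also have "\<dots> = 4 * \<bar>t\<bar> ^ 3 * trC3"
    by (simp add: exp_minus field_simps)
  finally show ?thesis .
qed

text \<open>For real arguments the remainder is the expectation of a nonnegative variable, so
  \<open>g\<close> decreases from \<open>g 0 = 1\<close>: the lower tail of \<open>V\<close> is no
  heavier than the Gaussian transform suggests.\<close>

lemma laplace_V_bound:
  fixes l :: real
  assumes l: "0 \<le> l"
  shows "(LINT \<omega>|M. exp (- l * V \<omega>)) \<le> exp (- l * trC + l\<^sup>2 * trC2)"
proof -
  define r where "r l = Re (g (of_real l))" for l :: real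
  have g_real: "g (of_real l) = of_real (exp (l * trC - l\<^sup>2 * trC2) * (LINT \<omega>|M. exp (- l * V \<omega>)))" for l
    unfolding g_def Phi_def by (simp flip: exp_of_real integral_complex_of_real)
  have Rem_real: "Rem (of_real l) = of_real (LINT \<omega>|M. Q \<omega> * exp (- l * V \<omega>))" if "0 \<le> l" for l
    using Rem_eq[of "of_real l"] that by (simp flip: exp_of_real integral_complex_of_real)
  have D: "(r has_vector_derivative
       - 4 * l\<^sup>2 * exp (l * trC - l\<^sup>2 * trC2) * (LINT \<omega>|M. Q \<omega> * exp (- l * V \<omega>))) (at l within {0..})" if "0 \<le> l" for l
  proof -
    have "(g has_field_derivative of_real (- 4 * l\<^sup>2 * exp (l * trC - l\<^sup>2 * trC2) * (LINT \<omega>|M. Q \<omega> * exp (- l * V \<omega>))))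
        (at (of_real l) within of_real ` {0..})"
    proof -
      have "(g has_field_derivative - 4 * (complex_of_real l)\<^sup>2 * exp (complex_of_real l * trC - (complex_of_real l)\<^sup>2 * trC2) * Rem (complex_of_real l))
        (at (of_real l) within of_real ` {0..})"
        using that by (intro DERIV_subset[OF g_derivative]) auto
      also have "- 4 * (complex_of_real l)\<^sup>2 * exp (complex_of_real l * trC - (complex_of_real l)\<^sup>2 * trC2) * Rem (complex_of_real l) =
        complex_of_real (- 4 * l\<^sup>2 * exp (l * trC - l\<^sup>2 * trC2) * (LINT \<omega>|M. Q \<omega> * exp (- l * V \<omega>)))"
        unfolding Rem_real[OF that] by (simp flip: exp_of_real)
      finally show ?thesis .
    qed
    from field_vector_diff_chain_within[OF has_vector_derivative_of_real[OF DERIV_ident] this]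
    have "(g \<circ> of_real has_vector_derivative of_real (- 4 * l\<^sup>2 * exp (l * trC - l\<^sup>2 * trC2) * (LINT \<omega>|M. Q \<omega> * exp (- l * V \<omega>)))) (at l within {0..})"
      by simp
    from bounded_linear.has_vector_derivative[OF bounded_linear_Re this] show ?thesis
      by (simp add: r_def[abs_def] o_def)
  qed
  have "r l \<le> r 0"
  proof (rule DERIV_nonpos_imp_decreasing_open[where f = r and a = 0 and b = l])
      show "0 \<le> l" by (rule l)
      show "\<exists>y. DERIV r x :> y \<and> y \<le> 0" if "0 < x" "x < l" for x
      proof -
        have "(LINT \<omega>|M. Q \<omega> * exp (- x * V \<omega>)) \<ge> 0"
          by (intro integral_nonneg_AE AE_I2) (simp add: Q_def sum_nonneg)
        moreover have "at x within {0..} = at x"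
          using that by (intro at_within_interior) simp
        ultimately have "DERIV r x :> - 4 * x\<^sup>2 * exp (x * trC - x\<^sup>2 * trC2) * (LINT \<omega>|M. Q \<omega> * exp (- x * V \<omega>))"
          "- 4 * x\<^sup>2 * exp (x * trC - x\<^sup>2 * trC2) * (LINT \<omega>|M. Q \<omega> * exp (- x * V \<omega>)) \<le> 0"
          using D[of x] that by (simp_all add: has_real_derivative_iff_has_vector_derivative)
        then show ?thesis by blast
      qed
      have "continuous_on {0..} r"
        using D by (auto simp: continuous_on_eq_continuous_within intro: has_vector_derivative_continuous)
      then show "continuous_on {0..l} r" by (rule continuous_on_subset) auto
  qed
  then have "exp (l * trC - l\<^sup>2 * trC2) * (LINT \<omega>|M. exp (- l * V \<omega>)) \<le> 1"
    using g_0 by (simp add: r_def g_real)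
  then have "exp (- l * trC + l\<^sup>2 * trC2) * (exp (l * trC - l\<^sup>2 * trC2) * (LINT \<omega>|M. exp (- l * V \<omega>))) \<le> exp (- l * trC + l\<^sup>2 * trC2) * 1"
    by (intro mult_left_mono) auto
  then show ?thesis by (simp flip: mult.assoc exp_add)
qed

lemma prob_V_small_le:
  assumes "trC2 > 0" "trC \<ge> 0"
  shows "prob {\<omega> \<in> space M. V \<omega> \<le> trC / 2} \<le> exp (- trC\<^sup>2 / (16 * trC2))"
proof -
  \<comment> \<open>Minimiser of the Chernoff exponent
    \<open>- l * trC / 2 + l^2 * trC2\<close>.\<close>
  define l where "l = trC / (4 * trC2)"
  have l: "l \<ge> 0" using assms by (simp add: l_def)
  have "{\<omega> \<in> space M. V \<omega> \<le> trC / 2} \<subseteq> {\<omega> \<in> space M. exp (- l * trC / 2) \<le> exp (- l * V \<omega>)}"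
    using mult_left_mono[OF _ l] by fastforce
  then have "prob {\<omega> \<in> space M. V \<omega> \<le> trC / 2} \<le> prob {\<omega> \<in> space M. exp (- l * trC / 2) \<le> exp (- l * V \<omega>)}"
    by (intro finite_measure_mono) measurable
  also have "\<dots> \<le> (LINT \<omega>|M. exp (- l * V \<omega>)) / exp (- l * trC / 2)"
    using l V_nonneg
    by (intro integral_Markov_inequality_measure[where A = "{}"] integrable_const_bound[where B = 1]) auto
  also have "\<dots> \<le> exp (- l * trC + l\<^sup>2 * trC2) / exp (- l * trC / 2)"
    by (intro divide_right_mono laplace_V_bound l) simp
  also have "\<dots> = exp (- trC\<^sup>2 / (16 * trC2))"
    using assms by (simp add: l_def field_simps power2_eq_square flip: exp_diff)
  finally show ?thesis .
qed

end

section \<open>Central limit theorem for quadratic functionals\<close>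

lemma centred_gaussian_cong_AE:
  assumes "centred_gaussian M X" "Y \<in> borel_measurable M" "AE \<omega> in M. Y \<omega> = X \<omega>"
  shows "centred_gaussian M Y"
  using assms(1) unfolding centred_gaussian_def
proof (elim conjE disjE exE)
  assume "AE \<omega> in M. X \<omega> = 0"
  with assms(3) have "AE \<omega> in M. Y \<omega> = 0" by eventually_elim auto
  then show "Y \<in> borel_measurable M \<and> ((AE \<omega> in M. Y \<omega> = 0) \<or>
      (\<exists>\<sigma>>0. distributed M lborel Y (normal_density 0 \<sigma>)))"
    using assms(2) by simp
next
  fix \<sigma> :: real assume s: "0 < \<sigma>" "distributed M lborel X (normal_density 0 \<sigma>)" and X: "X \<in> borel_measurable M"
  have "distr M lborel Y = distr M lborel X"
    using assms X by (intro distr_cong_AE) auto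
  then have "distributed M lborel Y (normal_density 0 \<sigma>)"
    using s assms(2) by (simp add: distributed_def)
  then show "Y \<in> borel_measurable M \<and> ((AE \<omega> in M. Y \<omega> = 0) \<or>
      (\<exists>\<sigma>>0. distributed M lborel Y (normal_density 0 \<sigma>)))"
    using assms(2) s(1) by blast
qed

context prob_space
begin

lemma centred_gaussian_integrable_pow4:
  assumes "centred_gaussian M X"
  shows "integrable M (\<lambda>\<omega>. X \<omega> ^ 4)"
  using assms unfolding centred_gaussian_def
proof (elim conjE disjE exE)
  assume [measurable]: "X \<in> borel_measurable M" and "AE \<omega> in M. X \<omega> = 0"
  then show ?thesis
    by (subst integrable_cong_AE[where g = "\<lambda>_. 0"]) auto
next
  fix \<sigma> :: real assume s: "0 < \<sigma>" "distributed M lborel X (normal_density 0 \<sigma>)"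
  then show ?thesis
    using distributed_integrable[OF s(2), of "\<lambda>x. x ^ 4"] integrable_normal_moment[OF s(1), of 0 4] by simp
qed

lemma normal_distributed_second_moment:
  assumes "0 < \<sigma>" "distributed M lborel X (normal_density 0 \<sigma>)"
  shows "(LINT \<omega>|M. (X \<omega>)\<^sup>2) = \<sigma>\<^sup>2"
  using normal_distributed_variance[OF assms] normal_distributed_expectation[OF assms] by simp

lemma centred_gaussian_char:
  assumes "centred_gaussian M X"
  shows "(LINT \<omega>|M. iexp (X \<omega>)) = exp (- (LINT \<omega>|M. (X \<omega>)\<^sup>2) / 2)"
  using assms unfolding centred_gaussian_def
proof (elim conjE disjE exE)
  assume [measurable]: "X \<in> borel_measurable M" and X: "AE \<omega> in M. X \<omega> = 0"
  have "(LINT \<omega>|M. iexp (X \<omega>)) = (LINT \<omega>|M. 1)"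
    using X by (intro integral_cong_AE) auto
  moreover have "(LINT \<omega>|M. (X \<omega>)\<^sup>2) = (LINT \<omega>|M. 0)"
    using X by (intro integral_cong_AE) auto
  ultimately show ?thesis by (simp add: prob_space)
next
  fix \<sigma> :: real assume s: "0 < \<sigma>" "distributed M lborel X (normal_density 0 \<sigma>)" and [measurable]: "X \<in> borel_measurable M"
  define S where "S \<omega> = X \<omega> / \<sigma>" for \<omega>
  have "distributed M lborel S std_normal_density"
    using normal_standard_normal_convert[OF s(1), of X 0] s(2) by (simp add: S_def[abs_def])
  then have d: "distr M borel S = std_normal_distribution" 
    by (simp add: distributed_def cong: distr_cong)
  have [measurable]: "S \<in> borel_measurable M" unfolding S_def[abs_def] by measurable
  have "(LINT \<omega>|M. iexp (X \<omega>)) = char (distr M borel S) \<sigma>"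
    unfolding char_def using s(1) by (subst integral_distr) (auto simp: S_def)
  also have "\<dots> = exp (- \<sigma>\<^sup>2 / 2)"
    unfolding d char_std_normal_distribution by simp
  also have "\<sigma>\<^sup>2 = (LINT \<omega>|M. (X \<omega>)\<^sup>2)"
    by (rule normal_distributed_second_moment[OF s, symmetric])
  finally show ?thesis .
qed

text \<open>Markov's inequality for \<open>exp (X^2 / (4 * \<sigma>^2))\<close>. Its expectation is
  \<open>sqrt 2\<close>, because multiplying the density by this weight gives \<open>sqrt 2\<close>
  times the normal density of variance \<open>2 * \<sigma>^2\<close>. Stating the bound with some
  \<open>s\<close> above the second moment includes the degenerate case.\<close>

lemma centred_gaussian_tail:
  assumes "centred_gaussian M X" "(LINT \<omega>|M. (X \<omega>)\<^sup>2) \<le> s" "s > 0" "a > 0"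
  shows "prob {\<omega> \<in> space M. a \<le> (X \<omega>)\<^sup>2} \<le> 2 * exp (- a / (4 * s))"
  using assms(1) unfolding centred_gaussian_def
proof (elim conjE disjE exE)
  assume [measurable]: "X \<in> borel_measurable M" and X: "AE \<omega> in M. X \<omega> = 0"
  have "prob {\<omega> \<in> space M. a \<le> (X \<omega>)\<^sup>2} = prob {}"
    using X assms(4) by (intro finite_measure_eq_AE) auto
  then show ?thesis by simp
next
  fix \<sigma> :: real assume \<sigma>: "0 < \<sigma>" "distributed M lborel X (normal_density 0 \<sigma>)" and [measurable]: "X \<in> borel_measurable M"
  have \<sigma>s: "\<sigma>\<^sup>2 \<le> s" using normal_distributed_second_moment[OF \<sigma>] assms(2) by simp
  define h where "h x = exp (x\<^sup>2 / (4 * \<sigma>\<^sup>2))" for x :: real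
  have [measurable]: "h \<in> borel_measurable borel" unfolding h_def[abs_def] by measurable
  have dens: "normal_density 0 \<sigma> x * h x = sqrt 2 * normal_density 0 (sqrt 2 * \<sigma>) x" for x
  proof -
    have sq: "(sqrt 2 * \<sigma>)\<^sup>2 = 2 * \<sigma>\<^sup>2" by (simp add: power_mult_distrib)
    have 1: "sqrt (2 * pi * (sqrt 2 * \<sigma>)\<^sup>2) = sqrt 2 * sqrt (2 * pi * \<sigma>\<^sup>2)"
      unfolding sq by (simp add: real_sqrt_mult)
    have e: "- x\<^sup>2 / (2 * \<sigma>\<^sup>2) + x\<^sup>2 / (4 * \<sigma>\<^sup>2) = - x\<^sup>2 / (2 * (sqrt 2 * \<sigma>)\<^sup>2)"
      unfolding sq using \<sigma>(1) by (simp add: field_simps)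
    have 2: "exp (- x\<^sup>2 / (2 * (sqrt 2 * \<sigma>)\<^sup>2)) = exp (- x\<^sup>2 / (2 * \<sigma>\<^sup>2)) * exp (x\<^sup>2 / (4 * \<sigma>\<^sup>2))"
      unfolding exp_add[symmetric] e ..
    show ?thesis unfolding normal_density_def h_def diff_0_right 1 2 by simp
  qed
  have int: "integrable lborel (normal_density 0 (sqrt 2 * \<sigma>))" and one: "(LINT x|lborel. normal_density 0 (sqrt 2 * \<sigma>) x) = 1"
    using \<sigma>(1) by (auto intro!: integrable_normal_density integral_normal_density)
  have ih: "integrable M (\<lambda>\<omega>. h (X \<omega>))"
    using distributed_integrable[OF \<sigma>(2), of h] int by (simp add: dens)
  have Eh: "(LINT \<omega>|M. h (X \<omega>)) = sqrt 2"
    using distributed_integral[OF \<sigma>(2), of h] one by (simp add: dens)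
  have "{\<omega> \<in> space M. a \<le> (X \<omega>)\<^sup>2} \<subseteq> {\<omega> \<in> space M. exp (a / (4 * \<sigma>\<^sup>2)) \<le> h (X \<omega>)}"
    using \<sigma>(1) by (auto simp: h_def divide_right_mono)
  then have "prob {\<omega> \<in> space M. a \<le> (X \<omega>)\<^sup>2} \<le> prob {\<omega> \<in> space M. exp (a / (4 * \<sigma>\<^sup>2)) \<le> h (X \<omega>)}"
    by (intro finite_measure_mono) measurable
  also have "\<dots> \<le> (LINT \<omega>|M. h (X \<omega>)) / exp (a / (4 * \<sigma>\<^sup>2))"
    by (intro integral_Markov_inequality_measure[where A = "{}"] ih) (auto simp: h_def)
  also have "\<dots> = sqrt 2 * exp (- a / (4 * \<sigma>\<^sup>2))"
    unfolding Eh minus_divide_left[symmetric] exp_minus by (rule divide_inverse)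
  also have "\<dots> \<le> 2 * exp (- a / (4 * s))"
  proof (rule mult_mono)
    show "sqrt 2 \<le> 2" by (rule real_le_lsqrt) auto
    show "exp (- a / (4 * \<sigma>\<^sup>2)) \<le> exp (- a / (4 * s))"
      using \<sigma>s \<sigma>(1) assms(3,4) by (simp add: frac_le)
  qed auto
  finally show ?thesis .
qed

text \<open>Membership is up to null sets, since the solution is an arbitrary version of the Wiener
  integrals and not literally one of them.\<close>

definition gaussian_span :: "'i set \<Rightarrow> ('i \<Rightarrow> 'a \<Rightarrow> real) \<Rightarrow> ('a \<Rightarrow> real) set" where
  "gaussian_span I X = {Z \<in> borel_measurable M. \<exists>J c. finite J \<and> J \<subseteq> I \<and> (AE \<omega> in M. Z \<omega> = (\<Sum>i\<in>J. c i * X i \<omega>))}"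

lemma gaussian_span_base:
  assumes "i \<in> I" "Z \<in> borel_measurable M" "AE \<omega> in M. Z \<omega> = X i \<omega>"
  shows "Z \<in> gaussian_span I X"
  unfolding gaussian_span_def using assms by (auto intro!: exI[of _ "{i}"] exI[of _ "\<lambda>_. 1"])

lemma gaussian_span_centred_gaussian:
  assumes "jointly_centred_gaussian M I X" "Z \<in> gaussian_span I X"
  shows "centred_gaussian M Z"
proof -
  obtain J c where J: "finite J" "J \<subseteq> I" "AE \<omega> in M. Z \<omega> = (\<Sum>i\<in>J. c i * X i \<omega>)"
    using assms(2) by (auto simp: gaussian_span_def)
  then have "centred_gaussian M (\<lambda>\<omega>. \<Sum>i\<in>J. c i * X i \<omega>)"
    using assms(1) by (auto simp: jointly_centred_gaussian_def)
  then show ?thesis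
    using J assms(2) by (rule_tac centred_gaussian_cong_AE) (auto simp: gaussian_span_def)
qed

lemma gaussian_space_gaussian_span:
  assumes "jointly_centred_gaussian M I X"
  shows "gaussian_space M (gaussian_span I X)"
proof
  fix Z Z' :: "'a \<Rightarrow> real" and a b :: real
  assume Z: "Z \<in> gaussian_span I X"
  show "Z \<in> borel_measurable M" using Z by (simp add: gaussian_span_def)
  note cg = gaussian_span_centred_gaussian[OF assms Z]
  show "integrable M (\<lambda>\<omega>. Z \<omega> ^ 4)" by (rule centred_gaussian_integrable_pow4[OF cg])
  show "(LINT \<omega>|M. iexp (Z \<omega>)) = exp (- (LINT \<omega>|M. (Z \<omega>)\<^sup>2) / 2)" by (rule centred_gaussian_char[OF cg])
  assume Z': "Z' \<in> gaussian_span I X"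
  obtain J c where J: "finite J" "J \<subseteq> I" "AE \<omega> in M. Z \<omega> = (\<Sum>i\<in>J. c i * X i \<omega>)"
    using Z by (auto simp: gaussian_span_def)
  obtain J' c' where J': "finite J'" "J' \<subseteq> I" "AE \<omega> in M. Z' \<omega> = (\<Sum>i\<in>J'. c' i * X i \<omega>)"
    using Z' by (auto simp: gaussian_span_def)
  define d where "d i = a * (if i \<in> J then c i else 0) + b * (if i \<in> J' then c' i else 0)" for i
  have "AE \<omega> in M. a * Z \<omega> + b * Z' \<omega> = (\<Sum>i\<in>J \<union> J'. d i * X i \<omega>)"
    using J(3) J'(3)
  proof eventually_elim
    case (elim \<omega>)
    have "(\<Sum>i\<in>J. c i * X i \<omega>) = (\<Sum>i\<in>J \<union> J'. (if i \<in> J then c i else 0) * X i \<omega>)"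
      using J(1) J'(1) by (intro sum.mono_neutral_cong_left) auto
    moreover have "(\<Sum>i\<in>J'. c' i * X i \<omega>) = (\<Sum>i\<in>J \<union> J'. (if i \<in> J' then c' i else 0) * X i \<omega>)"
      using J(1) J'(1) by (intro sum.mono_neutral_cong_left) auto
    ultimately show ?case
      using elim by (simp add: d_def distrib_right sum.distrib sum_distrib_left mult.assoc)
  qed
  then show "(\<lambda>\<omega>. a * Z \<omega> + b * Z' \<omega>) \<in> gaussian_span I X"
    using Z Z' J J' unfolding gaussian_span_def
    by (auto intro!: exI[of _ "J \<union> J'"] exI[of _ d])
qed

end

text \<open>Levy's continuity theorem with the bound \<open>char_V_bound\<close>;
  \<open>2 * t2\<close> is the variance of \<open>V\<close>. The sign \<open>t1 - V\<close> is
  chosen because the estimator decreases in \<open>V\<close>.\<close>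

lemma quadratic_form_clt:
  fixes M :: "'a measure" and Y :: "nat \<Rightarrow> 'i \<Rightarrow> 'a \<Rightarrow> real" and I :: "nat \<Rightarrow> 'i set"
  assumes gv: "\<And>n. gaussian_vector M G (I n) (Y n)"
  defines "V \<equiv> \<lambda>n. gaussian_vector.V (I n) (Y n)"
    and "t1 \<equiv> \<lambda>n. gaussian_vector.trC M (I n) (Y n)"
    and "t2 \<equiv> \<lambda>n. gaussian_vector.trC2 M (I n) (Y n)"
    and "t3 \<equiv> \<lambda>n. gaussian_vector.trC3 M (I n) (Y n)"
  assumes pos: "eventually (\<lambda>n. t2 n > 0) sequentially"
    and lim: "(\<lambda>n. t3 n / sqrt (2 * t2 n) ^ 3) \<longlonglongrightarrow> 0"
  shows "weak_conv_m (\<lambda>n. distr M borel (\<lambda>\<omega>. (t1 n - V n \<omega>) / sqrt (2 * t2 n))) std_normal_distribution"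
proof (rule levy_continuity)
  interpret gv: gaussian_vector M G "I n" "Y n" for n by (rule gv)
  have [measurable]: "V n \<in> borel_measurable M" for n
    unfolding V_def by (rule gv.measurable_V)
  show "real_distribution (distr M borel (\<lambda>\<omega>. (t1 n - V n \<omega>) / sqrt (2 * t2 n)))" for n
    by (rule gv.real_distribution_distr) measurable
  show "real_distribution std_normal_distribution" by (rule real_dist_normal_dist)
  fix t :: real
  let ?c = "\<lambda>n. char (distr M borel (\<lambda>\<omega>. (t1 n - V n \<omega>) / sqrt (2 * t2 n))) t"
  have bound: "cmod (?c n - char std_normal_distribution t) \<le> 4 * \<bar>t\<bar> ^ 3 * (t3 n / sqrt (2 * t2 n) ^ 3)"
    if n: "t2 n > 0" for n
  proof -
    \<comment> \<open>The frequency at which the normal factor \<open>exp (- s^2 * t2)\<close>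
      becomes the standard one, \<open>exp (- t^2 / 2)\<close>; the minus sign turns
      \<open>V - t1\<close> into \<open>t1 - V\<close>.\<close>
    define s where "s = - t / sqrt (2 * t2 n)"
    have s2: "s\<^sup>2 * t2 n = t\<^sup>2 / 2" using n by (simp add: s_def power_divide)
    have "?c n = (LINT \<omega>|M. iexp (s * (V n \<omega> - t1 n)))"
      unfolding char_def by (subst integral_distr) (auto simp: s_def algebra_simps diff_divide_distrib)
    then have "cmod (?c n - char std_normal_distribution t) =
       cmod ((LINT \<omega>|M. iexp (s * (V n \<omega> - t1 n))) - exp (- s\<^sup>2 * t2 n))"
    proof -
      have e: "- s\<^sup>2 * t2 n = - t\<^sup>2 / 2" using s2 by simp
      show ?thesis
        unfolding e char_std_normal_distribution \<open>?c n = _\<close> ..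
    qed
    also have "\<dots> \<le> 4 * \<bar>s\<bar> ^ 3 * t3 n"
      unfolding V_def t1_def t2_def t3_def by (rule gv.char_V_bound)
    also have "\<dots> = 4 * \<bar>t\<bar> ^ 3 * (t3 n / sqrt (2 * t2 n) ^ 3)"
      using n by (simp add: s_def power_divide abs_divide)
    finally show ?thesis .
  qed
  have "(\<lambda>n. ?c n - char std_normal_distribution t) \<longlonglongrightarrow> 0"
  proof (rule Lim_null_comparison)
    show "eventually (\<lambda>n. norm (?c n - char std_normal_distribution t) \<le> 4 * \<bar>t\<bar> ^ 3 * (t3 n / sqrt (2 * t2 n) ^ 3)) sequentially"
      using pos by eventually_elim (rule bound)
    show "(\<lambda>n. 4 * \<bar>t\<bar> ^ 3 * (t3 n / sqrt (2 * t2 n) ^ 3)) \<longlonglongrightarrow> 0"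
      using tendsto_mult_left[OF lim, of "4 * \<bar>t\<bar> ^ 3"] by simp
  qed
  then show "?c \<longlonglongrightarrow> char std_normal_distribution t"
    by (rule LIM_zero_cancel)
qed

text \<open>Continuous mapping with maps depending on \<open>n\<close>, in place of a delta method.
  Skorohod's representation supplies pointwise convergent copies, and convergence of
  \<open>h n\<close> along every convergent sequence is just what these require; bounded convergence
  then treats the characteristic functions.\<close>

lemma weak_conv_extended_mapping:
  fixes M :: "'a measure" and F :: "nat \<Rightarrow> 'a \<Rightarrow> real" and h :: "nat \<Rightarrow> real \<Rightarrow> real"
  assumes M: "prob_space M" and [measurable]: "\<And>n. F n \<in> borel_measurable M"
    and \<nu>: "real_distribution \<nu>" and wc: "weak_conv_m (\<lambda>n. distr M borel (F n)) \<nu>"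
    and [measurable]: "\<And>n. h n \<in> borel_measurable borel"
    and h: "\<And>X x. X \<longlonglongrightarrow> x \<Longrightarrow> (\<lambda>n. h n (X n)) \<longlonglongrightarrow> x"
  shows "weak_conv_m (\<lambda>n. distr M borel (\<lambda>\<omega>. h n (F n \<omega>))) \<nu>"
proof (rule levy_continuity)
  interpret prob_space M by (rule M)
  have rd: "real_distribution (distr M borel (F n))" for n
    by (rule real_distribution_distr) measurable
  show "real_distribution (distr M borel (\<lambda>\<omega>. h n (F n \<omega>)))" for n
    by (rule real_distribution_distr) measurable
  show "real_distribution \<nu>" by (rule \<nu>)
  obtain \<Omega> :: "real measure" and Ys Y where \<Omega>: "prob_space \<Omega>"
    and [measurable]: "\<And>n. Ys n \<in> measurable \<Omega> borel" and dYs: "\<And>n. distr \<Omega> borel (Ys n) = distr M borel (F n)"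
    and Y: "Y \<in> measurable \<Omega> lborel" and dY: "distr \<Omega> borel Y = \<nu>"
    and conv: "\<And>x. x \<in> space \<Omega> \<Longrightarrow> (\<lambda>n. Ys n x) \<longlonglongrightarrow> Y x"
    using Skorohod[OF rd \<nu> wc] by metis
  have [measurable]: "Y \<in> borel_measurable \<Omega>" using Y by simp
  interpret \<Omega>: prob_space \<Omega> by (rule \<Omega>)
  fix t :: real
  have "char (distr M borel (\<lambda>\<omega>. h n (F n \<omega>))) t = (LINT x|\<Omega>. iexp (t * h n (Ys n x)))" for n
  proof -
    have "char (distr M borel (\<lambda>\<omega>. h n (F n \<omega>))) t = (LINT y|distr M borel (F n). iexp (t * h n y))"
      unfolding char_def by (simp add: integral_distr)
    also have "\<dots> = (LINT x|\<Omega>. iexp (t * h n (Ys n x)))"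
      unfolding dYs[symmetric] by (simp add: integral_distr)
    finally show ?thesis .
  qed
  moreover have "char \<nu> t = (LINT x|\<Omega>. iexp (t * Y x))"
    unfolding dY[symmetric] char_def by (simp add: integral_distr)
  moreover have "(\<lambda>n. LINT x|\<Omega>. iexp (t * h n (Ys n x))) \<longlonglongrightarrow> (LINT x|\<Omega>. iexp (t * Y x))"
  proof (rule integral_dominated_convergence[where w = "\<lambda>_. 1"])
    show "AE x in \<Omega>. (\<lambda>n. iexp (t * h n (Ys n x))) \<longlonglongrightarrow> iexp (t * Y x)"
      by (intro AE_I2 tendsto_intros h conv)
  qed (auto simp del: of_real_mult)
  ultimately show "(\<lambda>n. char (distr M borel (\<lambda>\<omega>. h n (F n \<omega>))) t) \<longlonglongrightarrow> char \<nu> t"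
    by simp
qed

section \<open>Covariance of the wave solution\<close>

definition spow :: "real \<Rightarrow> real \<Rightarrow> real" where
  "spow q w = sgn w * \<bar>w\<bar> powr q"

lemma spow_nonneg_eq: "0 \<le> w \<Longrightarrow> spow q w = w powr q"
  by (cases "w = 0") (simp_all add: spow_def)

lemma spow_minus: "spow q (- w) = - spow q w"
  by (simp add: spow_def sgn_minus)

lemma spow_eq_max: "q > 0 \<Longrightarrow> spow q w = max 0 w powr q - max 0 (- w) powr q"
  by (cases w "0 :: real" rule: linorder_cases) (simp_all add: spow_def max_def)

lemma continuous_on_spow:
  assumes "q > 0" "continuous_on S f"
  shows "continuous_on S (\<lambda>x. spow q (f x))"
  unfolding spow_eq_max[OF assms(1)] using assms
  by (intro continuous_on_diff continuous_on_powr' continuous_on_max continuous_on_const continuous_on_minus) auto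

text \<open>The purpose of the sign in \<open>spow\<close>: one continuous antiderivative of the
  even power \<open>q * \<bar>w\<bar> powr (q - 1)\<close> on both sides of its possible singularity
  at 0.\<close>

lemma DERIV_spow:
  assumes "w \<noteq> 0"
  shows "(spow q has_real_derivative q * \<bar>w\<bar> powr (q - 1)) (at w)"
proof (cases "w > 0")
  case True
  have "((\<lambda>w. w powr q) has_real_derivative q * w powr (q - 1)) (at w)"
    using True by (rule has_real_derivative_powr)
  then show ?thesis
    using True by (rule_tac has_field_derivative_transform_within_open[where S = "{0<..}" and f = "\<lambda>w. w powr q"])
      (auto simp: spow_def)
next
  case False
  then have w: "w < 0" using assms by simp
  have "((\<lambda>w. - ((- w) powr q)) has_real_derivative q * (- w) powr (q - 1)) (at w)"
    using w by (auto intro!: derivative_eq_intros)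
  then show ?thesis
    using w by (rule_tac has_field_derivative_transform_within_open[where S = "{..<0}" and f = "\<lambda>w. - ((- w) powr q)"])
      (auto simp: spow_def)
qed

lemma DERIV_abs_powr:
  assumes "w \<noteq> 0"
  shows "((\<lambda>w. \<bar>w\<bar> powr q) has_real_derivative q * spow (q - 1) w) (at w)"
proof (cases "w > 0")
  case True
  have "((\<lambda>w. w powr q) has_real_derivative q * w powr (q - 1)) (at w)"
    using True by (rule has_real_derivative_powr)
  then show ?thesis
    using True by (rule_tac has_field_derivative_transform_within_open[where S = "{0<..}" and f = "\<lambda>w. w powr q"])
      (auto simp: spow_def)
next
  case False
  then have w: "w < 0" using assms by simp
  have "((\<lambda>w. (- w) powr q) has_real_derivative - q * (- w) powr (q - 1)) (at w)"
    using w by (auto intro!: derivative_eq_intros)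
  then show ?thesis
    using w by (rule_tac has_field_derivative_transform_within_open[where S = "{..<0}" and f = "\<lambda>w. (- w) powr q"])
      (auto simp: spow_def)
qed

text \<open>The exponent \<open>q - 1\<close> may be negative, so the integrand may blow up at
  \<open>v = r\<close>. The antiderivative stays continuous there, and the fundamental theorem
  tolerates this exceptional point.\<close>

lemma has_integral_abs_diff_powr:
  assumes "q > 0" "0 \<le> r" "0 \<le> b"
  shows "((\<lambda>v. \<bar>r - v\<bar> powr (q - 1)) has_integral (r powr q + spow q (b - r)) / q) {0..b}"
proof -
  have "((\<lambda>v. \<bar>r - v\<bar> powr (q - 1)) has_integral (spow q (b - r) / q - spow q (0 - r) / q)) {0..b}"
  proof (rule fundamental_theorem_of_calculus_interior_strong[where S = "{r}" and f = "\<lambda>v. spow q (v - r) / q"])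
    fix v assume "v \<in> {0<..<b} - {r}"
    then have v: "v - r \<noteq> 0" by auto
    have "((\<lambda>v. spow q (v - r) / q) has_real_derivative (q * \<bar>v - r\<bar> powr (q - 1)) * 1 / q) (at v)"
      by (intro DERIV_cdivide DERIV_chain2[where f = "spow q" and g = "\<lambda>v. v - r", OF DERIV_spow[OF v]]) (auto intro!: derivative_eq_intros)
    then show "((\<lambda>v. spow q (v - r) / q) has_vector_derivative \<bar>r - v\<bar> powr (q - 1)) (at v)"
      using assms(1) by (simp add: has_real_derivative_iff_has_vector_derivative abs_minus_commute)
  next
    show "continuous_on {0..b} (\<lambda>v. spow q (v - r) / q)"
      using assms(1) by (intro continuous_intros continuous_on_spow) auto
  qed (use assms in auto)
  then show ?thesis
    using assms spow_minus[of q r] spow_nonneg_eq[of r q] by (simp add: add_divide_distrib algebra_simps)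
qed

text \<open>The outer integration of the kernel over the rectangle with sides \<open>a\<close> and
  \<open>b\<close>, the inner one being \<open>has_integral_abs_diff_powr\<close>.\<close>

lemma has_integral_powr_add_spow:
  assumes "q > 0" "0 \<le> a" "0 \<le> b"
  shows "((\<lambda>r. (r powr q + spow q (b - r)) / q) has_integral
     (a powr (q + 1) + b powr (q + 1) - \<bar>b - a\<bar> powr (q + 1)) / (q * (q + 1))) {0..a}"
proof -
  let ?f = "\<lambda>r. (r powr (q + 1) - \<bar>b - r\<bar> powr (q + 1)) / (q * (q + 1))"
  have "((\<lambda>r. (r powr q + spow q (b - r)) / q) has_integral (?f a - ?f 0)) {0..a}"
  proof (rule fundamental_theorem_of_calculus_interior_strong[where S = "{b}" and f = ?f])
    fix r assume "r \<in> {0<..<a} - {b}"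
    then have r: "r > 0" "b - r \<noteq> 0" by auto
    have "(?f has_real_derivative ((q + 1) * r powr (q + 1 - 1) - ((q + 1) * spow (q + 1 - 1) (b - r)) * (0 - 1)) / (q * (q + 1))) (at r)"
      using r by (intro DERIV_cdivide DERIV_diff has_real_derivative_powr DERIV_chain2[OF DERIV_abs_powr] DERIV_const DERIV_ident)
    moreover have "((q + 1) * r powr (q + 1 - 1) - ((q + 1) * spow (q + 1 - 1) (b - r)) * (0 - 1)) / (q * (q + 1)) = (r powr q + spow q (b - r)) / q"
      using assms(1) by (simp add: divide_simps) (simp add: algebra_simps)
    ultimately show "(?f has_vector_derivative (r powr q + spow q (b - r)) / q) (at r)"
      by (simp add: has_real_derivative_iff_has_vector_derivative)
  next
    show "continuous_on {0..a} ?f"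
      using assms by (intro continuous_on_divide continuous_on_diff continuous_on_powr' continuous_intros) auto
  qed (use assms in auto)
  moreover have "?f a - ?f 0 = (a powr (q + 1) + b powr (q + 1) - \<bar>b - a\<bar> powr (q + 1)) / (q * (q + 1))"
    using assms by (simp add: diff_divide_distrib add_divide_distrib)
  ultimately show ?thesis by simp
qed

lemma powr_add_spow_nonneg:
  assumes "q > 0" "0 \<le> r" "0 \<le> b"
  shows "0 \<le> r powr q + spow q (b - r)"
proof (cases "b \<ge> r")
  case True
  then show ?thesis by (simp add: spow_nonneg_eq)
next
  case False
  have "spow q (b - r) = - ((r - b) powr q)"
    using spow_minus[of q "r - b"] spow_nonneg_eq[of "r - b" q] False by simp
  moreover have "(r - b) powr q \<le> r powr q"
    using False assms by (intro powr_mono2) auto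
  ultimately show ?thesis by simp
qed

text \<open>The integration in space: at distance \<open>z\<close> from \<open>x\<close> the time
  rectangle has sides \<open>s - z\<close> and \<open>t - z\<close>, whose difference
  \<open>t - s\<close> does not depend on \<open>z\<close>.\<close>

lemma has_integral_increment_powr:
  fixes c s t :: real
  assumes "c > 0" "0 \<le> s" "s \<le> t"
  shows "((\<lambda>z. (s - z) powr c + (t - z) powr c - (t - s) powr c) has_integral
    ((s powr (c + 1) + t powr (c + 1) - (t - s) powr (c + 1)) / (c + 1) - s * (t - s) powr c)) {0..s}"
proof -
  let ?f = "\<lambda>z. - ((s - z) powr (c + 1) + (t - z) powr (c + 1)) / (c + 1) - (t - s) powr c * z"
  have 1: "((\<lambda>z. (s - z) powr c + (t - z) powr c - (t - s) powr c) has_integral (?f s - ?f 0)) {0..s}"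
  proof (rule fundamental_theorem_of_calculus_interior_strong[where S = "{}" and f = ?f])
    fix z assume "z \<in> {0<..<s} - {}"
    then have z: "s - z > 0" "t - z > 0" using assms by auto
    have "(?f has_real_derivative (s - z) powr c + (t - z) powr c - (t - s) powr c) (at z)"
      using z assms(1) by (auto intro!: derivative_eq_intros simp: divide_simps) (simp add: algebra_simps)
    then show "(?f has_vector_derivative (s - z) powr c + (t - z) powr c - (t - s) powr c) (at z)"
      by (simp add: has_real_derivative_iff_has_vector_derivative)
  next
    show "continuous_on {0..s} ?f"
      using assms by (intro continuous_on_divide continuous_on_diff continuous_on_minus continuous_on_add
          continuous_on_powr' continuous_intros) auto
  qed (use assms in auto)
  have 2: "?f s - ?f 0 = (s powr (c + 1) + t powr (c + 1) - (t - s) powr (c + 1)) / (c + 1) - s * (t - s) powr c"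
    using assms by (simp add: diff_divide_distrib add_divide_distrib)
  show ?thesis using 1 unfolding 2 .
qed

section \<open>Passage between gauge, nonnegative and iterated Bochner integrals\<close>

lemma nn_integral_half_open:
  fixes f :: "real \<Rightarrow> ennreal"
  shows "(\<integral>\<^sup>+ v. f v * indicator {0..<b} v \<partial>lborel) = (\<integral>\<^sup>+ v. f v * indicator {0..b} v \<partial>lborel)"
proof (rule nn_integral_cong_AE)
  show "AE v in lborel. f v * indicator {0..<b} v = f v * indicator {0..b} v"
    using AE_lborel_singleton[of b] by eventually_elim (auto simp: indicator_def)
qed

text \<open>The two sides of \<open>x\<close> contribute equally, whence the factor 2; the endpoints
  at distance \<open>m\<close> form a null set.\<close>

lemma nn_integral_reflected:
  fixes \<phi> :: "real \<Rightarrow> real"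
  assumes [measurable]: "\<phi> \<in> borel_measurable borel" and nn: "\<And>z. z \<in> {0..m} \<Longrightarrow> 0 \<le> \<phi> z" and I: "(\<phi> has_integral I) {0..m}" and m: "0 \<le> m"
  shows "(\<integral>\<^sup>+ y. ennreal (\<phi> \<bar>x - y\<bar>) * indicator {..<m} \<bar>x - y\<bar> \<partial>lborel) = ennreal (2 * I)"
proof -
  have I1: "((\<lambda>w. \<phi> \<bar>w\<bar>) has_integral I) {0..m}"
    using I by (rule has_integral_eq[rotated]) simp
  have "((\<lambda>w. \<phi> \<bar>- w\<bar>) has_integral I) {-m..-0}"
    using I1 by (subst has_integral_reflect_real) auto
  then have I2: "((\<lambda>w. \<phi> \<bar>w\<bar>) has_integral I) {-m..0}" by simp
  have "((\<lambda>w. \<phi> \<bar>w\<bar>) has_integral (I + I)) {-m..m}"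
    using m by (intro has_integral_combine[OF _ _ I2 I1]) auto
  then have *: "(\<integral>\<^sup>+ w. ennreal (\<phi> \<bar>w\<bar>) * indicator {-m..m} w \<partial>lborel) = ennreal (2 * I)"
    using nn by (subst nn_integral_has_integral_lebesgue') auto
  have "(\<integral>\<^sup>+ y. ennreal (\<phi> \<bar>x - y\<bar>) * indicator {..<m} \<bar>x - y\<bar> \<partial>lborel) =
    (\<integral>\<^sup>+ y. ennreal (\<phi> \<bar>x - y\<bar>) * indicator {-m..m} (x - y) \<partial>lborel)"
  proof (rule nn_integral_cong_AE)
    show "AE y in lborel. ennreal (\<phi> \<bar>x - y\<bar>) * indicator {..<m} \<bar>x - y\<bar> = ennreal (\<phi> \<bar>x - y\<bar>) * indicator {-m..m} (x - y)"
      using AE_lborel_singleton[of "x - m"] AE_lborel_singleton[of "x + m"]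
      by eventually_elim (auto simp: indicator_def)
  qed
  also have "\<dots> = (\<integral>\<^sup>+ w. ennreal (\<phi> \<bar>w\<bar>) * indicator {-m..m} w \<partial>lborel)"
    by (subst (2) nn_integral_real_affine[where c = "-1" and t = x]) auto
  finally show ?thesis using * by simp
qed

lemma integral_enn2real:
  assumes [measurable]: "A \<in> borel_measurable M" and fin: "(\<integral>\<^sup>+ x. A x \<partial>M) < \<infinity>"
  shows "(LINT x|M. enn2real (A x)) = enn2real (\<integral>\<^sup>+ x. A x \<partial>M)"
proof -
  have "AE x in M. A x \<noteq> \<infinity>"
    using fin by (intro nn_integral_PInf_AE) auto
  then have "(\<integral>\<^sup>+ x. ennreal (enn2real (A x)) \<partial>M) = (\<integral>\<^sup>+ x. A x \<partial>M)"
    by (intro nn_integral_cong_AE) (auto simp: less_top)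
  then show ?thesis
    by (subst integral_eq_nn_integral) auto
qed

text \<open>If the nonnegative integral is infinite, both sides are 0 by convention.\<close>

lemma integral_eq_enn2real_nn_integral:
  fixes f :: "'a \<Rightarrow> real"
  assumes "f \<in> borel_measurable M" "\<And>x. 0 \<le> f x"
  shows "(LINT x|M. f x) = enn2real (\<integral>\<^sup>+ x. ennreal (f x) \<partial>M)"
  using assms by (intro integral_eq_nn_integral) auto

lemma iterated_integral2:
  fixes g :: "real \<Rightarrow> real \<Rightarrow> real"
  assumes [measurable]: "(\<lambda>(r, y). g r y) \<in> borel_measurable (borel \<Otimes>\<^sub>M borel)" and nn: "\<And>r y. 0 \<le> g r y"
    and c: "(\<integral>\<^sup>+ r. \<integral>\<^sup>+ y. ennreal (g r y) \<partial>lborel \<partial>lborel) = ennreal c" "0 \<le> c"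
  shows "(LINT r|lborel. LINT y|lborel. g r y) = c"
proof -
  have "(LINT r|lborel. LINT y|lborel. g r y) = (LINT r|lborel. enn2real (\<integral>\<^sup>+ y. ennreal (g r y) \<partial>lborel))"
    using nn by (intro Bochner_Integration.integral_cong refl integral_eq_enn2real_nn_integral) measurable
  also have "\<dots> = c"
    using c by (subst integral_enn2real) auto
  finally show ?thesis .
qed

lemma iterated_integral3:
  fixes g :: "real \<Rightarrow> real \<Rightarrow> real \<Rightarrow> real"
  assumes [measurable]: "(\<lambda>((r, v), y). g r v y) \<in> borel_measurable ((borel \<Otimes>\<^sub>M borel) \<Otimes>\<^sub>M borel)" and nn: "\<And>r v y. 0 \<le> g r v y"
    and c: "(\<integral>\<^sup>+ r. \<integral>\<^sup>+ v. \<integral>\<^sup>+ y. ennreal (g r v y) \<partial>lborel \<partial>lborel \<partial>lborel) = ennreal c" "0 \<le> c"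
  shows "(LINT r|lborel. LINT v|lborel. LINT y|lborel. g r v y) = c"
proof -
  have g[measurable]: "(\<lambda>x. g (fst (fst x)) (snd (fst x)) (snd x)) \<in> borel_measurable ((borel \<Otimes>\<^sub>M borel) \<Otimes>\<^sub>M borel)"
    using assms(1) by (simp add: case_prod_beta')
  have [measurable]: "g r v \<in> borel_measurable borel" for r v
    using measurable_compose[OF _ g, of "\<lambda>y. ((r, v), y)" borel] by simp
  define A where "A r v = (\<integral>\<^sup>+ y. ennreal (g r v y) \<partial>lborel)" for r v
  have [measurable]: "(\<lambda>(r, v). A r v) \<in> borel_measurable (borel \<Otimes>\<^sub>M borel)"
    unfolding A_def by measurable
  have "(LINT r|lborel. LINT v|lborel. LINT y|lborel. g r v y) = (LINT r|lborel. LINT v|lborel. enn2real (A r v))"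
    unfolding A_def using nn by (intro Bochner_Integration.integral_cong refl integral_eq_enn2real_nn_integral) measurable
  also have "\<dots> = (LINT r|lborel. enn2real (\<integral>\<^sup>+ v. A r v \<partial>lborel))"
  proof (rule integral_cong_AE)
    \<comment> \<open>Finiteness of the triple integral makes the inner double integral finite only
      for almost every \<open>r\<close>, so the integrands are compared almost everywhere.\<close>
    have "AE r in lborel. (\<integral>\<^sup>+ v. A r v \<partial>lborel) \<noteq> \<infinity>"
      using c(1) unfolding A_def[symmetric] by (intro nn_integral_PInf_AE) auto
    then show "AE r in lborel. (LINT v|lborel. enn2real (A r v)) = enn2real (\<integral>\<^sup>+ v. A r v \<partial>lborel)"
      by eventually_elim (rule integral_enn2real, auto simp: less_top)
  qed measurable
  also have "\<dots> = c"
    using c unfolding A_def[symmetric] by (subst integral_enn2real) auto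
  finally show ?thesis .
qed

section \<open>The covariance of the solution at two times\<close>

definition wave_integrand :: "real \<Rightarrow> real \<Rightarrow> real \<times> real \<Rightarrow> real" where
  "wave_integrand x t = (\<lambda>(r, y). indicator {0..t} r * wave_kernel (t - r) (x - y))"

text \<open>The covariance of the solution at times \<open>s\<close> and \<open>t\<close> and the
  same point \<open>x\<close>, on which it does not depend. For \<open>H = 1/2\<close> and
  nonnegative times it reduces to \<open>(min s t)^2 / 4\<close>.\<close>

definition wave_covariance :: "real \<Rightarrow> real \<Rightarrow> real \<Rightarrow> real" where
  "wave_covariance H s t =
    ((s powr (2 * H + 1) + t powr (2 * H + 1) - \<bar>t - s\<bar> powr (2 * H + 1)) / (2 * H + 1)
      - min s t * \<bar>t - s\<bar> powr (2 * H)) / 4"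

text \<open>For fixed \<open>y\<close> the backward light cone is a time interval. Hence, with the
  integration over \<open>y\<close> performed last, the times \<open>r\<close> and \<open>v\<close>
  range over a rectangle.\<close>

lemma wave_integrand_eq:
  "0 \<le> r \<Longrightarrow> wave_integrand x t (r, y) = 1/2 * indicator {0..<t - \<bar>x - y\<bar>} r"
  by (auto simp: wave_integrand_def wave_kernel_def indicator_def)

lemma wave_integrand_nonneg: "0 \<le> wave_integrand x t p"
  by (auto simp: wave_integrand_def wave_kernel_def indicator_def split: prod.splits)

lemma measurable_wave_integrand [measurable]: "wave_integrand x t \<in> borel_measurable borel"
proof -
  have "(\<lambda>p :: real \<times> real. if 0 \<le> fst p \<and> fst p \<le> t \<and> \<bar>x - snd p\<bar> < t - fst p then 1/2 else 0 :: real) \<in> borel_measurable (borel \<Otimes>\<^sub>M borel)"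
    by measurable
  also have "(\<lambda>p :: real \<times> real. if 0 \<le> fst p \<and> fst p \<le> t \<and> \<bar>x - snd p\<bar> < t - fst p then 1/2 else 0 :: real) = wave_integrand x t"
    by (auto simp: wave_integrand_def wave_kernel_def indicator_def fun_eq_iff)
  finally show ?thesis by (simp add: borel_prod)
qed

lemma nn_integral_kernel_rectangle:
  assumes q: "q > 0" and a: "0 \<le> a" and b: "0 \<le> b"
  shows "(\<integral>\<^sup>+ r. (\<integral>\<^sup>+ v. ennreal (\<bar>r - v\<bar> powr (q - 1)) * indicator {0..<b} v \<partial>lborel) * indicator {0..<a} r \<partial>lborel)
    = ennreal ((a powr (q + 1) + b powr (q + 1) - \<bar>b - a\<bar> powr (q + 1)) / (q * (q + 1)))"
proof -
  have "(\<integral>\<^sup>+ v. ennreal (\<bar>r - v\<bar> powr (q - 1)) * indicator {0..<b} v \<partial>lborel) = ennreal ((r powr q + spow q (b - r)) / q)"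
    if "0 \<le> r" for r
    unfolding nn_integral_half_open
    by (rule nn_integral_has_integral_lebesgue'[OF _ has_integral_abs_diff_powr[OF q that b]]) simp
  then have "(\<integral>\<^sup>+ r. (\<integral>\<^sup>+ v. ennreal (\<bar>r - v\<bar> powr (q - 1)) * indicator {0..<b} v \<partial>lborel) * indicator {0..<a} r \<partial>lborel)
    = (\<integral>\<^sup>+ r. ennreal ((r powr q + spow q (b - r)) / q) * indicator {0..<a} r \<partial>lborel)"
    by (intro nn_integral_cong) (auto simp: indicator_def)
  also have "\<dots> = ennreal ((a powr (q + 1) + b powr (q + 1) - \<bar>b - a\<bar> powr (q + 1)) / (q * (q + 1)))"
    unfolding nn_integral_half_open
    by (rule nn_integral_has_integral_lebesgue'[OF _ has_integral_powr_add_spow[OF q a b]])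
       (use powr_add_spow_nonneg[OF q _ b] q in auto)
  finally show ?thesis .
qed

lemma increment_powr_nonneg:
  fixes c s t :: real
  assumes "c > 0" "0 \<le> s" "s \<le> t"
  shows "0 \<le> s powr c + t powr c - (t - s) powr c"
  using powr_mono2[of c "t - s" t] powr_ge_zero[of s c] assms by linarith

text \<open>Tonelli moves \<open>y\<close> to the outside; each \<open>y\<close> with \<bar>x -
  y\<bar> < s then contributes the kernel integrated over a rectangle, and the result depends only
  on \<bar>x - y\<bar>. The factor 1/4 comes from the two wave kernels.\<close>

lemma wave_nn_integral:
  assumes H: "1/2 < H" and s: "0 \<le> s" and st: "s \<le> t"
  shows "(\<integral>\<^sup>+ r\<in>{0..}. (\<integral>\<^sup>+ v\<in>{0..}. (\<integral>\<^sup>+ y.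
              ennreal (wave_integrand x s (r, y) * wave_integrand x t (v, y) * \<bar>r - v\<bar> powr (2 * H - 2))
              \<partial>lborel) \<partial>lborel) \<partial>lborel) = ennreal (wave_covariance H s t / (H * (2 * H - 1)))"
proof -
  define q where "q = 2 * H - 1"
  have q: "q > 0" using H by (simp add: q_def)
  define h where "h r v y = ennreal (1/4 * \<bar>r - v\<bar> powr (q - 1)) * indicator {0..<s - \<bar>x - y\<bar>} r * indicator {0..<t - \<bar>x - y\<bar>} v"
    for r v y
  \<comment> \<open>The endpoint of the interval moves with \<open>y\<close>; written as a condition
    on the pair, the indicator is visibly jointly measurable.\<close>
  have ind: "indicator {0..<c - \<bar>x - y\<bar>} r = (if 0 \<le> r \<and> \<bar>x - y\<bar> < c - r then 1 else 0 :: ennreal)" for c y r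
    by (auto simp: indicator_def)
  have [measurable]: "(\<lambda>p. h (fst (fst p)) (snd (fst p)) (snd p)) \<in> borel_measurable ((borel \<Otimes>\<^sub>M borel) \<Otimes>\<^sub>M borel)"
    unfolding h_def ind by measurable
  have [measurable]: "(\<lambda>p. h (fst (fst p)) (snd p) (snd (fst p))) \<in> borel_measurable ((borel \<Otimes>\<^sub>M borel) \<Otimes>\<^sub>M borel)"
    "(\<lambda>p. h (snd (fst p)) (snd p) (fst (fst p))) \<in> borel_measurable ((borel \<Otimes>\<^sub>M borel) \<Otimes>\<^sub>M borel)"
    unfolding h_def ind by measurable
  have [measurable]: "(\<lambda>p. h r (fst p) (snd p)) \<in> borel_measurable (borel \<Otimes>\<^sub>M borel)"
    "(\<lambda>p. h r (snd p) (fst p)) \<in> borel_measurable (borel \<Otimes>\<^sub>M borel)" for r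
    unfolding h_def ind by measurable
  have "(\<integral>\<^sup>+ r\<in>{0..}. (\<integral>\<^sup>+ v\<in>{0..}. (\<integral>\<^sup>+ y.
              ennreal (wave_integrand x s (r, y) * wave_integrand x t (v, y) * \<bar>r - v\<bar> powr (2 * H - 2))
              \<partial>lborel) \<partial>lborel) \<partial>lborel) = (\<integral>\<^sup>+ r. \<integral>\<^sup>+ v. \<integral>\<^sup>+ y. h r v y \<partial>lborel \<partial>lborel \<partial>lborel)"
  proof (rule nn_integral_cong)
    fix r :: real
    have *: "(\<integral>\<^sup>+ y. ennreal (wave_integrand x s (r, y) * wave_integrand x t (v, y) * \<bar>r - v\<bar> powr (2 * H - 2)) \<partial>lborel)
      = (\<integral>\<^sup>+ y. h r v y \<partial>lborel)" if "0 \<le> r" "0 \<le> v" for v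
      using that by (intro nn_integral_cong) (auto simp: wave_integrand_eq h_def q_def indicator_def)
    have 0: "integral\<^sup>N lborel (h r v) = 0" if "r < 0 \<or> v < 0" for v
    proof -
      have "h r v = (\<lambda>_. 0)" using that by (auto simp: h_def)
      then show ?thesis by simp
    qed
    show "(\<integral>\<^sup>+ v\<in>{0..}. (\<integral>\<^sup>+ y. ennreal (wave_integrand x s (r, y) * wave_integrand x t (v, y) * \<bar>r - v\<bar> powr (2 * H - 2))
              \<partial>lborel) \<partial>lborel) * indicator {0..} r = (\<integral>\<^sup>+ v. \<integral>\<^sup>+ y. h r v y \<partial>lborel \<partial>lborel)"
    proof (cases "0 \<le> r")
      case True
      then have "(\<integral>\<^sup>+ v\<in>{0..}. (\<integral>\<^sup>+ y. ennreal (wave_integrand x s (r, y) * wave_integrand x t (v, y) * \<bar>r - v\<bar> powr (2 * H - 2))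
              \<partial>lborel) \<partial>lborel) = (\<integral>\<^sup>+ v. \<integral>\<^sup>+ y. h r v y \<partial>lborel \<partial>lborel)"
        using * 0 by (intro nn_integral_cong) (auto simp: indicator_def not_le)
      then show ?thesis using True by simp
    next
      case False
      then show ?thesis using 0 by simp
    qed
  qed
  also have "\<dots> = (\<integral>\<^sup>+ r. \<integral>\<^sup>+ y. \<integral>\<^sup>+ v. h r v y \<partial>lborel \<partial>lborel \<partial>lborel)"
    by (rule nn_integral_cong, rule lborel_pair.Fubini') measurable
  also have "\<dots> = (\<integral>\<^sup>+ y. \<integral>\<^sup>+ r. \<integral>\<^sup>+ v. h r v y \<partial>lborel \<partial>lborel \<partial>lborel)"
    by (rule lborel_pair.Fubini') measurable
  also have "\<dots> = (\<integral>\<^sup>+ y. ennreal (((s - \<bar>x - y\<bar>) powr (q + 1) + (t - \<bar>x - y\<bar>) powr (q + 1) - (t - s) powr (q + 1)) / (4 * q * (q + 1)))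
       * indicator {..<s} \<bar>x - y\<bar> \<partial>lborel)"
  proof (rule nn_integral_cong)
    fix y :: real
    let ?a = "s - \<bar>x - y\<bar>" and ?b = "t - \<bar>x - y\<bar>"
    show "(\<integral>\<^sup>+ r. \<integral>\<^sup>+ v. h r v y \<partial>lborel \<partial>lborel) = ennreal ((?a powr (q + 1) + ?b powr (q + 1) - (t - s) powr (q + 1)) / (4 * q * (q + 1)))
       * indicator {..<s} \<bar>x - y\<bar>"
    proof (cases "\<bar>x - y\<bar> < s")
      case True
      have "(\<integral>\<^sup>+ r. \<integral>\<^sup>+ v. h r v y \<partial>lborel \<partial>lborel) = (\<integral>\<^sup>+ r. ennreal (1/4) * ((\<integral>\<^sup>+ v. ennreal (\<bar>r - v\<bar> powr (q - 1)) * indicator {0..<?b} v \<partial>lborel) * indicator {0..<?a} r) \<partial>lborel)"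
      proof (rule nn_integral_cong)
        fix r :: real
        have em: "ennreal (1/4 * z) = ennreal (1/4) * ennreal z" if "0 \<le> z" for z
          using that by (intro ennreal_mult) auto
        have "(\<integral>\<^sup>+ v. h r v y \<partial>lborel) = (\<integral>\<^sup>+ v. (ennreal (1/4) * indicator {0..<?a} r) * (ennreal (\<bar>r - v\<bar> powr (q - 1)) * indicator {0..<?b} v) \<partial>lborel)"
          unfolding h_def em[OF powr_ge_zero] by (simp only: mult_ac)
        also have "\<dots> = (ennreal (1/4) * indicator {0..<?a} r) * (\<integral>\<^sup>+ v. ennreal (\<bar>r - v\<bar> powr (q - 1)) * indicator {0..<?b} v \<partial>lborel)"
          by (rule nn_integral_cmult) measurable
        finally show "(\<integral>\<^sup>+ v. h r v y \<partial>lborel) =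
          ennreal (1/4) * ((\<integral>\<^sup>+ v. ennreal (\<bar>r - v\<bar> powr (q - 1)) * indicator {0..<?b} v \<partial>lborel) * indicator {0..<?a} r)"
          by (simp only: mult_ac)
      qed
      also have "\<dots> = ennreal (1/4) * (\<integral>\<^sup>+ r. (\<integral>\<^sup>+ v. ennreal (\<bar>r - v\<bar> powr (q - 1)) * indicator {0..<?b} v \<partial>lborel) * indicator {0..<?a} r \<partial>lborel)"
        by (rule nn_integral_cmult) measurable
      also have "\<dots> = ennreal (1/4) * ennreal ((?a powr (q + 1) + ?b powr (q + 1) - \<bar>?b - ?a\<bar> powr (q + 1)) / (q * (q + 1)))"
        using True st by (subst nn_integral_kernel_rectangle[OF q]) auto
      also have "\<dots> = ennreal ((?a powr (q + 1) + ?b powr (q + 1) - (t - s) powr (q + 1)) / (4 * q * (q + 1)))"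
        using st by (simp add: ennreal_mult'[symmetric] mult.assoc)
      finally show ?thesis using True by simp
    next
      case False
      then show ?thesis by (simp add: h_def)
    qed
  qed
  also have "\<dots> = ennreal (2 * (((s powr (q + 1 + 1) + t powr (q + 1 + 1) - (t - s) powr (q + 1 + 1)) / (q + 1 + 1) - s * (t - s) powr (q + 1)) / (4 * q * (q + 1))))"
  proof (rule nn_integral_reflected)
    show "0 \<le> ((s - z) powr (q + 1) + (t - z) powr (q + 1) - (t - s) powr (q + 1)) / (4 * q * (q + 1))" if "z \<in> {0..s}" for z
      using increment_powr_nonneg[of "q + 1" "s - z" "t - z"] that st q by simp
    show "((\<lambda>z. ((s - z) powr (q + 1) + (t - z) powr (q + 1) - (t - s) powr (q + 1)) / (4 * q * (q + 1))) has_integral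
      ((s powr (q + 1 + 1) + t powr (q + 1 + 1) - (t - s) powr (q + 1 + 1)) / (q + 1 + 1) - s * (t - s) powr (q + 1)) / (4 * q * (q + 1))) {0..s}"
      using q s st by (intro has_integral_divide has_integral_increment_powr) auto
  qed (use s in auto)
  also have "2 * (((s powr (q + 1 + 1) + t powr (q + 1 + 1) - (t - s) powr (q + 1 + 1)) / (q + 1 + 1) - s * (t - s) powr (q + 1)) / (4 * q * (q + 1)))
     = wave_covariance H s t / (H * (2 * H - 1))"
  proof -
    have e: "q + 1 = 2 * H" "2 * H - 1 = q" by (simp_all add: q_def)
    have m: "min s t = s" "\<bar>t - s\<bar> = t - s" using st by auto
    have "2 * (a / (4 * q * (2 * H))) = a / 4 / (H * q)" for a by simp
    then show ?thesis unfolding wave_covariance_def e m .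
  qed
  finally show ?thesis .
qed

text \<open>For white noise only the intersection of the two cones counts. It is the smaller cone,
  of area \<open>s^2\<close>, weighted by 1/4.\<close>

lemma wave_nn_integral_half:
  assumes s: "0 \<le> s" and st: "s \<le> t"
  shows "(\<integral>\<^sup>+ r\<in>{0..}. (\<integral>\<^sup>+ y. ennreal (wave_integrand x s (r, y) * wave_integrand x t (r, y)) \<partial>lborel) \<partial>lborel)
     = ennreal (wave_covariance (1/2) s t)"
proof -
  define h where "h r y = ennreal (1/4) * indicator {0..<s - \<bar>x - y\<bar>} r" for r y
  have ind: "indicator {0..<c - \<bar>x - y\<bar>} r = (if 0 \<le> r \<and> \<bar>x - y\<bar> < c - r then 1 else 0 :: ennreal)" for c y r
    by (auto simp: indicator_def)
  have [measurable]: "(\<lambda>p. h (fst p) (snd p)) \<in> borel_measurable (borel \<Otimes>\<^sub>M borel)"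
    "(\<lambda>p. h (snd p) (fst p)) \<in> borel_measurable (borel \<Otimes>\<^sub>M borel)"
    unfolding h_def ind by measurable
  have "(\<integral>\<^sup>+ r\<in>{0..}. (\<integral>\<^sup>+ y. ennreal (wave_integrand x s (r, y) * wave_integrand x t (r, y)) \<partial>lborel) \<partial>lborel)
    = (\<integral>\<^sup>+ r. \<integral>\<^sup>+ y. h r y \<partial>lborel \<partial>lborel)"
  proof (rule nn_integral_cong)
    fix r :: real
    have "ennreal (wave_integrand x s (r, y) * wave_integrand x t (r, y)) = h r y" if "0 \<le> r" for y
      using that st by (auto simp: wave_integrand_eq h_def indicator_def)
    then show "(\<integral>\<^sup>+ y. ennreal (wave_integrand x s (r, y) * wave_integrand x t (r, y)) \<partial>lborel) * indicator {0..} r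
      = (\<integral>\<^sup>+ y. h r y \<partial>lborel)"
      by (cases "0 \<le> r") (auto simp: h_def)
  qed
  also have "\<dots> = (\<integral>\<^sup>+ y. \<integral>\<^sup>+ r. h r y \<partial>lborel \<partial>lborel)"
    by (rule lborel_pair.Fubini') measurable
  also have "\<dots> = (\<integral>\<^sup>+ y. ennreal ((s - \<bar>x - y\<bar>) / 4) * indicator {..<s} \<bar>x - y\<bar> \<partial>lborel)"
  proof (rule nn_integral_cong)
    fix y :: real
    show "(\<integral>\<^sup>+ r. h r y \<partial>lborel) = ennreal ((s - \<bar>x - y\<bar>) / 4) * indicator {..<s} \<bar>x - y\<bar>"
      by (cases "\<bar>x - y\<bar> < s") (auto simp: h_def nn_integral_cmult_indicator simp flip: ennreal_mult')
  qed
  also have "\<dots> = ennreal (2 * (s\<^sup>2 / 8))"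
  proof (rule nn_integral_reflected)
    let ?f = "\<lambda>z. (s * z - z\<^sup>2 / 2) / 4"
    have "((\<lambda>z. (s - z) / 4) has_integral (?f s - ?f 0)) {0..s}"
    proof (rule fundamental_theorem_of_calculus)
      show "(?f has_vector_derivative (s - z) / 4) (at z within {0..s})" for z
        unfolding has_real_derivative_iff_has_vector_derivative[symmetric]
        by (auto intro!: derivative_eq_intros)
    qed (rule s)
    then show "((\<lambda>z. (s - z) / 4) has_integral s\<^sup>2 / 8) {0..s}"
      by (simp add: power2_eq_square)
  qed (use s in auto)
  also have "2 * (s\<^sup>2 / 8) = wave_covariance (1/2) s t"
    using s st by (simp add: wave_covariance_def min_def power2_eq_square field_simps)
  finally show ?thesis .
qed

lemma wave_covariance_commute: "wave_covariance H s t = wave_covariance H t s"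
  by (simp add: wave_covariance_def min.commute abs_minus_commute add.commute)

text \<open>Up to a factor it is the integral in \<open>has_integral_increment_powr\<close>, whose
  integrand is nonnegative.\<close>

lemma wave_covariance_nonneg:
  assumes "1/2 \<le> H" "0 \<le> s" "s \<le> t"
  shows "0 \<le> wave_covariance H s t"
proof -
  have "((\<lambda>z. (s - z) powr (2 * H) + (t - z) powr (2 * H) - (t - s) powr (2 * H)) has_integral
    ((s powr (2 * H + 1) + t powr (2 * H + 1) - (t - s) powr (2 * H + 1)) / (2 * H + 1) - s * (t - s) powr (2 * H))) {0..s}"
    using assms by (intro has_integral_increment_powr) auto
  then have "0 \<le> (s powr (2 * H + 1) + t powr (2 * H + 1) - (t - s) powr (2 * H + 1)) / (2 * H + 1) - s * (t - s) powr (2 * H)"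
    by (rule has_integral_nonneg) (use assms increment_powr_nonneg[of "2 * H" "s - z" "t - z" for z] in auto)
  then show ?thesis using assms by (simp add: wave_covariance_def min_def)
qed

lemma wave_integrand_noise_integrands:
  assumes "1/2 \<le> H" "0 \<le> t"
  shows "wave_integrand x t \<in> noise_integrands H"
proof (cases "H = 1/2")
  case True
  show ?thesis
    using wave_nn_integral_half[OF assms(2) order_refl, of x] True
    by (simp add: noise_integrands_def power2_eq_square)
next
  case False
  then have "1/2 < H" using assms by simp
  from wave_nn_integral[OF this assms(2) order_refl, of x] False show ?thesis
    by (simp add: noise_integrands_def wave_integrand_nonneg)
qed

lemma noise_cov_wave_integrand:
  assumes H: "1/2 \<le> H" and s: "0 \<le> s" and st: "s \<le> t"
  shows "noise_cov H (wave_integrand x s) (wave_integrand x t) = wave_covariance H s t"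
proof (cases "H = 1/2")
  case True
  have [measurable]: "wave_integrand x c \<in> borel_measurable (borel \<Otimes>\<^sub>M borel)" for c
    unfolding borel_prod by measurable
  have "(\<lambda>p. indicator {0..} (fst p) * (wave_integrand x s p * wave_integrand x t p)) \<in> borel_measurable (borel \<Otimes>\<^sub>M borel)"
    by measurable
  then have m: "(\<lambda>(r, y). indicator {0..} r * (wave_integrand x s (r, y) * wave_integrand x t (r, y))) \<in> borel_measurable (borel \<Otimes>\<^sub>M borel)"
    by (simp add: case_prod_beta')
  have "(\<integral>\<^sup>+ r. \<integral>\<^sup>+ y. ennreal (indicator {0..} r * (wave_integrand x s (r, y) * wave_integrand x t (r, y))) \<partial>lborel \<partial>lborel)
    = ennreal (wave_covariance (1/2) s t)"
    unfolding wave_nn_integral_half[OF s st, of x, symmetric]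
    by (intro nn_integral_cong) (auto simp: indicator_def)
  from iterated_integral2[OF m _ this] show ?thesis
    using wave_covariance_nonneg[of "1/2" s t] s st unfolding True
    by (simp add: noise_cov_def set_lebesgue_integral_def wave_integrand_nonneg)
next
  case False
  then have H': "1/2 < H" using H by simp
  let ?g = "\<lambda>r v y. indicator {0..} r * (indicator {0..} v * (wave_integrand x s (r, y) * wave_integrand x t (v, y) * \<bar>r - v\<bar> powr (2 * H - 2)))"
  have [measurable]: "wave_integrand x c \<in> borel_measurable (borel \<Otimes>\<^sub>M borel)" for c
    unfolding borel_prod by measurable
  have m: "(\<lambda>((r, v), y). ?g r v y) \<in> borel_measurable ((borel \<Otimes>\<^sub>M borel) \<Otimes>\<^sub>M borel)"
    unfolding case_prod_beta' by measurable
  have pos: "0 < H * (2 * H - 1)" using H' by simp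
  have "(\<integral>\<^sup>+ r. \<integral>\<^sup>+ v. \<integral>\<^sup>+ y. ennreal (?g r v y) \<partial>lborel \<partial>lborel \<partial>lborel)
    = ennreal (wave_covariance H s t / (H * (2 * H - 1)))"
    unfolding wave_nn_integral[OF H' s st, of x, symmetric]
  proof (rule nn_integral_cong)
    fix r :: real
    have "(\<integral>\<^sup>+ y. ennreal (?g r v y) \<partial>lborel) = (\<integral>\<^sup>+ y. ennreal (wave_integrand x s (r, y) * wave_integrand x t (v, y) * \<bar>r - v\<bar> powr (2 * H - 2)) \<partial>lborel) * indicator {0..} v * indicator {0..} r" for v
      by (auto simp: indicator_def)
    then show "(\<integral>\<^sup>+ v. \<integral>\<^sup>+ y. ennreal (?g r v y) \<partial>lborel \<partial>lborel) =
      (\<integral>\<^sup>+ v\<in>{0..}. (\<integral>\<^sup>+ y. ennreal (wave_integrand x s (r, y) * wave_integrand x t (v, y) * \<bar>r - v\<bar> powr (2 * H - 2)) \<partial>lborel) \<partial>lborel) * indicator {0..} r"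
      by (auto simp: indicator_def)
  qed
  from iterated_integral3[OF m _ this] have "(LINT r|lborel. LINT v|lborel. LINT y|lborel. ?g r v y) = wave_covariance H s t / (H * (2 * H - 1))"
    using wave_covariance_nonneg[OF H s st] pos by (simp add: wave_integrand_nonneg)
  then show ?thesis
    using False H' by (simp add: noise_cov_def set_lebesgue_integral_def)
qed

section \<open>Covariance of the increments\<close>

lemma powr_mvt:
  fixes x e :: real
  assumes "0 \<le> x" "0 < e"
  obtains z where "x < z" "z < x + 1" "(x + 1) powr e - x powr e = e * z powr (e - 1)"
proof -
  have "\<exists>l z. x < z \<and> z < x + 1 \<and> DERIV (\<lambda>z. z powr e) z :> l \<and> (x + 1) powr e - x powr e = (x + 1 - x) * l"
  proof (rule MVT)
    show "continuous_on {x..x + 1} (\<lambda>z. z powr e)"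
      using assms by (intro continuous_on_powr' continuous_intros) auto
    show "(\<lambda>z. z powr e) differentiable (at z)" if "x < z" "z < x + 1" for z
      using that assms has_real_derivative_powr[of z e] by (auto simp: real_differentiable_def)
  qed simp
  then obtain l z where z: "x < z" "z < x + 1" "DERIV (\<lambda>z. z powr e) z :> l" "(x + 1) powr e - x powr e = l"
    by auto
  then have "l = e * z powr (e - 1)"
    using assms has_real_derivative_powr[of z e] by (auto intro: DERIV_unique)
  with z that show thesis by auto
qed

lemma powr_increment_le:
  fixes x e :: real
  assumes "0 \<le> x" "1 \<le> e"
  shows "(x + 1) powr e - x powr e \<le> e * (x + 1) powr (e - 1)"
proof -
  obtain z where z: "x < z" "z < x + 1" "(x + 1) powr e - x powr e = e * z powr (e - 1)"
    using powr_mvt[of x e] assms by auto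
  have "z powr (e - 1) \<le> (x + 1) powr (e - 1)"
    using z assms by (intro powr_mono2) auto
  then show ?thesis using z(3) assms by simp
qed

text \<open>Convexity of \<open>z powr e\<close>: backward unit differences increase. The bound
  \<open>1 \<le> z\<close> keeps the arguments nonnegative.\<close>

lemma powr_increment_mono:
  fixes z w e :: real
  assumes "1 \<le> z" "z \<le> w" "1 \<le> e"
  shows "z powr e - (z - 1) powr e \<le> w powr e - (w - 1) powr e"
proof (rule DERIV_nonneg_imp_increasing_open[where f = "\<lambda>z. z powr e - (z - 1) powr e"])
  fix x assume x: "z < x" "x < w"
  have "((\<lambda>z. z powr e - (z - 1) powr e) has_real_derivative e * x powr (e - 1) - e * (x - 1) powr (e - 1)) (at x)"
    using x assms by (auto intro!: derivative_eq_intros)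
  moreover have "(x - 1) powr (e - 1) \<le> x powr (e - 1)"
    using x assms by (intro powr_mono2) auto
  then have "0 \<le> e * x powr (e - 1) - e * (x - 1) powr (e - 1)"
    using assms by (simp add: mult_left_mono)
  ultimately show "\<exists>y. ((\<lambda>z. z powr e - (z - 1) powr e) has_real_derivative y) (at x) \<and> 0 \<le> y"
    by blast
next
  show "continuous_on {z..w} (\<lambda>z. z powr e - (z - 1) powr e)"
    using assms by (intro continuous_on_diff continuous_on_powr' continuous_intros) auto
qed (use assms in auto)

text \<open>Unit time steps suffice, by self-similarity of the solution.\<close>

definition incr_cov :: "real \<Rightarrow> nat \<Rightarrow> nat \<Rightarrow> real" where
  "incr_cov H i j = wave_covariance H (i + 1) (j + 1) - wave_covariance H i (j + 1)
     - wave_covariance H (i + 1) j + wave_covariance H i j"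

lemma incr_cov_commute: "incr_cov H i j = incr_cov H j i"
  by (simp add: incr_cov_def wave_covariance_commute)

text \<open>At each \<open>y\<close> under the cone the step adds a unit time interval, which
  contributes 1/4; the width \<open>2 * i\<close> gives the leading term \<open>i / 2\<close>, and
  the constant comes from the tip.\<close>

lemma incr_cov_diag:
  assumes "1/2 \<le> H"
  shows "incr_cov H i i = i / 2 + 1 / (2 * (2 * H + 1))"
proof -
  define p where "p = 2 * H + 1"
  have p: "p > 0" using assms by (simp add: p_def)
  have "wave_covariance H t t = t powr p / (2 * p)" if "0 \<le> t" for t
    unfolding wave_covariance_def p_def[symmetric] by simp
  moreover have "wave_covariance H i (i + 1) = ((i powr p + (i + 1) powr p - 1) / p - i) / 4"
    unfolding wave_covariance_def p_def[symmetric] by (simp add: min_def)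
  ultimately show ?thesis
    using p wave_covariance_commute[of H "i + 1" i] unfolding incr_cov_def p_def[symmetric]
    by (simp add: field_simps)
qed

text \<open>With lag \<open>k\<close>, four times the entry is a second difference of
  \<open>k powr p\<close> over \<open>p\<close>, plus \<open>i\<close> times a second difference of
  \<open>k powr c\<close>, minus \<open>k powr c - (k - 1) powr c\<close>. The second term is
  nonnegative by convexity, and the first outweighs the negative one.\<close>

lemma incr_cov_nonneg_aux:
  assumes H: "1/2 \<le> H" and ij: "i < j"
  shows "0 \<le> incr_cov H i j"
proof -
  define k where "k = real j - real i"
  define c where "c = 2 * H"
  define p where "p = c + 1"
  have k: "1 \<le> k" using ij by (simp add: k_def)
  have c: "1 \<le> c" and p: "p = c + 1" using H by (auto simp: c_def p_def)
  have "4 * incr_cov H i j = ((k + 1) powr p + (k - 1) powr p - 2 * k powr p) / p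
      + i * ((k + 1) powr c + (k - 1) powr c - 2 * k powr c) + (k - 1) powr c - k powr c"
  proof -
    have m: "min (real i + 1) (real j + 1) = real i + 1" "min (real i) (real j + 1) = real i"
      "min (real i + 1) (real j) = real i + 1" "min (real i) (real j) = real i"
      using ij by auto
    have a: "\<bar>real j + 1 - (real i + 1)\<bar> = k" "\<bar>real j + 1 - real i\<bar> = k + 1" "\<bar>real j - (real i + 1)\<bar> = k - 1" "\<bar>real j - real i\<bar> = k"
      using k by (auto simp: k_def)
    have "p > 0" using c p by simp
    then show ?thesis
      unfolding incr_cov_def wave_covariance_def of_nat_add of_nat_1 m a c_def[symmetric] p_def[symmetric]
      by (simp add: field_simps)
  qed
  moreover have "0 \<le> (k + 1) powr c + (k - 1) powr c - 2 * k powr c"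
    using powr_increment_mono[of k "k + 1" c] k c by simp
  \<comment> \<open>As \<open>p = c + 1\<close>, the derivative of \<open>?D\<close> is the backward
    difference of \<open>z powr c\<close>; the second difference is its value at some
    \<open>z\<close> beyond \<open>k\<close>, and \<open>powr_increment_mono\<close> compares it
    with the value at \<open>k\<close>.\<close>
  moreover have "k powr c - (k - 1) powr c \<le> ((k + 1) powr p + (k - 1) powr p - 2 * k powr p) / p"
  proof -
    have "p > 0" using c p by simp
    let ?D = "\<lambda>z. (z powr p - (z - 1) powr p) / p"
    have "\<exists>l z. k < z \<and> z < k + 1 \<and> DERIV ?D z :> l \<and> ?D (k + 1) - ?D k = (k + 1 - k) * l"
    proof (rule MVT[where f = ?D])
      show "continuous_on {k..k + 1} ?D"
        using k c p by (intro continuous_on_divide continuous_on_diff continuous_on_powr' continuous_intros) auto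
      show "?D differentiable (at z)" if "k < z" "z < k + 1" for z
        unfolding real_differentiable_def using that k c p
        by (intro exI) (auto intro!: derivative_eq_intros)
    qed simp
    then obtain l z where z: "k < z" "z < k + 1" "DERIV ?D z :> l" "?D (k + 1) - ?D k = l"
      by auto
    have "DERIV ?D z :> (p * z powr (p - 1) - p * (z - 1) powr (p - 1)) / p"
      using z k \<open>p > 0\<close> by (auto intro!: derivative_eq_intros)
    then have "l = z powr c - (z - 1) powr c"
      using z(3) p c DERIV_unique by (fastforce simp: diff_divide_distrib)
    moreover have "k powr c - (k - 1) powr c \<le> z powr c - (z - 1) powr c"
      using powr_increment_mono[of k z c] k c z by simp
    moreover have "?D (k + 1) - ?D k = ((k + 1) powr p + (k - 1) powr p - 2 * k powr p) / p"
      by (simp add: diff_divide_distrib add_divide_distrib)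
    ultimately show ?thesis using z(4) by simp
  qed
  moreover have "0 \<le> real i * ((k + 1) powr c + (k - 1) powr c - 2 * k powr c)"
    using calculation(2) by simp
  ultimately show ?thesis by linarith
qed

lemma incr_cov_nonneg:
  assumes "1/2 \<le> H"
  shows "0 \<le> incr_cov H i j"
proof (cases i j rule: linorder_cases)
  case equal
  then show ?thesis using assms by (simp add: incr_cov_diag)
next
  case greater
  then show ?thesis using incr_cov_nonneg_aux[OF assms greater] by (simp add: incr_cov_commute)
qed (rule incr_cov_nonneg_aux[OF assms])

text \<open>A row sum telescopes to the covariance of one increment with the solution at time
  \<open>N\<close>, since the covariance with time 0 vanishes. Each difference of powers in its
  closed form is of order \<open>N powr (2 * H)\<close> by the mean value theorem.\<close>

lemma incr_cov_row_sum:
  assumes H: "1/2 \<le> H" "H \<le> 1" and i: "i < N"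
  shows "(\<Sum>j<N. incr_cov H i j) \<le> real N powr (2 * H)"
proof -
  define c where "c = 2 * H"
  define p where "p = c + 1"
  have c: "1 \<le> c" "c \<le> 2" using H by (auto simp: c_def)
  have W0: "wave_covariance H s 0 = 0" if "0 \<le> s" for s
    using that by (simp add: wave_covariance_def)
  have "(\<Sum>j<N. incr_cov H i j) = (\<Sum>j<N. (wave_covariance H (i + 1) (Suc j) - wave_covariance H i (Suc j))
     - (wave_covariance H (i + 1) j - wave_covariance H i j))"
    by (intro sum.cong) (auto simp: incr_cov_def algebra_simps)
  also have "\<dots> = wave_covariance H (i + 1) N - wave_covariance H i N"
    by (subst sum_lessThan_telescope) (simp add: W0)
  finally have eq: "(\<Sum>j<N. incr_cov H i j) = wave_covariance H (i + 1) N - wave_covariance H i N" .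
  define a where "a = real N - real i - 1"
  have a: "0 \<le> a" "a + 1 \<le> N" using i by (auto simp: a_def)
  have x: "((x + 1) powr p - x powr p) / p \<le> N powr c" if "0 \<le> x" "x + 1 \<le> N" for x :: real
  proof -
    have "((x + 1) powr p - x powr p) / p \<le> (x + 1) powr c"
      using powr_increment_le[of x p] that c by (simp add: p_def field_simps)
    also have "\<dots> \<le> N powr c" using that c by (intro powr_mono2) auto
    finally show ?thesis .
  qed
  have "i * ((a + 1) powr c - a powr c) \<le> N * (c * (a + 1) powr (c - 1))"
    using powr_increment_le[of a c] a c i powr_mono2[of c a "a + 1"] by (intro mult_mono) auto
  \<comment> \<open>Here \<open>H \<le> 1\<close> enters as \<open>c \<le> 2\<close>. The three
    bounds add up to \<open>4 * N powr c\<close>, which matches the factor 4 on the left of the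
    final estimate.\<close>
  also have "\<dots> \<le> N * (2 * N powr (c - 1))"
    using a c by (intro mult_left_mono mult_mono powr_mono2) auto
  also have "\<dots> = 2 * N powr c"
    using i powr_mult_base[of N "c - 1"] by simp
  finally have 3: "i * ((a + 1) powr c - a powr c) \<le> 2 * N powr c" .
  have "4 * (wave_covariance H (i + 1) N - wave_covariance H i N) =
     ((i + 1) powr p - i powr p) / p + ((a + 1) powr p - a powr p) / p + i * ((a + 1) powr c - a powr c) - a powr c"
  proof -
    have m: "min (real i + 1) (real N) = real i + 1" "min (real i) (real N) = real i"
      using i by auto
    have b: "\<bar>real N - (real i + 1)\<bar> = a" "\<bar>real N - real i\<bar> = a + 1"
      using i by (auto simp: a_def)
    have "p > 0" using c by (simp add: p_def)
    then show ?thesis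
      unfolding wave_covariance_def m b p_def[symmetric] c_def[symmetric] of_nat_add of_nat_1
      by (simp add: field_simps)
  qed
  also have "\<dots> \<le> N powr c + N powr c + 2 * N powr c - 0"
    using x[of "real i"] x[of a] 3 a i by (intro add_mono diff_mono) (auto simp: add.commute)
  finally show ?thesis using eq by (simp add: c_def)
qed

lemma sum_incr_cov_diag:
  assumes "1/2 \<le> H"
  shows "(\<Sum>i<N. incr_cov H i i) = real N * (real N - 1) / 4 + real N / (2 * (2 * H + 1))"
proof -
  have "(\<Sum>i<N. real i / 2 + d) = real N * (real N - 1) / 4 + real N * d" for d
    by (induction N) (simp_all add: field_simps)
  from this[of "1 / (2 * (2 * H + 1))"] show ?thesis
    by (simp add: incr_cov_diag[OF assms])
qed

text \<open>The diagonal alone suffices: its entries are at least \<open>i / 2\<close>, and for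
  \<open>N \<ge> 2\<close> the factors \<open>N - 1\<close> and \<open>2 * N - 1\<close> of the sum
  of squares are at least \<open>N / 2\<close> and \<open>N\<close>.\<close>

lemma sum_incr_cov_square_ge:
  assumes "1/2 \<le> H" "2 \<le> N"
  shows "real N ^ 3 / 48 \<le> (\<Sum>i<N. \<Sum>k<N. incr_cov H i k * incr_cov H k i)"
proof -
  have "(\<Sum>i<N. (real i / 2)\<^sup>2) = (real N - 1) * real N * (2 * real N - 1) / 24"
    by (induction N) (simp_all add: field_simps power2_eq_square)
  moreover have "real N ^ 3 / 48 \<le> (real N - 1) * real N * (2 * real N - 1) / 24"
  proof -
    have "(real N / 2) * real N * real N \<le> (real N - 1) * real N * (2 * real N - 1)"
      using assms(2) by (intro mult_mono) auto
    then show ?thesis by (simp add: power3_eq_cube)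
  qed
  moreover have "(\<Sum>i<N. (real i / 2)\<^sup>2) \<le> (\<Sum>i<N. \<Sum>k<N. incr_cov H i k * incr_cov H k i)"
  proof (rule sum_mono)
    fix i assume i: "i \<in> {..<N}"
    have "(real i / 2)\<^sup>2 \<le> incr_cov H i i * incr_cov H i i"
      unfolding power2_eq_square using assms(1) by (intro mult_mono) (auto simp: incr_cov_diag)
    also have "\<dots> \<le> (\<Sum>k<N. incr_cov H i k * incr_cov H k i)"
      using i assms(1) by (intro member_le_sum[where f = "\<lambda>k. incr_cov H i k * incr_cov H k i"]) (auto simp: incr_cov_nonneg)
    finally show "(real i / 2)\<^sup>2 \<le> (\<Sum>k<N. incr_cov H i k * incr_cov H k i)" .
  qed
  ultimately show ?thesis by linarith
qed

text \<open>The largest row sum of a nonnegative symmetric matrix bounds its spectral norm; an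
  elementary argument replaces the spectrum. Bound \<open>C i k * C k m\<close> by half the sum of
  the squares: after renaming indices the two halves agree, and one free index sums to a
  row.\<close>

lemma sum_triple_product_le:
  fixes C :: "nat \<Rightarrow> nat \<Rightarrow> real"
  assumes nn: "\<And>i j. 0 \<le> C i j" and sym: "\<And>i j. C i j = C j i" and row: "\<And>i. i < N \<Longrightarrow> (\<Sum>j<N. C i j) \<le> S"
  shows "(\<Sum>i<N. \<Sum>k<N. \<Sum>m<N. C i k * C k m * C m i) \<le> S * (\<Sum>i<N. \<Sum>k<N. C i k * C k i)"
proof -
  let ?T = "\<Sum>i<N. \<Sum>k<N. C i k * C k i"
  have "C i k * C k m * C m i \<le> (C i k)\<^sup>2 * C i m / 2 + (C m k)\<^sup>2 * C m i / 2" for i k m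
  proof -
    have "0 \<le> (C i k - C m k)\<^sup>2" by simp
    then have "C i k * C k m \<le> ((C i k)\<^sup>2 + (C m k)\<^sup>2) / 2"
      using sym[of k m] by (simp add: power2_diff)
    from mult_right_mono[OF this nn[of m i]] show ?thesis
      using sym[of m i] by (simp add: field_simps)
  qed
  then have "(\<Sum>i<N. \<Sum>k<N. \<Sum>m<N. C i k * C k m * C m i) \<le>
     (\<Sum>i<N. \<Sum>k<N. \<Sum>m<N. (C i k)\<^sup>2 * C i m / 2 + (C m k)\<^sup>2 * C m i / 2)"
    by (intro sum_mono)
  also have "\<dots> = (\<Sum>i<N. \<Sum>k<N. \<Sum>m<N. (C i k)\<^sup>2 * C i m / 2) + (\<Sum>i<N. \<Sum>k<N. \<Sum>m<N. (C m k)\<^sup>2 * C m i / 2)"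
    by (simp add: sum.distrib)
  also have "(\<Sum>i<N. \<Sum>k<N. \<Sum>m<N. (C m k)\<^sup>2 * C m i / 2) = (\<Sum>i<N. \<Sum>m<N. \<Sum>k<N. (C m k)\<^sup>2 * C m i / 2)"
    by (intro sum.cong refl sum.swap)
  also have "\<dots> = (\<Sum>m<N. \<Sum>i<N. \<Sum>k<N. (C m k)\<^sup>2 * C m i / 2)"
    by (rule sum.swap)
  also have "\<dots> = (\<Sum>m<N. \<Sum>k<N. \<Sum>i<N. (C m k)\<^sup>2 * C m i / 2)"
    by (intro sum.cong refl sum.swap)
  also have "(\<Sum>i<N. \<Sum>k<N. \<Sum>m<N. (C i k)\<^sup>2 * C i m / 2) + (\<Sum>m<N. \<Sum>k<N. \<Sum>i<N. (C m k)\<^sup>2 * C m i / 2)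
     = (\<Sum>i<N. \<Sum>k<N. (C i k)\<^sup>2 * (\<Sum>m<N. C i m))"
    by (simp add: sum_distrib_left sum_distrib_right mult.commute flip: sum.distrib)
  also have "\<dots> \<le> (\<Sum>i<N. \<Sum>k<N. (C i k)\<^sup>2 * S)"
    using row by (intro sum_mono mult_left_mono) auto
  also have "\<dots> = S * ?T"
    using sym by (simp add: sum_distrib_left power2_eq_square mult_ac)
  finally show ?thesis .
qed

lemma sum_square_le:
  fixes C :: "nat \<Rightarrow> nat \<Rightarrow> real"
  assumes nn: "\<And>i j. 0 \<le> C i j" and row: "\<And>i. i < N \<Longrightarrow> (\<Sum>j<N. C i j) \<le> S"
    and entry: "\<And>i j. i < N \<Longrightarrow> j < N \<Longrightarrow> C i j \<le> B"
  shows "(\<Sum>i<N. \<Sum>k<N. C i k * C k i) \<le> N * (S * B)"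
proof -
  have "(\<Sum>k<N. C i k * C k i) \<le> S * B" if i: "i < N" for i
  proof -
    have "(\<Sum>k<N. C i k * C k i) \<le> (\<Sum>k<N. C i k * B)"
      using nn entry i by (intro sum_mono mult_left_mono) auto
    also have "\<dots> = (\<Sum>k<N. C i k) * B" by (simp add: sum_distrib_right)
    also have "\<dots> \<le> S * B"
      using row[OF i] order_trans[OF nn entry[OF i i]] by (intro mult_right_mono) auto
    finally show ?thesis .
  qed
  then have "(\<Sum>i<N. \<Sum>k<N. C i k * C k i) \<le> (\<Sum>i<N. S * B)"
    by (intro sum_mono) auto
  then show ?thesis by simp
qed

section \<open>The estimator\<close>

lemma (in gaussian_space) cov_le:
  assumes "X \<in> G" "Y \<in> G"
  shows "cov X Y \<le> (cov X X + cov Y Y) / 2"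
proof -
  have "0 \<le> (LINT \<omega>|M. (X \<omega> - Y \<omega>)\<^sup>2)" by simp
  also have "\<dots> = (LINT \<omega>|M. X \<omega> * X \<omega> + Y \<omega> * Y \<omega> - 2 * (X \<omega> * Y \<omega>))"
    by (simp add: power2_eq_square algebra_simps)
  also have "\<dots> = cov X X + cov Y Y - 2 * cov X Y"
    using integrable_G2 assms by (simp add: cov_def)
  finally show ?thesis by simp
qed

lemma wave_covariance_scale:
  assumes "0 < a" "0 \<le> s" "0 \<le> t"
  shows "a powr (2 * H + 1) * wave_covariance H (s / a) (t / a) = wave_covariance H s t"
proof -
  have m: "min (s / a) (t / a) = min s t / a" using assms by (auto simp: min_def divide_right_mono field_simps)
  have d: "\<bar>t / a - s / a\<bar> = \<bar>t - s\<bar> / a" using assms by (simp flip: diff_divide_distrib)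
  have p: "(y / a) powr e = y powr e / a powr e" if "0 \<le> y" for y e
    using that assms by (simp add: powr_divide)
  have a: "a powr (2 * H + 1) = a * a powr (2 * H)" "a powr (2 * H) > 0"
    using assms by (simp_all add: powr_add mult.commute)
  have alg: "a * A * (((S / (a * A) + T / (a * A) - D / (a * A)) / P - m / a * (E / A)) / 4) = ((S + T - D) / P - m * E) / 4"
    if "A > 0" for A S T D P m E :: real
  proof -
    have "S / (a * A) + T / (a * A) - D / (a * A) = (S + T - D) / (a * A)"
      by (simp add: add_divide_distrib diff_divide_distrib)
    moreover have "a * A * ((X / (a * A) / P - m / a * (E / A)) / 4) = (X / P - m * E) / 4" for X
      using that assms(1) by (cases "P = 0") (simp_all add: field_simps)
    ultimately show ?thesis by simp
  qed
  show ?thesis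
    unfolding wave_covariance_def m d p[OF assms(2)] p[OF assms(3)] p[OF abs_ge_zero] a
    by (rule alg[OF a(2)])
qed

section \<open>The observed solution: normalised increments and bounds for their traces\<close>

locale wave_observation =
  fixes M :: "'a measure" and H :: real and W :: "(real \<times> real \<Rightarrow> real) \<Rightarrow> 'a \<Rightarrow> real"
    and u :: "real \<Rightarrow> real \<Rightarrow> 'a \<Rightarrow> real" and x :: real
  assumes noise: "fractional_white_noise M H W" and solution: "mild_wave_solution M W u"
    and H_ge: "1/2 \<le> H" and H_less: "H < 1"
begin

sublocale prob_space M
  using noise by (simp add: fractional_white_noise_def)

abbreviation G :: "('a \<Rightarrow> real) set" where "G \<equiv> gaussian_span (noise_integrands H) W"

lemma jointly: "jointly_centred_gaussian M (noise_integrands H) W"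
  using noise by (simp add: fractional_white_noise_def)

sublocale gaussian_space M G
  by (rule gaussian_space_gaussian_span[OF jointly])

lemma u_version: "0 \<le> t \<Longrightarrow> AE \<omega> in M. u t x \<omega> = W (wave_integrand x t) \<omega>"
  using solution by (simp add: mild_wave_solution_def wave_integrand_def)

lemma measurable_u [measurable]: "0 \<le> t \<Longrightarrow> u t x \<in> borel_measurable M"
  using solution by (simp add: mild_wave_solution_def)

lemma u_in_G: "0 \<le> t \<Longrightarrow> u t x \<in> G"
  using wave_integrand_noise_integrands[OF H_ge] u_version by (intro gaussian_span_base[of "wave_integrand x t"]) auto

lemma cov_u:
  assumes "0 \<le> s" "0 \<le> t"
  shows "cov (u s x) (u t x) = wave_covariance H s t"
proof -
  have *: "cov (u s x) (u t x) = wave_covariance H s t" if st: "0 \<le> s" "s \<le> t" for s t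
  proof -
    have t: "0 \<le> t" using st by simp
    note I = wave_integrand_noise_integrands[OF H_ge, of _ x]
    have cg: "W (wave_integrand x r) \<in> borel_measurable M" if "0 \<le> r" for r
      using jointly[unfolded jointly_centred_gaussian_def, rule_format, of "{wave_integrand x r}" "\<lambda>_. 1"] I[OF that]
      by (simp add: centred_gaussian_def)
    have [measurable]: "W (wave_integrand x s) \<in> borel_measurable M" "W (wave_integrand x t) \<in> borel_measurable M"
      "u s x \<in> borel_measurable M" "u t x \<in> borel_measurable M"
      using st t by (auto intro!: cg measurable_u)
    have "AE \<omega> in M. u s x \<omega> * u t x \<omega> = W (wave_integrand x s) \<omega> * W (wave_integrand x t) \<omega>"
      using u_version[OF st(1)] u_version[OF t] by eventually_elim simp
    then have "cov (u s x) (u t x) = (LINT \<omega>|M. W (wave_integrand x s) \<omega> * W (wave_integrand x t) \<omega>)"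
      unfolding cov_def by (intro integral_cong_AE) auto
    also have "\<dots> = noise_cov H (wave_integrand x s) (wave_integrand x t)"
      using noise I st t by (simp add: fractional_white_noise_def)
    also have "\<dots> = wave_covariance H s t"
      by (rule noise_cov_wave_integrand[OF H_ge st])
    finally show ?thesis .
  qed
  show ?thesis
    using *[of s t] *[of t s] assms by (cases "s \<le> t") (auto simp: cov_commute wave_covariance_commute)
qed

text \<open>\<open>H + 1/2\<close> is the self-similarity index of the solution in time. With this
  factor the covariance matrix for smaller \<open>N\<close> is a block of the one for larger
  \<open>N\<close>.\<close>

definition Y :: "nat \<Rightarrow> nat \<Rightarrow> 'a \<Rightarrow> real" where
  "Y N i \<omega> = real N powr (H + 1/2) * (u (real (i + 1) / real N) x \<omega> - u (real i / real N) x \<omega>)"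

lemma Y_in_G: "Y N i \<in> G"
  unfolding Y_def[abs_def] by (intro scale_G diff_G u_in_G) auto

sublocale gv: gaussian_vector M G "{..<N}" "Y N" for N
  by unfold_locales (auto intro: Y_in_G)

abbreviation V :: "nat \<Rightarrow> 'a \<Rightarrow> real" where "V N \<equiv> gaussian_vector.V {..<N} (Y N)"

lemma cov_Y:
  assumes N: "N > 0"
  shows "cov (Y N i) (Y N j) = incr_cov H i j"
proof -
  define r where "r = real N powr (H + 1/2)"
  have rr: "r * r = real N powr (2 * H + 1)" unfolding r_def by (simp flip: powr_add)
  define U where "U k = u (real k / real N) x" for k :: nat
  have U: "U k \<in> G" for k by (simp add: U_def u_in_G)
  have Y: "Y N k = (\<lambda>\<omega>. r * U (k + 1) \<omega> + (- r) * U k \<omega>)" for k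
    by (simp add: Y_def U_def r_def algebra_simps fun_eq_iff)
  have c: "r * r * cov (U k) (U l) = wave_covariance H (real k) (real l)" for k l
    unfolding rr U_def using N by (simp add: cov_u wave_covariance_scale)
  have "cov (Y N i) (Y N j) = r * r * cov (U (i + 1)) (U (j + 1)) - r * r * cov (U i) (U (j + 1))
     - r * r * cov (U (i + 1)) (U j) + r * r * cov (U i) (U j)"
    unfolding Y cov_lin(2)[OF U U lin_G[OF U U]] cov_lin(1)[OF U U U] by (simp add: algebra_simps)
  then show ?thesis unfolding c by (simp add: incr_cov_def)
qed

abbreviation p :: real where "p \<equiv> 2 * H + 1"

definition t1 :: "nat \<Rightarrow> real" where "t1 N = real N * (real N - 1) / 4 + real N / (2 * p)"
definition t2 :: "nat \<Rightarrow> real" where "t2 N = (\<Sum>i<N. \<Sum>k<N. incr_cov H i k * incr_cov H k i)"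
definition t3 :: "nat \<Rightarrow> real" where "t3 N = (\<Sum>i<N. \<Sum>k<N. \<Sum>m<N. incr_cov H i k * incr_cov H k m * incr_cov H m i)"

lemma trC_eq: "gv.trC N = t1 N" and trC2_eq: "gv.trC2 N = t2 N" and trC3_eq: "gv.trC3 N = t3 N"
proof -
  have "N > 0" if "i < N" for i using that by simp
  then show "gv.trC N = t1 N" "gv.trC2 N = t2 N" "gv.trC3 N = t3 N"
    unfolding gv.trC_def gv.trC2_def gv.trC3_def t1_def sum_incr_cov_diag[OF H_ge, symmetric] t2_def t3_def
    by (auto intro!: sum.cong simp: cov_Y)
qed

lemma incr_cov_diag_le: "i < N \<Longrightarrow> incr_cov H i i \<le> real N"
proof -
  assume i: "i < N"
  have "1 / (2 * (2 * H + 1)) \<le> 1 / 2" using H_ge by (intro divide_left_mono) auto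
  then show ?thesis using i by (simp add: incr_cov_diag[OF H_ge])
qed

lemma incr_cov_entry_le: "i < N \<Longrightarrow> j < N \<Longrightarrow> incr_cov H i j \<le> real N"
  using cov_le[OF Y_in_G Y_in_G, of N i N j] incr_cov_diag_le[of i N] incr_cov_diag_le[of j N]
  by (simp add: cov_Y)

lemma row_sum: "i < N \<Longrightarrow> (\<Sum>j<N. incr_cov H i j) \<le> real N powr (2 * H)"
  using incr_cov_row_sum[OF H_ge] H_less by simp

text \<open>There are \<open>N\<close> rows, with sums at most \<open>N powr (2 * H)\<close> and
  entries at most \<open>N\<close>. This crude bound still lets \<open>(t1 N)^2 / t2 N\<close> grow
  like a positive power of \<open>N\<close> when \<open>H < 1\<close>.\<close>

lemma t2_le: "t2 N \<le> real N powr (2 * H + 2)"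
proof (cases "N = 0")
  case False
  have "t2 N \<le> real N * (real N powr (2 * H) * real N)"
    unfolding t2_def by (intro sum_square_le incr_cov_nonneg H_ge row_sum incr_cov_entry_le)
  also have "\<dots> = real N powr (2 * H + 2)"
    using False by (simp add: powr_add power2_eq_square)
  finally show ?thesis .
qed (simp add: t2_def)

lemma t2_ge: "2 \<le> N \<Longrightarrow> real N ^ 3 / 48 \<le> t2 N"
  unfolding t2_def by (rule sum_incr_cov_square_ge[OF H_ge])

lemma t2_pos: "2 \<le> N \<Longrightarrow> 0 < t2 N"
  by (rule less_le_trans[OF _ t2_ge]) auto

lemma t3_le: "t3 N \<le> real N powr (2 * H) * t2 N"
  unfolding t2_def t3_def by (intro sum_triple_product_le incr_cov_nonneg H_ge incr_cov_commute row_sum)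

lemma t3_nonneg: "0 \<le> t3 N"
  unfolding t3_def by (intro sum_nonneg mult_nonneg_nonneg incr_cov_nonneg H_ge)

lemma t1_ge: "2 \<le> N \<Longrightarrow> (real N)\<^sup>2 / 8 \<le> t1 N"
proof -
  assume N: "2 \<le> N"
  have "(real N)\<^sup>2 / 8 \<le> real N * (real N - 1) / 4"
    using mult_left_mono[of 2 "real N" "real N"] N by (simp add: power2_eq_square field_simps)
  moreover have "0 \<le> real N / (2 * p)" using H_ge by simp
  ultimately show ?thesis unfolding t1_def by linarith
qed

lemma sum_increments_eq:
  assumes N: "N > 0"
  shows "(\<Sum>i<N. (u (real (i + 1) / real N) x \<omega> - u (real i / real N) x \<omega>)\<^sup>2) = V N \<omega> / real N powr (2 * H + 1)"
proof -
  have "(real N powr (H + 1/2))\<^sup>2 = real N powr (2 * H + 1)"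
    by (simp add: power2_eq_square flip: powr_add)
  then have "V N \<omega> = real N powr (2 * H + 1) * (\<Sum>i<N. (u (real (i + 1) / real N) x \<omega> - u (real i / real N) x \<omega>)\<^sup>2)"
    unfolding gv.V_def Y_def by (simp add: power_mult_distrib sum_distrib_left)
  then show ?thesis using N by simp
qed

text \<open>The inner logarithm is left unexpanded, so the identity also holds at outcomes with
  \<open>V N \<omega> = 0\<close>; \<open>hurst_estimator_minus\<close> expands it for positive
  values.\<close>

lemma hurst_estimator_eq:
  assumes "N > 0"
  shows "hurst_estimator u x N \<omega> = - ((ln 4 + ln (V N \<omega> / (real N)\<^sup>2 / real N powr (2 * H))) / (2 * ln (real N)))"
proof -
  have "1 / real N * (V N \<omega> / real N powr (2 * H + 1)) = V N \<omega> / (real N)\<^sup>2 / real N powr (2 * H)"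
    using assms by (simp add: powr_add power2_eq_square)
  then show ?thesis
    unfolding hurst_estimator_def sum_increments_eq[OF assms] by (rule arg_cong)
qed

lemma hurst_estimator_minus:
  assumes "2 \<le> N" "0 < v"
  shows "- ((ln 4 + ln (v / (real N)\<^sup>2 / real N powr (2 * H))) / (2 * ln (real N))) - H = - (ln (4 * v / (real N)\<^sup>2) / (2 * ln (real N)))"
proof -
  have "ln (v / (real N)\<^sup>2 / real N powr (2 * H)) = ln (v / (real N)\<^sup>2) - 2 * H * ln (real N)"
  proof -
    have "ln (v / (real N)\<^sup>2 / real N powr (2 * H)) = ln (v / (real N)\<^sup>2) - ln (real N powr (2 * H))"
      by (rule ln_divide_pos) (use assms in auto)
    then show ?thesis using assms by (simp add: ln_powr)
  qed
  moreover have "ln (4 * v / (real N)\<^sup>2) = ln 4 + ln (v / (real N)\<^sup>2)"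
    using assms ln_mult[of 4 "v / (real N)\<^sup>2"] by simp
  moreover have "ln (real N) > 0" using assms by simp
  ultimately show ?thesis by (simp add: field_simps)
qed

lemma measurable_hurst_estimator: "hurst_estimator u x N \<in> borel_measurable M"
proof -
  have [measurable]: "u (real i / real N) x \<in> borel_measurable M" for i
    by (rule measurable_u) simp
  show ?thesis unfolding hurst_estimator_def[abs_def] by measurable
qed

section \<open>Tail bounds for the quadratic variation and strong consistency\<close>

lemma summable_lower_tail: "summable (\<lambda>N. prob {\<omega> \<in> space M. V N \<omega> \<le> t1 N / 2})"
proof (rule summable_comparison_test_ev)
  \<comment> \<open>From \<open>t1 \<ge> N^2 / 8\<close> and
    \<open>t2 \<le> N powr (2 * H + 2)\<close> the exponent \<open>t1^2 / (16 * t2)\<close> is at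
    least \<open>N powr a / 1024\<close>; \<open>a > 0\<close> is exactly
    \<open>H < 1\<close>.\<close>
  define a where "a = 2 - 2 * H"
  have a: "a > 0" using H_less by (simp add: a_def)
  show "eventually (\<lambda>N. norm (prob {\<omega> \<in> space M. V N \<omega> \<le> t1 N / 2}) \<le> exp (- (real N powr a) / 1024)) sequentially"
    using eventually_ge_at_top[of 2]
  proof eventually_elim
    case (elim N)
    have t2: "0 < t2 N" by (rule t2_pos[OF elim])
    have t1: "0 \<le> t1 N" using t1_ge[OF elim] by (rule order_trans[rotated]) simp
    have "prob {\<omega> \<in> space M. V N \<omega> \<le> t1 N / 2} \<le> exp (- (t1 N)\<^sup>2 / (16 * t2 N))"
      using gv.prob_V_small_le[of N] t1 t2 by (simp add: trC_eq trC2_eq)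
    also have "\<dots> \<le> exp (- (real N powr a) / 1024)"
    proof -
      have "real N powr a * t2 N \<le> real N powr a * real N powr (2 * H + 2)"
        by (intro mult_left_mono t2_le) simp
      also have "\<dots> = 64 * ((real N)\<^sup>2 / 8)\<^sup>2"
      proof -
        have "real N powr a * real N powr (2 * H + 2) = real N powr 4"
          by (simp add: a_def flip: powr_add)
        then show ?thesis using elim by (simp add: power_divide flip: power_mult)
      qed
      also have "\<dots> \<le> 64 * (t1 N)\<^sup>2"
        using t1_ge[OF elim] by (intro mult_left_mono power_mono) auto
      finally have "(real N powr a) / 1024 \<le> (t1 N)\<^sup>2 / (16 * t2 N)"
        using t2 by (simp add: field_simps)
      then show ?thesis by simp
    qed
    finally show ?case by simp
  qed
  show "summable (\<lambda>N. exp (- (real N powr a) / 1024))"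
  proof (rule summable_comparison_test_bigo)
    show "summable (\<lambda>n. norm (real n powr (-2)))"
      by (simp add: summable_real_powr_iff)
    show "(\<lambda>N. exp (- (real N powr a) / 1024)) \<in> O(\<lambda>n. real n powr (-2))"
      using a by real_asymp
  qed
qed

text \<open>If \<open>V\<close> exceeds \<open>12 * N^2 * ln N\<close>, some squared increment is at
  least \<open>12 * N * ln N\<close>. Variances are at most \<open>N\<close>, so each such event has
  probability at most \<open>2 * N powr (-3)\<close>, and the union bound over \<open>N\<close>
  increments remains summable. Dependence between increments is irrelevant here.\<close>

lemma summable_upper_tail: "summable (\<lambda>N. prob {\<omega> \<in> space M. 12 * (real N)\<^sup>2 * ln (real N) < V N \<omega>})"
proof (rule summable_comparison_test_ev)
  show "summable (\<lambda>N. 2 * real N powr (-2))"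
    by (intro summable_mult) (simp add: summable_real_powr_iff)
  show "eventually (\<lambda>N. norm (prob {\<omega> \<in> space M. 12 * (real N)\<^sup>2 * ln (real N) < V N \<omega>}) \<le> 2 * real N powr (-2)) sequentially"
    using eventually_ge_at_top[of 2]
  proof eventually_elim
    case (elim N)
    let ?a = "12 * real N * ln (real N)"
    let ?E = "\<lambda>i. {\<omega> \<in> space M. ?a \<le> (Y N i \<omega>)\<^sup>2}"
    have a: "?a > 0" using elim by simp
    note [measurable] = Y_in_G[THEN measurable_G]
    have "{\<omega> \<in> space M. 12 * (real N)\<^sup>2 * ln (real N) < V N \<omega>} \<subseteq> (\<Union>i<N. ?E i)"
    proof (rule subsetI, rule ccontr)
      fix \<omega> assume w: "\<omega> \<in> {\<omega> \<in> space M. 12 * (real N)\<^sup>2 * ln (real N) < V N \<omega>}" "\<omega> \<notin> (\<Union>i<N. ?E i)"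
      then have "V N \<omega> \<le> (\<Sum>i<N. ?a)"
        unfolding gv.V_def by (intro sum_mono) (auto simp: not_le intro: less_imp_le)
      then show False using w by (simp add: power2_eq_square)
    qed
    then have "prob {\<omega> \<in> space M. 12 * (real N)\<^sup>2 * ln (real N) < V N \<omega>} \<le> prob (\<Union>i<N. ?E i)"
      by (intro finite_measure_mono) auto
    also have "\<dots> \<le> (\<Sum>i<N. prob (?E i))"
      by (intro finite_measure_subadditive_finite) auto
    also have "\<dots> \<le> (\<Sum>i<N. 2 * exp (- ?a / (4 * real N)))"
    proof (rule sum_mono)
      fix i assume i: "i \<in> {..<N}"
      have "(LINT \<omega>|M. (Y N i \<omega>)\<^sup>2) \<le> real N"
        using incr_cov_diag_le[of i N] cov_Y[of N i i] i elim by (simp add: cov_def power2_eq_square)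
      then show "prob (?E i) \<le> 2 * exp (- ?a / (4 * real N))"
        using a elim by (intro centred_gaussian_tail gaussian_span_centred_gaussian[OF jointly] Y_in_G) auto
    qed
    also have "\<dots> = 2 * real N powr (-2)"
    proof -
      have "- ?a / (4 * real N) = -3 * ln (real N)" using elim by simp
      then have "exp (- ?a / (4 * real N)) = real N powr (-3)"
        using elim by (simp add: powr_def)
      then show ?thesis using elim powr_mult_base[of "real N" "-3"] by simp
    qed
    finally show ?case by simp
  qed
qed

text \<open>By Borel-Cantelli \<open>4 * V / N^2\<close> eventually lies between
  \<open>1 / 4\<close> and \<open>48 * ln N\<close>. The error is minus its logarithm divided by
  \<open>2 * ln N\<close>, which tends to 0 even with the logarithmic upper bound.\<close>

lemma strongly_consistent: "strongly_consistent M (hurst_estimator u x) H"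
  unfolding strongly_consistent_def
proof (intro conjI allI measurable_hurst_estimator)
  have "AE \<omega> in M. eventually (\<lambda>N. \<omega> \<in> space M - {\<omega> \<in> space M. V N \<omega> \<le> t1 N / 2}) sequentially"
    by (rule borel_cantelli_AE1[OF _ _ summable_lower_tail]) (simp_all add: less_top[symmetric])
  moreover have "AE \<omega> in M. eventually (\<lambda>N. \<omega> \<in> space M - {\<omega> \<in> space M. 12 * (real N)\<^sup>2 * ln (real N) < V N \<omega>}) sequentially"
    by (rule borel_cantelli_AE1[OF _ _ summable_upper_tail]) (simp_all add: less_top[symmetric])
  ultimately show "AE \<omega> in M. (\<lambda>N. hurst_estimator u x N \<omega>) \<longlonglongrightarrow> H"
  proof eventually_elim
    case (elim \<omega>)
    have bounds: "eventually (\<lambda>N. - (ln (48 * ln (real N)) / (2 * ln (real N))) \<le> hurst_estimator u x N \<omega> - H \<and>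
       hurst_estimator u x N \<omega> - H \<le> - (ln (1 / 4) / (2 * ln (real N)))) sequentially"
      using elim eventually_ge_at_top[of 2]
    proof eventually_elim
      case (elim N)
      have lo: "(real N)\<^sup>2 / 16 \<le> V N \<omega>" and up: "V N \<omega> \<le> 12 * (real N)\<^sup>2 * ln (real N)"
        using elim t1_ge[of N] by auto
      have N: "(real N)\<^sup>2 > 0" "ln (real N) > 0" using elim by auto
      then have V: "V N \<omega> > 0" using lo by (intro less_le_trans[OF _ lo]) auto
      have eq: "hurst_estimator u x N \<omega> - H = - (ln (4 * V N \<omega> / (real N)\<^sup>2) / (2 * ln (real N)))"
      proof -
        have "2 \<le> N" "0 < N" using elim by auto
        then show ?thesis
          unfolding hurst_estimator_eq[OF \<open>0 < N\<close>] by (intro hurst_estimator_minus V)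
      qed
      have "1 / 4 \<le> 4 * V N \<omega> / (real N)\<^sup>2" "4 * V N \<omega> / (real N)\<^sup>2 \<le> 48 * ln (real N)"
        using lo up N by (simp_all add: field_simps)
      then have "ln (1 / 4) \<le> ln (4 * V N \<omega> / (real N)\<^sup>2)" "ln (4 * V N \<omega> / (real N)\<^sup>2) \<le> ln (48 * ln (real N))"
        by (subst ln_le_cancel_iff; use N V in auto)+
      then show ?case
        unfolding eq using N by (auto intro!: divide_right_mono)
    qed
    have "(\<lambda>N. hurst_estimator u x N \<omega> - H) \<longlonglongrightarrow> 0"
    proof (rule tendsto_sandwich)
      show "(\<lambda>N. - (ln (48 * ln (real N)) / (2 * ln (real N)))) \<longlonglongrightarrow> 0" by real_asymp
      show "(\<lambda>N. - (ln (1 / 4) / (2 * ln (real N)))) \<longlonglongrightarrow> 0" by real_asymp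
    qed (use bounds in \<open>auto elim: eventually_mono\<close>)
    then show ?case by (rule LIM_zero_cancel)
  qed
qed

section \<open>Asymptotic normality\<close>

text \<open>Standard deviation of \<open>4 V / N\<^sup>2\<close>, whose logarithm is \<open>2 ln N\<close> times the estimation error.\<close>

definition \<tau> :: "nat \<Rightarrow> real" where "\<tau> N = 4 * sqrt (2 * t2 N) / (real N)\<^sup>2"

lemma \<tau>_pos: "2 \<le> N \<Longrightarrow> 0 < \<tau> N"
  using t2_pos[of N] by (simp add: \<tau>_def)

lemma \<tau>_tendsto_0: "\<tau> \<longlonglongrightarrow> 0"
proof -
  define a where "a = H - 1"
  have a: "a < 0" using H_less by (simp add: a_def)
  have le: "\<tau> N \<le> 4 * sqrt 2 * real N powr a" if "2 \<le> N" for N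
  proof -
    have "sqrt (2 * t2 N) \<le> sqrt (2 * real N powr (2 * H + 2))"
      using t2_le[of N] by simp
    also have "\<dots> = sqrt 2 * real N powr (H + 1)"
      by (simp add: real_sqrt_mult powr_half_sqrt[symmetric] powr_powr add_divide_distrib)
    also have "\<dots> = sqrt 2 * (real N powr a * (real N)\<^sup>2)"
    proof -
      have "real N powr a * (real N)\<^sup>2 = real N powr (a + 2)"
        using that by (simp add: powr_add)
      then show ?thesis by (simp add: a_def add.commute)
    qed
    finally show ?thesis
      using that by (simp add: \<tau>_def field_simps)
  qed
  have "eventually (\<lambda>N. \<tau> N \<le> 4 * sqrt 2 * real N powr a) sequentially"
    by (rule eventually_mono[OF eventually_ge_at_top[of 2]]) (rule le)
  moreover have "eventually (\<lambda>N. 0 \<le> \<tau> N) sequentially"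
    using eventually_ge_at_top[of 2] by eventually_elim (auto dest: \<tau>_pos)
  moreover have "(\<lambda>N. 4 * sqrt 2 * real N powr a) \<longlonglongrightarrow> 0"
    using a by real_asymp
  ultimately show ?thesis
    by (intro tendsto_sandwich[of "\<lambda>_. 0" \<tau> sequentially "\<lambda>N. 4 * sqrt 2 * real N powr a"]) auto
qed

lemma inverse_\<tau>_le:
  assumes "2 \<le> N"
  shows "1 / \<tau> N \<le> 2 * sqrt (real N)"
proof -
  have N: "real N > 0" using assms by simp
  \<comment> \<open>The available bound is \<open>N^3 / 24\<close>; it is weakened to 64 so that the
    root is \<open>N * sqrt N / 8\<close>.\<close>
  have "real N ^ 3 / 64 \<le> 2 * t2 N" using t2_ge[OF assms] N
    by (smt (verit) field_sum_of_halves divide_left_mono zero_less_power t2_pos[OF assms] frac_le)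
  then have "sqrt (real N ^ 3 / 64) \<le> sqrt (2 * t2 N)" by simp
  moreover have "sqrt (real N ^ 3 / 64) = real N * sqrt (real N) / 8"
    using N by (simp add: real_sqrt_divide power3_eq_cube real_sqrt_mult)
  ultimately have "real N * sqrt (real N) / 8 \<le> sqrt (2 * t2 N)" by simp
  then have "(real N)\<^sup>2 / (4 * sqrt (2 * t2 N)) \<le> (real N)\<^sup>2 / (4 * (real N * sqrt (real N) / 8))"
    using N by (intro divide_left_mono mult_left_mono mult_pos_pos) (use t2_pos[OF assms] in auto)
  also have "\<dots> = 2 * sqrt (real N)"
    using N by (simp add: power2_eq_square field_simps real_div_sqrt)
  finally show ?thesis by (simp add: \<tau>_def)
qed

text \<open>The relative bias: \<open>4 * V N / N^2\<close> has expectation \<open>1 + b N\<close>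
  for positive \<open>N\<close>.\<close>

definition b :: "nat \<Rightarrow> real" where "b N = (2 / p - 1) / real N"

lemma t1_eq: "N > 0 \<Longrightarrow> 4 * t1 N / (real N)\<^sup>2 = 1 + b N"
proof -
  assume N: "N > 0"
  have gen: "4 * (n * (n - 1) / 4 + n / (2 * q)) / n\<^sup>2 = 1 + (2 / q - 1) / n" if "n > 0" "q > 0" for n q :: real
    using that by (simp add: field_simps power2_eq_square)
  show ?thesis unfolding t1_def b_def by (rule gen) (use N H_ge in auto)
qed

lemma b_tendsto_0: "b \<longlonglongrightarrow> 0"
  unfolding b_def[abs_def] by real_asymp

text \<open>The bias is of order at most \<open>1 / N\<close> and the standard deviation at least
  \<open>1 / (2 * sqrt N)\<close>, so centring at the true \<open>H\<close> is legitimate.\<close>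

lemma b_div_\<tau>_tendsto_0: "(\<lambda>N. b N / \<tau> N) \<longlonglongrightarrow> 0"
proof (rule Lim_null_comparison)
  define d where "d = \<bar>2 / p - 1\<bar>"
  show "eventually (\<lambda>N. norm (b N / \<tau> N) \<le> d / real N * (2 * sqrt (real N))) sequentially"
    using eventually_ge_at_top[of 2]
  proof eventually_elim
    case (elim N)
    have "norm (b N / \<tau> N) = d / real N * (1 / \<tau> N)"
      using \<tau>_pos[OF elim] by (simp add: b_def d_def abs_divide)
    also have "\<dots> \<le> d / real N * (2 * sqrt (real N))"
      by (intro mult_left_mono inverse_\<tau>_le elim) (simp add: d_def)
    finally show ?case .
  qed
  show "(\<lambda>N. d / real N * (2 * sqrt (real N))) \<longlonglongrightarrow> 0" by real_asymp
qed

text \<open>The normalised estimation error as a function of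
  \<open>y = (t1 N - V N) / sqrt (2 * t2 N)\<close>. It copies the unexpanded logarithms of the
  estimator, so that the two agree at every outcome.\<close>

definition h :: "nat \<Rightarrow> real \<Rightarrow> real" where
  "h N y = 2 * ln (real N) / \<tau> N * (- ((ln 4 + ln ((t1 N - sqrt (2 * t2 N) * y) / (real N)\<^sup>2 / real N powr (2 * H))) / (2 * ln (real N))) - H)"

text \<open>Here \<open>4 * V / N^2\<close> becomes \<open>1 + \<delta>\<close> with
  \<open>\<delta> = b - \<tau> * X\<close>, and \<open>\<delta> / \<tau>\<close> tends to
  \<open>- y\<close>. Replacing \<open>ln (1 + \<delta>)\<close> by \<open>\<delta>\<close> costs at
  most \<open>2 * \<delta>^2\<close>, which after division by \<open>\<tau>\<close> is
  \<open>2 * (\<delta> / \<tau>)^2 * \<tau>\<close> and vanishes.\<close>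

lemma h_tendsto:
  assumes X: "X \<longlonglongrightarrow> y"
  shows "(\<lambda>N. h N (X N)) \<longlonglongrightarrow> y"
proof -
  define \<delta> where "\<delta> N = b N - \<tau> N * X N" for N
  have \<delta>0: "\<delta> \<longlonglongrightarrow> 0"
    unfolding \<delta>_def[abs_def] using tendsto_diff[OF b_tendsto_0 tendsto_mult[OF \<tau>_tendsto_0 X]] by simp
  have "(\<lambda>N. b N / \<tau> N - X N) \<longlonglongrightarrow> 0 - y"
    by (intro tendsto_diff b_div_\<tau>_tendsto_0 X)
  moreover have ev: "eventually (\<lambda>N. b N / \<tau> N - X N = \<delta> N / \<tau> N) sequentially"
    using eventually_ge_at_top[of 2]
    by eventually_elim (use \<tau>_pos in \<open>force simp: \<delta>_def diff_divide_distrib\<close>)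
  ultimately have \<delta>\<tau>: "(\<lambda>N. \<delta> N / \<tau> N) \<longlonglongrightarrow> - y"
    using tendsto_cong[OF ev] by simp
  have small: "eventually (\<lambda>N. \<bar>\<delta> N\<bar> < 1/2) sequentially"
    using order_tendstoD(2)[OF tendsto_rabs_zero[OF \<delta>0], of "1/2"] by simp
  have ev2: "eventually (\<lambda>N. norm (h N (X N) - (- (\<delta> N / \<tau> N))) \<le> 2 * (\<delta> N / \<tau> N)\<^sup>2 * \<tau> N) sequentially"
    using small eventually_ge_at_top[of 2]
  proof eventually_elim
    case (elim N)
    have N: "real N > 0" "ln (real N) > 0" and \<tau>: "\<tau> N > 0" using elim \<tau>_pos by auto
    let ?v = "t1 N - sqrt (2 * t2 N) * X N"
    have v: "4 * ?v / (real N)\<^sup>2 = 1 + \<delta> N"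
    proof -
      have "4 * ?v / (real N)\<^sup>2 = 4 * t1 N / (real N)\<^sup>2 - \<tau> N * X N"
        by (simp add: \<tau>_def diff_divide_distrib)
      then show ?thesis using t1_eq[of N] N by (simp add: \<delta>_def)
    qed
    have "0 < 4 * ?v / (real N)\<^sup>2" unfolding v using elim by simp
    then have "?v > 0" using N by (simp add: zero_less_divide_iff)
    then have "h N (X N) = 2 * ln (real N) / \<tau> N * - (ln (4 * ?v / (real N)\<^sup>2) / (2 * ln (real N)))"
      unfolding h_def using hurst_estimator_minus[OF elim(2)] by simp
    then have "h N (X N) = - (ln (1 + \<delta> N) / \<tau> N)"
      unfolding v using N by simp
    then have "norm (h N (X N) - (- (\<delta> N / \<tau> N))) = \<bar>ln (1 + \<delta> N) - \<delta> N\<bar> / \<tau> N"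
      using \<tau> by (simp add: abs_divide abs_minus_commute flip: diff_divide_distrib)
    also have "\<dots> \<le> 2 * (\<delta> N)\<^sup>2 / \<tau> N"
      using elim \<tau> by (intro divide_right_mono abs_ln_one_plus_x_minus_x_bound) auto
    also have "\<dots> = 2 * (\<delta> N / \<tau> N)\<^sup>2 * \<tau> N"
      using \<tau> by (simp add: power2_eq_square)
    finally show ?case .
  qed
  have "(\<lambda>N. 2 * (\<delta> N / \<tau> N)\<^sup>2 * \<tau> N) \<longlonglongrightarrow> 2 * (- y)\<^sup>2 * 0"
    by (intro tendsto_intros \<delta>\<tau> \<tau>_tendsto_0)
  then have "(\<lambda>N. 2 * (\<delta> N / \<tau> N)\<^sup>2 * \<tau> N) \<longlonglongrightarrow> 0" by simp
  with ev2 have "(\<lambda>N. h N (X N) - (- (\<delta> N / \<tau> N))) \<longlonglongrightarrow> 0"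
    by (rule Lim_null_comparison)
  from tendsto_add[OF this tendsto_minus[OF \<delta>\<tau>]] show ?thesis by simp
qed

text \<open>One factor \<open>t2\<close> cancels by \<open>t3_le\<close>, leaving
  \<open>N powr (2 * H)\<close> over a multiple of \<open>sqrt t2\<close>, whose order is at least
  \<open>N powr (3/2)\<close>. The resulting exponent \<open>2 * H - 3/2\<close> is negative exactly
  for \<open>H < 3/4\<close>.\<close>

lemma third_trace_ratio:
  assumes "H < 3/4"
  shows "(\<lambda>N. t3 N / sqrt (2 * t2 N) ^ 3) \<longlonglongrightarrow> 0"
proof -
  define a where "a = 2 * H - 3/2"
  have a: "a < 0" using assms by (simp add: a_def)
  have "eventually (\<lambda>N. norm (t3 N / sqrt (2 * t2 N) ^ 3) \<le> 4 * real N powr a) sequentially"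
    using eventually_ge_at_top[of 2]
  proof eventually_elim
    case (elim N)
    have t2: "t2 N > 0" by (rule t2_pos[OF elim])
    have N: "real N > 0" using elim by simp
    have "sqrt (2 * t2 N) ^ 3 = 2 * t2 N * sqrt (2 * t2 N)"
      using t2 by (simp add: power3_eq_cube)
    then have "norm (t3 N / sqrt (2 * t2 N) ^ 3) = t3 N / (2 * t2 N * sqrt (2 * t2 N))"
      using t3_nonneg[of N] t2 by simp
    also have "\<dots> \<le> real N powr (2 * H) * t2 N / (2 * t2 N * sqrt (2 * t2 N))"
      using t2 by (intro divide_right_mono t3_le) simp
    also have "\<dots> = real N powr (2 * H) * (2 * (1 / \<tau> N) / (real N)\<^sup>2)"
      using t2 N by (simp add: \<tau>_def field_simps)
    also have "\<dots> \<le> real N powr (2 * H) * (2 * (2 * sqrt (real N)) / (real N)\<^sup>2)"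
      by (intro mult_left_mono divide_right_mono inverse_\<tau>_le elim) auto
    also have "\<dots> = 4 * real N powr a"
    proof -
      have "real N powr (2 * H) * sqrt (real N) = real N powr a * (real N)\<^sup>2"
      proof -
        have "real N powr (2 * H) * sqrt (real N) = real N powr (2 * H + 1/2)"
          using N by (simp add: powr_add powr_half_sqrt)
        also have "\<dots> = real N powr a * real N powr 2"
          by (subst powr_add[symmetric]) (simp add: a_def add.commute)
        finally show ?thesis using N by simp
      qed
      then show ?thesis using N by (simp add: field_simps)
    qed
    finally show ?case .
  qed
  moreover have "(\<lambda>N. 4 * real N powr a) \<longlonglongrightarrow> 0" using a by real_asymp
  ultimately show ?thesis by (rule Lim_null_comparison)
qed

lemma asymptotically_normal:
  assumes "H < 3/4"
  shows "asymptotically_normal M (hurst_estimator u x) H"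
  unfolding asymptotically_normal_def
proof (intro conjI allI measurable_hurst_estimator exI)
  let ?a = "\<lambda>N. 2 * ln (real N) / \<tau> N"
  let ?F = "\<lambda>N \<omega>. (t1 N - V N \<omega>) / sqrt (2 * t2 N)"
  have t2ev: "eventually (\<lambda>N. 0 < t2 N) sequentially"
    using eventually_ge_at_top[of 2] by eventually_elim (rule t2_pos)
  show "filterlim ?a at_top sequentially"
  proof (rule filterlim_at_top_mono)
    show "filterlim (\<lambda>N. 2 * ln (real N)) at_top sequentially" by real_asymp
    \<comment> \<open>Dividing by \<open>\<tau> N < 1\<close> only enlarges \<open>2 * ln N\<close>,
      so the normalising sequence diverges.\<close>
    have "eventually (\<lambda>N. \<tau> N < 1) sequentially"
      using order_tendstoD(2)[OF \<tau>_tendsto_0, of 1] by simp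
    then show "eventually (\<lambda>N. 2 * ln (real N) \<le> ?a N) sequentially"
      using eventually_ge_at_top[of 2]
    proof eventually_elim
      case (elim N)
      have "2 * ln (real N) / 1 \<le> 2 * ln (real N) / \<tau> N"
        using elim \<tau>_pos[of N] by (intro divide_left_mono) auto
      then show ?case by simp
    qed
  qed
  have clt: "weak_conv_m (\<lambda>N. distr M borel (?F N)) std_normal_distribution"
    using quadratic_form_clt[OF gv.gaussian_vector_axioms] t2ev third_trace_ratio[OF assms]
    by (simp add: trC_eq trC2_eq trC3_eq)
  have meas: "h N \<in> borel_measurable borel" for N
    unfolding h_def[abs_def] by measurable
  have "weak_conv_m (\<lambda>N. distr M borel (\<lambda>\<omega>. h N (?F N \<omega>))) std_normal_distribution"
    by (rule weak_conv_extended_mapping[OF prob_space_axioms _ real_dist_normal_dist clt meas h_tendsto]) measurable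
  moreover have "h N (?F N \<omega>) = ?a N * (hurst_estimator u x N \<omega> - H)" for N \<omega>
  proof (cases "2 \<le> N")
    case True
    have "t1 N - sqrt (2 * t2 N) * ?F N \<omega> = V N \<omega>" using t2_pos[OF True] by simp
    then show ?thesis
      using True unfolding h_def by (subst hurst_estimator_eq) auto
  next
    case False
    \<comment> \<open>In both cases \<open>ln (real N) = 0\<close> (for \<open>N = 0\<close> by the
      convention for \<open>ln 0\<close>), so the normalising factor and hence both sides
      vanish.\<close>
    then have "N = 0 \<or> N = 1" by auto
    then show ?thesis by (auto simp: h_def)
  qed
  ultimately show "weak_conv_m (\<lambda>N. distr M borel (\<lambda>\<omega>. ?a N * (hurst_estimator u x N \<omega> - H)))
      (density lborel (normal_density 0 1))"
    by simp
qed simp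

end

theorem theorem5:
  fixes M :: "'a measure"
    and W :: "(real \<times> real \<Rightarrow> real) \<Rightarrow> 'a \<Rightarrow> real"
    and u :: "real \<Rightarrow> real \<Rightarrow> 'a \<Rightarrow> real"
    and H x :: real
  assumes "fractional_white_noise M H W"
    and "mild_wave_solution M W u"
  shows "(1/2 \<le> H \<and> H < 3/4 \<longrightarrow>
            strongly_consistent M (hurst_estimator u x) H \<and>
            asymptotically_normal M (hurst_estimator u x) H) \<and>
         (3/4 < H \<and> H < 1 \<longrightarrow>
            strongly_consistent M (hurst_estimator u x) H)"
proof (intro conjI impI)
  assume H: "1/2 \<le> H \<and> H < 3/4"
  interpret wave_observation M H W u x
    using assms H by unfold_locales auto
  show "strongly_consistent M (hurst_estimator u x) H" by (rule strongly_consistent)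
  show "asymptotically_normal M (hurst_estimator u x) H"
    using H by (intro asymptotically_normal) auto
next
  assume H: "3/4 < H \<and> H < 1"
  interpret wave_observation M H W u x
    using assms H by unfold_locales auto
  show "strongly_consistent M (hurst_estimator u x) H" by (rule strongly_consistent)
qed

end
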